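(* Let $K$ be a field. Let $\mathbb A$ be a functor of $\mathcal K$-algebras which is a D-proquasi-coherent module, and let $\mathbb P,\mathbb P'$ be proquasi-coherent $\mathcal K$-modules which are functors of $\mathbb A$-modules. Then a morphism of $\mathcal K$-modules $f\colon\mathbb P\to\mathbb P'$ is a morphism of $\mathbb A$-modules if and only if $f_K\colon\mathbb P(K)\to\mathbb P'(K)$ is a morphism of $\mathbb A(K)$-modules.
   Context: $K$ is a field. All functors are covariant functors on the category of commutative $K$-algebras. $\mathcal K$ is the functor of rings $\mathcal K(S)=S$. A functor of $\mathcal K$-modules $\mathbb M$ is a functor of sets with morphisms of functors $\mathbb M\times\mathbb M\to\mathbb M$, $\mathcal K\times\mathbb M\to\mathbb M$ making $\mathbb M(S)$ an $S$-module for every commutative $K$-algebra $S$. A morphism is a natural transformation $f$ with every $f_S$ $S$-linear. A functor of $\mathcal K$-algebras is a functor $\mathbb A$ of (associative unital, not necessarily commutative) rings with a morphism of functors of rings $\mathcal K\to\mathbb A$ such that $S$ is central in $\mathbb A(S)$ for every $S$. Functors of $\mathbb A$-modules are functors of $\mathcal K$-modules with a compatible (pointwise) $\mathbb A(S)$-module structure, functorial in $S$. For a $K$-vector space $V$, the associated quasi-coherent module is $\mathcal V(S)=V\otimes_K S$. A functor of $\mathcal K$-modules is proquasi-coherent if it is an inverse limit (computed pointwise) of quasi-coherent modules. $\mathbb M^*(S):=\operatorname{Hom}_{\mathcal S}(\mathbb M_{|S},\mathcal S)$, where $\mathbb M_{|S}$ is the restriction of $\mathbb M$ to commutative $S$-algebras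 and $\mathcal S(T)=T$. $\mathbb M(\mathcal K)$ denotes the functor $S\mapsto\mathbb M(K)\otimes_K S$, with natural morphism $\mathbb M(\mathcal K)\to\mathbb M$, $m\otimes s\mapsto s\cdot m$. $\mathbb M$ is D-proquasi-coherent if the dual morphism $\mathbb M^*\to\mathbb M(\mathcal K)^*$ is injective (on every $S$). *)

theory Defs
  imports "HOL-Algebra.Algebra"
begin

text \<open>
  Commutative algebras over a commutative ring \<open>R\<close> are the records \<open>S\<close> with \<open>algebra R S\<close>. Their
  carriers range over the subsets of one arbitrary type \<open>'u\<close>, which plays the role of the
  universe; the ground field lives in \<open>'u\<close> as well, so that every \<open>S\<close> is again a possible base ring.
\<close>

type_synonym 'u alg = "('u, 'u) module"

text \<open>For records that are used only as modules, the fields \<open>mult\<close> and \<open>one\<close> have no meaning.\<close>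

definition with_smult :: "('b, 'x) ring_scheme \<Rightarrow> ('a \<Rightarrow> 'b \<Rightarrow> 'b) \<Rightarrow> ('a, 'b) module" where
  "with_smult E sm = \<lparr>carrier = carrier E, monoid.mult = monoid.mult E, monoid.one = monoid.one E,
     ring.zero = ring.zero E, ring.add = ring.add E, smult = sm\<rparr>"

definition regular :: "('u, 'x) ring_scheme \<Rightarrow> 'u alg" where
  "regular S = with_smult S (monoid.mult S)"

definition restrict_scalars :: "'u alg \<Rightarrow> 'u alg \<Rightarrow> 'u alg" where
  "restrict_scalars S T = with_smult T (\<lambda>k t. (k \<odot>\<^bsub>S\<^esub> \<one>\<^bsub>S\<^esub>) \<odot>\<^bsub>T\<^esub> t)"

text \<open>Maps are made extensional throughout, so that equality of functions is equality of maps.\<close>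

definition alg_hom :: "('u, 'x) ring_scheme \<Rightarrow> 'u alg \<Rightarrow> 'u alg \<Rightarrow> ('u \<Rightarrow> 'u) set" where
  "alg_hom R S T = {h \<in> ring_hom S T \<inter> extensional (carrier S).
     \<forall>r\<in>carrier R. \<forall>s\<in>carrier S. h (r \<odot>\<^bsub>S\<^esub> s) = r \<odot>\<^bsub>T\<^esub> h s}"

definition unit_hom :: "('u, 'x) ring_scheme \<Rightarrow> 'u alg \<Rightarrow> 'u \<Rightarrow> 'u" where
  "unit_hom R S = (\<lambda>r\<in>carrier R. r \<odot>\<^bsub>S\<^esub> \<one>\<^bsub>S\<^esub>)"

text \<open>Left modules and linear maps over a not necessarily commutative ring.\<close>

definition left_module :: "('a, 'x) ring_scheme \<Rightarrow> ('a, 'b) module \<Rightarrow> bool" where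
  "left_module R E \<longleftrightarrow> ring R \<and> abelian_group E \<and>
     (\<forall>a\<in>carrier R. \<forall>x\<in>carrier E. a \<odot>\<^bsub>E\<^esub> x \<in> carrier E) \<and>
     (\<forall>a\<in>carrier R. \<forall>b\<in>carrier R. \<forall>x\<in>carrier E.
        (a \<oplus>\<^bsub>R\<^esub> b) \<odot>\<^bsub>E\<^esub> x = a \<odot>\<^bsub>E\<^esub> x \<oplus>\<^bsub>E\<^esub> b \<odot>\<^bsub>E\<^esub> x) \<and>
     (\<forall>a\<in>carrier R. \<forall>x\<in>carrier E. \<forall>y\<in>carrier E.
        a \<odot>\<^bsub>E\<^esub> (x \<oplus>\<^bsub>E\<^esub> y) = a \<odot>\<^bsub>E\<^esub> x \<oplus>\<^bsub>E\<^esub> a \<odot>\<^bsub>E\<^esub> y) \<and>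
     (\<forall>a\<in>carrier R. \<forall>b\<in>carrier R. \<forall>x\<in>carrier E.
        (a \<otimes>\<^bsub>R\<^esub> b) \<odot>\<^bsub>E\<^esub> x = a \<odot>\<^bsub>E\<^esub> (b \<odot>\<^bsub>E\<^esub> x)) \<and>
     (\<forall>x\<in>carrier E. \<one>\<^bsub>R\<^esub> \<odot>\<^bsub>E\<^esub> x = x)"

definition linear_maps ::
    "('a, 'x) ring_scheme \<Rightarrow> ('a, 'b) module \<Rightarrow> ('a, 'c) module \<Rightarrow> ('b \<Rightarrow> 'c) set" where
  "linear_maps R E Y = {g \<in> carrier E \<rightarrow>\<^sub>E carrier Y.
     (\<forall>x\<in>carrier E. \<forall>y\<in>carrier E. g (x \<oplus>\<^bsub>E\<^esub> y) = g x \<oplus>\<^bsub>Y\<^esub> g y) \<and>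
     (\<forall>a\<in>carrier R. \<forall>x\<in>carrier E. g (a \<odot>\<^bsub>E\<^esub> x) = a \<odot>\<^bsub>Y\<^esub> g x)}"


section \<open>Functors of modules\<close>

record ('u, 'm) mod_functor =
  Ob :: "'u alg \<Rightarrow> ('u, 'm) module"
  Ar :: "'u alg \<Rightarrow> 'u alg \<Rightarrow> ('u \<Rightarrow> 'u) \<Rightarrow> 'm \<Rightarrow> 'm"

text \<open>The two equations on \<open>Ar M S T h\<close> say that addition and scalar multiplication are morphisms
  of functors.\<close>

definition module_functor :: "('u, 'x) ring_scheme \<Rightarrow> ('u, 'm) mod_functor \<Rightarrow> bool" where
  "module_functor R M \<longleftrightarrow>
     (\<forall>S. algebra R S \<longrightarrow> module S (Ob M S)) \<and>
     (\<forall>S T h. algebra R S \<longrightarrow> algebra R T \<longrightarrow> h \<in> alg_hom R S T \<longrightarrow>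
        Ar M S T h \<in> carrier (Ob M S) \<rightarrow> carrier (Ob M T) \<and>
        (\<forall>x\<in>carrier (Ob M S). \<forall>y\<in>carrier (Ob M S).
           Ar M S T h (x \<oplus>\<^bsub>Ob M S\<^esub> y) = Ar M S T h x \<oplus>\<^bsub>Ob M T\<^esub> Ar M S T h y) \<and>
        (\<forall>s\<in>carrier S. \<forall>x\<in>carrier (Ob M S).
           Ar M S T h (s \<odot>\<^bsub>Ob M S\<^esub> x) = h s \<odot>\<^bsub>Ob M T\<^esub> Ar M S T h x)) \<and>
     (\<forall>S. algebra R S \<longrightarrow>
        (\<forall>x\<in>carrier (Ob M S). Ar M S S (\<lambda>s\<in>carrier S. s) x = x)) \<and>
     (\<forall>S T U g h. algebra R S \<longrightarrow> algebra R T \<longrightarrow> algebra R U \<longrightarrow>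
        g \<in> alg_hom R S T \<longrightarrow> h \<in> alg_hom R T U \<longrightarrow>
        (\<forall>x\<in>carrier (Ob M S).
           Ar M S U (compose (carrier S) h g) x = Ar M T U h (Ar M S T g x)))"

definition functor_hom ::
    "('u, 'x) ring_scheme \<Rightarrow> ('u, 'm) mod_functor \<Rightarrow> ('u, 'n) mod_functor
      \<Rightarrow> ('u alg \<Rightarrow> 'm \<Rightarrow> 'n) set" where
  "functor_hom R M N = {f.
     (\<forall>S. algebra R S \<longrightarrow> f S \<in> linear_maps S (Ob M S) (Ob N S)) \<and>
     (\<forall>S. \<not> algebra R S \<longrightarrow> f S = (\<lambda>_. undefined)) \<and>
     (\<forall>S T h. algebra R S \<longrightarrow> algebra R T \<longrightarrow> h \<in> alg_hom R S T \<longrightarrow>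
        (\<forall>x\<in>carrier (Ob M S). f T (Ar M S T h x) = Ar N S T h (f S x)))}"

definition functor_iso ::
    "('u, 'x) ring_scheme \<Rightarrow> ('u, 'm) mod_functor \<Rightarrow> ('u, 'n) mod_functor \<Rightarrow> bool" where
  "functor_iso R M N \<longleftrightarrow> (\<exists>f\<in>functor_hom R M N.
     \<forall>S. algebra R S \<longrightarrow> bij_betw (f S) (carrier (Ob M S)) (carrier (Ob N S)))"

definition scalar_functor :: "('u, 'u) mod_functor" where
  "scalar_functor = \<lparr>Ob = regular, Ar = (\<lambda>S T h. h)\<rparr>"

definition restrict_functor ::
    "'u alg \<Rightarrow> ('u, 'm) mod_functor \<Rightarrow> ('u, 'm) mod_functor" where
  "restrict_functor S M = \<lparr>Ob = (\<lambda>T. Ob M (restrict_scalars S T)),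
     Ar = (\<lambda>T T'. Ar M (restrict_scalars S T) (restrict_scalars S T'))\<rparr>"


section \<open>Tensor products and quasi-coherent modules\<close>

text \<open>\<open>V \<otimes>\<^sub>R W\<close> is the free abelian group on \<open>V \<times> W\<close> modulo the usual relations.\<close>

definition tensor_free ::
    "('a, 'v) module \<Rightarrow> ('a, 'w) module \<Rightarrow> (('v \<times> 'w) \<Rightarrow>\<^sub>0 int) monoid" where
  "tensor_free V W = free_Abelian_group (carrier V \<times> carrier W)"

definition tensor_relators ::
    "('a, 'x) ring_scheme \<Rightarrow> ('a, 'v) module \<Rightarrow> ('a, 'w) module \<Rightarrow> (('v \<times> 'w) \<Rightarrow>\<^sub>0 int) set" where
  "tensor_relators R V W =
     {frag_of (v \<oplus>\<^bsub>V\<^esub> v', w) - frag_of (v, w) - frag_of (v', w) | v v' w.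
        v \<in> carrier V \<and> v' \<in> carrier V \<and> w \<in> carrier W} \<union>
     {frag_of (v, w \<oplus>\<^bsub>W\<^esub> w') - frag_of (v, w) - frag_of (v, w') | v w w'.
        v \<in> carrier V \<and> w \<in> carrier W \<and> w' \<in> carrier W} \<union>
     {frag_of (r \<odot>\<^bsub>V\<^esub> v, w) - frag_of (v, r \<odot>\<^bsub>W\<^esub> w) | r v w.
        r \<in> carrier R \<and> v \<in> carrier V \<and> w \<in> carrier W}"

definition tensor_kernel ::
    "('a, 'x) ring_scheme \<Rightarrow> ('a, 'v) module \<Rightarrow> ('a, 'w) module \<Rightarrow> (('v \<times> 'w) \<Rightarrow>\<^sub>0 int) set" where
  "tensor_kernel R V W = generate (tensor_free V W) (tensor_relators R V W)"

definition tensor_group ::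
    "('a, 'x) ring_scheme \<Rightarrow> ('a, 'v) module \<Rightarrow> ('a, 'w) module
      \<Rightarrow> (('v \<times> 'w) \<Rightarrow>\<^sub>0 int) set monoid" where
  "tensor_group R V W = tensor_free V W Mod tensor_kernel R V W"

text \<open>The map \<open>V \<otimes>\<^sub>R W \<rightarrow> V \<otimes>\<^sub>R W'\<close> induced by \<open>g : W \<rightarrow> W'\<close>. Tensors are cosets: \<open>C\<close> is mapped
  elementwise on the free groups and the result is saturated to a coset of the kernel.\<close>

definition tensor_map ::
    "('a, 'x) ring_scheme \<Rightarrow> ('a, 'v) module \<Rightarrow> ('a, 'w) module \<Rightarrow> ('w \<Rightarrow> 'w)
      \<Rightarrow> (('v \<times> 'w) \<Rightarrow>\<^sub>0 int) set \<Rightarrow> (('v \<times> 'w) \<Rightarrow>\<^sub>0 int) set" where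
  "tensor_map R V W' g C =
     tensor_kernel R V W' <#>\<^bsub>tensor_free V W'\<^esub>
       (frag_extend (\<lambda>(v, w). frag_of (v, g w)) ` C)"

type_synonym ('u, 'v) tensors = "(('v \<times> 'u) \<Rightarrow>\<^sub>0 int) set"

definition base_change ::
    "('u, 'x) ring_scheme \<Rightarrow> ('u, 'v) module \<Rightarrow> 'u alg \<Rightarrow> ('u, ('u, 'v) tensors) module" where
  "base_change R V S = \<lparr>carrier = carrier (tensor_group R V S),
     monoid.mult = undefined, monoid.one = undefined,
     ring.zero = monoid.one (tensor_group R V S), ring.add = monoid.mult (tensor_group R V S),
     smult = (\<lambda>s. tensor_map R V S (\<lambda>t. s \<otimes>\<^bsub>S\<^esub> t))\<rparr>"

definition quasi_coherent ::
    "('u, 'x) ring_scheme \<Rightarrow> ('u, 'v) module \<Rightarrow> ('u, ('u, 'v) tensors) mod_functor" where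
  "quasi_coherent R V = \<lparr>Ob = base_change R V, Ar = (\<lambda>S T h. tensor_map R V T h)\<rparr>"


section \<open>Inverse limits and proquasi-coherent modules\<close>

text \<open>The pointwise limit of the functors \<open>Q i\<close>, \<open>i \<in> I\<close>, along the sets \<open>D i j\<close> of transition
  morphisms \<open>Q i \<rightarrow> Q j\<close>. The limit of a diagram depends only on the objects and on which morphisms
  occur, so every small diagram, in particular every inverse system over a directed set, is
  covered.\<close>

definition limit_functor ::
    "'i set \<Rightarrow> ('i \<Rightarrow> ('u, 'm) mod_functor) \<Rightarrow> ('i \<Rightarrow> 'i \<Rightarrow> ('u alg \<Rightarrow> 'm \<Rightarrow> 'm) set)
      \<Rightarrow> ('u, 'i \<Rightarrow> 'm) mod_functor" where
  "limit_functor I Q D = \<lparr>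
     Ob = (\<lambda>S. \<lparr>
       carrier = {x \<in> (\<Pi>\<^sub>E i\<in>I. carrier (Ob (Q i) S)).
                   \<forall>i\<in>I. \<forall>j\<in>I. \<forall>t\<in>D i j. t S (x i) = x j},
       monoid.mult = undefined, monoid.one = undefined,
       ring.zero = (\<lambda>i\<in>I. \<zero>\<^bsub>Ob (Q i) S\<^esub>),
       ring.add = (\<lambda>x y. \<lambda>i\<in>I. x i \<oplus>\<^bsub>Ob (Q i) S\<^esub> y i),
       smult = (\<lambda>s x. \<lambda>i\<in>I. s \<odot>\<^bsub>Ob (Q i) S\<^esub> x i)\<rparr>),
     Ar = (\<lambda>S T h x. \<lambda>i\<in>I. Ar (Q i) S T h (x i))\<rparr>"

text \<open>The type arguments only bound the size of the index set and of the vector spaces in the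
  diagram, as HOL cannot quantify over types inside a formula.\<close>

definition proquasi_coherent ::
    "'i itself \<Rightarrow> 'v itself \<Rightarrow> ('u, 'x) ring_scheme \<Rightarrow> ('u, 'm) mod_functor \<Rightarrow> bool" where
  "proquasi_coherent _ _ R M \<longleftrightarrow> module_functor R M \<and>
     (\<exists>(I :: 'i set) (V :: 'i \<Rightarrow> ('u, 'v) module) D.
        (\<forall>i\<in>I. module R (V i)) \<and>
        (\<forall>i\<in>I. \<forall>j\<in>I. D i j \<subseteq> functor_hom R (quasi_coherent R (V i)) (quasi_coherent R (V j))) \<and>
        functor_iso R M (limit_functor I (\<lambda>i. quasi_coherent R (V i)) D))"


section \<open>Duals and D-proquasi-coherent modules\<close>

definition dual :: "('u, 'm) mod_functor \<Rightarrow> 'u alg \<Rightarrow> ('u alg \<Rightarrow> 'm \<Rightarrow> 'u) set" where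
  "dual M S = functor_hom S (restrict_functor S M) scalar_functor"

text \<open>For \<open>g : N \<rightarrow> M\<close>, the component at \<open>S\<close> of the dual morphism from the dual of \<open>M\<close> to the dual
  of \<open>N\<close>.\<close>

definition dual_map ::
    "('u, 'n) mod_functor \<Rightarrow> ('u alg \<Rightarrow> 'n \<Rightarrow> 'm) \<Rightarrow> 'u alg
      \<Rightarrow> ('u alg \<Rightarrow> 'm \<Rightarrow> 'u) \<Rightarrow> ('u alg \<Rightarrow> 'n \<Rightarrow> 'u)" where
  "dual_map N g S w = (\<lambda>T. if algebra S T
     then (\<lambda>x\<in>carrier (Ob N (restrict_scalars S T)). w T (g (restrict_scalars S T) x))
     else (\<lambda>_. undefined))"

definition global_part ::
    "('u, 'x) ring_scheme \<Rightarrow> ('u, 'm) mod_functor \<Rightarrow> ('u, ('u, 'm) tensors) mod_functor" where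
  "global_part R M = quasi_coherent R (Ob M (regular R))"

text \<open>The natural morphism \<open>m \<otimes> s \<mapsto> s \<cdot> m\<close> from \<open>global_part R M\<close> to \<open>M\<close>, where \<open>m\<close> is first
  transported along \<open>R \<rightarrow> S\<close>. It is evaluated on the representatives of the coset \<open>C\<close>; its value
  does not depend on the representative.\<close>

definition global_map ::
    "('u, 'x) ring_scheme \<Rightarrow> ('u, 'm) mod_functor \<Rightarrow> 'u alg \<Rightarrow> ('u, 'm) tensors \<Rightarrow> 'm" where
  "global_map R M S = (if algebra R S
     then (\<lambda>C\<in>carrier (Ob (global_part R M) S). the_elem
       ((\<lambda>c. \<Oplus>\<^bsub>Ob M S\<^esub>p\<in>Poly_Mapping.keys c. [Poly_Mapping.lookup c p] \<cdot>\<^bsub>Ob M S\<^esub>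
            (snd p \<odot>\<^bsub>Ob M S\<^esub> Ar M (regular R) S (unit_hom R S) (fst p))) ` C))
     else (\<lambda>_. undefined))"

definition D_proquasi_coherent :: "('u, 'x) ring_scheme \<Rightarrow> ('u, 'm) mod_functor \<Rightarrow> bool" where
  "D_proquasi_coherent R M \<longleftrightarrow> module_functor R M \<and>
     (\<forall>S. algebra R S \<longrightarrow>
        inj_on (dual_map (global_part R M) (global_map R M) S) (dual M S))"


section \<open>Functors of algebras and their modules\<close>

record ('u, 'a) alg_functor =
  AOb :: "'u alg \<Rightarrow> 'a ring"
  AAr :: "'u alg \<Rightarrow> 'u alg \<Rightarrow> ('u \<Rightarrow> 'u) \<Rightarrow> 'a \<Rightarrow> 'a"
  Aunit :: "'u alg \<Rightarrow> 'u \<Rightarrow> 'a"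

definition algebra_functor :: "('u, 'x) ring_scheme \<Rightarrow> ('u, 'a) alg_functor \<Rightarrow> bool" where
  "algebra_functor R A \<longleftrightarrow>
     (\<forall>S. algebra R S \<longrightarrow> ring (AOb A S)) \<and>
     (\<forall>S T h. algebra R S \<longrightarrow> algebra R T \<longrightarrow> h \<in> alg_hom R S T \<longrightarrow>
        AAr A S T h \<in> ring_hom (AOb A S) (AOb A T)) \<and>
     (\<forall>S. algebra R S \<longrightarrow>
        (\<forall>a\<in>carrier (AOb A S). AAr A S S (\<lambda>s\<in>carrier S. s) a = a)) \<and>
     (\<forall>S T U g h. algebra R S \<longrightarrow> algebra R T \<longrightarrow> algebra R U \<longrightarrow>
        g \<in> alg_hom R S T \<longrightarrow> h \<in> alg_hom R T U \<longrightarrow>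
        (\<forall>a\<in>carrier (AOb A S).
           AAr A S U (compose (carrier S) h g) a = AAr A T U h (AAr A S T g a))) \<and>
     (\<forall>S. algebra R S \<longrightarrow> Aunit A S \<in> ring_hom S (AOb A S)) \<and>
     (\<forall>S T h. algebra R S \<longrightarrow> algebra R T \<longrightarrow> h \<in> alg_hom R S T \<longrightarrow>
        (\<forall>s\<in>carrier S. AAr A S T h (Aunit A S s) = Aunit A T (h s))) \<and>
     (\<forall>S. algebra R S \<longrightarrow> (\<forall>s\<in>carrier S. \<forall>a\<in>carrier (AOb A S).
        Aunit A S s \<otimes>\<^bsub>AOb A S\<^esub> a = a \<otimes>\<^bsub>AOb A S\<^esub> Aunit A S s))"

definition underlying :: "('u, 'a) alg_functor \<Rightarrow> ('u, 'a) mod_functor" where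
  "underlying A = \<lparr>
     Ob = (\<lambda>S. with_smult (AOb A S) (\<lambda>s a. Aunit A S s \<otimes>\<^bsub>AOb A S\<^esub> a)),
     Ar = AAr A\<rparr>"

definition action_module ::
    "('u, 'p) mod_functor \<Rightarrow> ('u alg \<Rightarrow> 'a \<Rightarrow> 'p \<Rightarrow> 'p) \<Rightarrow> 'u alg \<Rightarrow> ('a, 'p) module" where
  "action_module P act S = with_smult (Ob P S) (act S)"

definition algebra_action ::
    "('u, 'x) ring_scheme \<Rightarrow> ('u, 'a) alg_functor \<Rightarrow> ('u, 'p) mod_functor
      \<Rightarrow> ('u alg \<Rightarrow> 'a \<Rightarrow> 'p \<Rightarrow> 'p) \<Rightarrow> bool" where
  "algebra_action R A P act \<longleftrightarrow> module_functor R P \<and>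
     (\<forall>S. algebra R S \<longrightarrow> left_module (AOb A S) (action_module P act S)) \<and>
     (\<forall>S. algebra R S \<longrightarrow> (\<forall>s\<in>carrier S. \<forall>x\<in>carrier (Ob P S).
        act S (Aunit A S s) x = s \<odot>\<^bsub>Ob P S\<^esub> x)) \<and>
     (\<forall>S T h. algebra R S \<longrightarrow> algebra R T \<longrightarrow> h \<in> alg_hom R S T \<longrightarrow>
        (\<forall>a\<in>carrier (AOb A S). \<forall>x\<in>carrier (Ob P S).
           Ar P S T h (act S a x) = act T (AAr A S T h a) (Ar P S T h x)))"

definition algebra_functor_hom ::
    "('u, 'x) ring_scheme \<Rightarrow> ('u, 'a) alg_functor
      \<Rightarrow> ('u, 'p) mod_functor \<Rightarrow> ('u alg \<Rightarrow> 'a \<Rightarrow> 'p \<Rightarrow> 'p)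
      \<Rightarrow> ('u, 'q) mod_functor \<Rightarrow> ('u alg \<Rightarrow> 'a \<Rightarrow> 'q \<Rightarrow> 'q)
      \<Rightarrow> ('u alg \<Rightarrow> 'p \<Rightarrow> 'q) set" where
  "algebra_functor_hom R A P act P' act' = {f \<in> functor_hom R P P'.
     \<forall>S. algebra R S \<longrightarrow>
       f S \<in> linear_maps (AOb A S) (action_module P act S) (action_module P' act' S)}"

end

theory Submission
  imports Defs
begin

text \<open>
  One implication is the instance \<open>S = K\<close>. For the other one, consider the defect
  \<open>e\<^sub>S(a, p) = f\<^sub>S(a p) - a f\<^sub>S(p)\<close> for \<open>a \<in> A(S)\<close>, \<open>p \<in> P(S)\<close>. It is natural in \<open>S\<close> and
  \<open>S\<close>-linear in each variable, and it vanishes for \<open>S = K\<close>. The two variables are moved from \<open>K\<close> to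
  an arbitrary \<open>S\<close> one after the other, by two different rigidity principles. Both concern
  scalar-valued morphisms, and the passage to scalars is possible because \<open>P'\<close> is a limit of functors
  \<open>V \<otimes> S\<close> and, over a field, a tensor \<open>u \<in> V \<otimes> S\<close> with \<open>(l \<otimes> 1) u = 0\<close> for all functionals \<open>l\<close>
  of \<open>V\<close> is zero (\<open>tensor_eq_zero\<close>). So the morphisms from \<open>P'\<close> to the scalar functor separate the
  points of each \<open>P'(S)\<close> (\<open>proquasi_coherent_separated\<close>).

  First let \<open>a \<in> A(K)\<close> and let \<open>p\<close> vary. For a functional \<open>l\<close> of \<open>P'\<close>, the morphism
  \<open>w = l(e(a, _))\<close> from \<open>P\<close> to the scalar functor is zero on \<open>P(K)\<close>. Every such \<open>w\<close> is zero
  (\<open>functional_eq_zero\<close>). Indeed \<open>P\<close>, being a limit of functors \<open>V \<otimes> S\<close>, is functorial not only for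
  homomorphisms of algebras but for all \<open>K\<close>-linear maps \<open>S \<rightarrow> T\<close>
  (\<open>proquasi_coherent_linear_extension\<close>). If \<open>L : S \<rightarrow> S\<close> has finite rank, then \<open>P(L)\<close> is a sum of maps
  that factor through \<open>P(K)\<close>, so \<open>w\<^sub>S P(L) = 0\<close>. When \<open>S\<close> is finite, \<open>L\<close> can be the identity. When
  \<open>S\<close> is infinite, \<open>w\<^sub>S P(L) = L w\<^sub>S\<close> for every linear \<open>L\<close> (\<open>functional_commutes_linear\<close>), and
  choosing \<open>L\<close> of finite rank with \<open>L (w\<^sub>S x) = w\<^sub>S x\<close> gives \<open>w\<^sub>S x = w\<^sub>S (P(L) x) = 0\<close>. The commutation
  comes from dual numbers: a linear endomorphism \<open>L\<close> of \<open>S\<close> induces the algebra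
  endomorphism \<open>k + \<epsilon> s \<mapsto> k + \<epsilon> L s\<close> of \<open>K + \<epsilon> S \<subseteq> S[\<epsilon>]\<close>, and \<open>w\<close> is natural for the latter. The
  distinction of cases is forced by the universe \<open>'u\<close>: it has room for \<open>S[\<epsilon>]\<close>, a set with as many
  elements as \<open>S \<times> S\<close>, if \<open>S\<close> is infinite, but possibly not if \<open>S\<close> is finite.

  Now fix \<open>p \<in> P(S)\<close> and a functional \<open>l\<close> of \<open>P'\<close>. For \<open>S\<close>-algebras \<open>T\<close> and \<open>a \<in> A(T)\<close> the
  assignment \<open>a \<mapsto> l(e\<^sub>T(a, p))\<close> is an element of \<open>A\<^sup>*(S)\<close>, and by the first step it vanishes on the image
  of \<open>A(K) \<otimes> T\<close>. As \<open>A\<close> is D-proquasi-coherent, it is zero (\<open>functor_hom_commutes_action\<close>).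
\<close>

section \<open>Linear maps\<close>

text \<open>Unlike \<open>linear_maps\<close>, this does not ask for extensionality, so that linear maps can be written
  as plain \<open>\<lambda>\<close>-terms and composed without restricting.\<close>

definition linear_on ::
    "('a, 'x) ring_scheme \<Rightarrow> ('a, 'b) module \<Rightarrow> ('a, 'c) module \<Rightarrow> ('b \<Rightarrow> 'c) \<Rightarrow> bool" where
  "linear_on R E Y g \<longleftrightarrow> g \<in> carrier E \<rightarrow> carrier Y \<and>
     (\<forall>x\<in>carrier E. \<forall>y\<in>carrier E. g (x \<oplus>\<^bsub>E\<^esub> y) = g x \<oplus>\<^bsub>Y\<^esub> g y) \<and>
     (\<forall>a\<in>carrier R. \<forall>x\<in>carrier E. g (a \<odot>\<^bsub>E\<^esub> x) = a \<odot>\<^bsub>Y\<^esub> g x)"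

lemma linear_onI:
  assumes "\<And>x. x \<in> carrier E \<Longrightarrow> g x \<in> carrier Y"
    and "\<And>x y. x \<in> carrier E \<Longrightarrow> y \<in> carrier E \<Longrightarrow> g (x \<oplus>\<^bsub>E\<^esub> y) = g x \<oplus>\<^bsub>Y\<^esub> g y"
    and "\<And>a x. a \<in> carrier R \<Longrightarrow> x \<in> carrier E \<Longrightarrow> g (a \<odot>\<^bsub>E\<^esub> x) = a \<odot>\<^bsub>Y\<^esub> g x"
  shows "linear_on R E Y g"
  using assms by (auto simp: linear_on_def)

lemma linear_onD:
  assumes "linear_on R E Y g"
  shows "x \<in> carrier E \<Longrightarrow> g x \<in> carrier Y"
    and "x \<in> carrier E \<Longrightarrow> y \<in> carrier E \<Longrightarrow> g (x \<oplus>\<^bsub>E\<^esub> y) = g x \<oplus>\<^bsub>Y\<^esub> g y"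
    and "a \<in> carrier R \<Longrightarrow> x \<in> carrier E \<Longrightarrow> g (a \<odot>\<^bsub>E\<^esub> x) = a \<odot>\<^bsub>Y\<^esub> g x"
  using assms by (auto simp: linear_on_def)

lemma linear_on_comp:
  assumes "linear_on R E Y g" "linear_on R Y Z h"
  shows "linear_on R E Z (\<lambda>x. h (g x))"
  using assms by (auto simp: linear_on_def Pi_iff)

lemma additive_zero:
  assumes "abelian_group E" "abelian_group Y" "\<And>x. x \<in> carrier E \<Longrightarrow> g x \<in> carrier Y"
    and "\<And>x y. x \<in> carrier E \<Longrightarrow> y \<in> carrier E \<Longrightarrow> g (x \<oplus>\<^bsub>E\<^esub> y) = g x \<oplus>\<^bsub>Y\<^esub> g y"
  shows "g \<zero>\<^bsub>E\<^esub> = \<zero>\<^bsub>Y\<^esub>"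
proof -
  interpret E: abelian_group E by fact
  interpret Y: abelian_group Y by fact
  have "g \<zero>\<^bsub>E\<^esub> \<oplus>\<^bsub>Y\<^esub> g \<zero>\<^bsub>E\<^esub> = g \<zero>\<^bsub>E\<^esub>"
    using assms(4)[of "\<zero>\<^bsub>E\<^esub>" "\<zero>\<^bsub>E\<^esub>"] by simp
  then show ?thesis using assms(3) by (simp add: Y.add.r_cancel_one)
qed

section \<open>Tensor products\<close>

definition tclass ::
    "('a, 'x) ring_scheme \<Rightarrow> ('a, 'v) module \<Rightarrow> ('a, 'w) module
      \<Rightarrow> (('v \<times> 'w) \<Rightarrow>\<^sub>0 int) \<Rightarrow> (('v \<times> 'w) \<Rightarrow>\<^sub>0 int) set" where
  "tclass R V W c = tensor_kernel R V W #>\<^bsub>tensor_free V W\<^esub> c"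

abbreviation pure ::
    "('a, 'x) ring_scheme \<Rightarrow> ('a, 'v) module \<Rightarrow> ('a, 'w) module \<Rightarrow> 'v \<Rightarrow> 'w
      \<Rightarrow> (('v \<times> 'w) \<Rightarrow>\<^sub>0 int) set" where
  "pure R V W v w \<equiv> tclass R V W (frag_of (v, w))"

abbreviation pairs where "pairs V W \<equiv> carrier V \<times> carrier W"

lemma tclass_eq: "tclass R V W c = (\<lambda>k. k + c) ` tensor_kernel R V W"
  by (auto simp: tclass_def r_coset_def tensor_free_def)

lemma keys_diff_subset:
  "Poly_Mapping.keys a \<subseteq> B \<Longrightarrow> Poly_Mapping.keys b \<subseteq> B \<Longrightarrow> Poly_Mapping.keys (a - b) \<subseteq> B"
  using keys_diff[of a b] by blast

lemma tensor_relators_subset: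
  assumes "module R V" "module R W"
  shows "tensor_relators R V W \<subseteq> carrier (tensor_free V W)"
proof -
  interpret V: module R V by fact
  interpret W: module R W by fact
  show ?thesis
    unfolding tensor_relators_def tensor_free_def
    by (intro subsetI, elim UnE CollectE exE conjE) (simp_all add: keys_diff_subset)
qed

lemma tensor_kernel_subgroup:
  assumes "module R V" "module R W"
  shows "subgroup (tensor_kernel R V W) (tensor_free V W)"
  unfolding tensor_kernel_def
  using group.generate_is_subgroup[OF _ tensor_relators_subset[OF assms]]
  by (simp add: tensor_free_def)

lemma tensor_kernel_normal:
  assumes "module R V" "module R W"
  shows "tensor_kernel R V W \<lhd> tensor_free V W"
  using comm_group.subgroup_imp_normal[OF _ tensor_kernel_subgroup[OF assms]]
  by (simp add: tensor_free_def abelian_free_Abelian_group)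

lemma tensor_kernel_closed:
  assumes "module R V" "module R W"
  shows "0 \<in> tensor_kernel R V W"
    and "a \<in> tensor_kernel R V W \<Longrightarrow> Poly_Mapping.keys a \<subseteq> pairs V W"
    and "a \<in> tensor_kernel R V W \<Longrightarrow> b \<in> tensor_kernel R V W \<Longrightarrow> a + b \<in> tensor_kernel R V W"
    and "a \<in> tensor_kernel R V W \<Longrightarrow> - a \<in> tensor_kernel R V W"
    and "a \<in> tensor_kernel R V W \<Longrightarrow> b \<in> tensor_kernel R V W \<Longrightarrow> a - b \<in> tensor_kernel R V W"
proof -
  interpret subgroup "tensor_kernel R V W" "tensor_free V W"
    by (rule tensor_kernel_subgroup[OF assms])
  show 0: "0 \<in> tensor_kernel R V W"
    using one_closed by (simp add: tensor_free_def)
  show k: "Poly_Mapping.keys a \<subseteq> pairs V W" if "a \<in> tensor_kernel R V W" for a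
    using mem_carrier[OF that] by (simp add: tensor_free_def)
  show add: "a + b \<in> tensor_kernel R V W" if "a \<in> tensor_kernel R V W" "b \<in> tensor_kernel R V W" for a b
    using m_closed[OF that] by (simp add: tensor_free_def)
  show minus: "- a \<in> tensor_kernel R V W" if "a \<in> tensor_kernel R V W" for a
    using m_inv_closed[OF that] k[OF that] by (simp add: tensor_free_def)
  show "a - b \<in> tensor_kernel R V W" if "a \<in> tensor_kernel R V W" "b \<in> tensor_kernel R V W" for a b
    using add[OF that(1) minus[OF that(2)]] by simp
qed

lemma tclass_cong_iff:
  assumes "module R V" "module R W"
  shows "tclass R V W c = tclass R V W d \<longleftrightarrow> c - d \<in> tensor_kernel R V W"
proof
  note K = tensor_kernel_closed[OF assms]
  assume "tclass R V W c = tclass R V W d"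
  then have "0 + c \<in> (\<lambda>k. k + d) ` tensor_kernel R V W"
    using K(1) by (metis tclass_eq imageI)
  then show "c - d \<in> tensor_kernel R V W" by auto
next
  note K = tensor_kernel_closed[OF assms]
  have sub: "tclass R V W c \<subseteq> tclass R V W d" if *: "c - d \<in> tensor_kernel R V W" for c d
  proof
    fix x assume "x \<in> tclass R V W c"
    then obtain k where k: "k \<in> tensor_kernel R V W" "x = k + c" by (auto simp: tclass_eq)
    have "x = (k + (c - d)) + d" using k by simp
    then show "x \<in> tclass R V W d" using K(3)[OF k(1) *] unfolding tclass_eq by blast
  qed
  assume *: "c - d \<in> tensor_kernel R V W"
  have "d - c \<in> tensor_kernel R V W" using K(4)[OF *] by simp
  then show "tclass R V W c = tclass R V W d" using sub[OF *] sub by blast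
qed

lemma base_change_sel:
  "carrier (base_change R V S) = {tclass R V S c | c. Poly_Mapping.keys c \<subseteq> pairs V S}"
  "\<zero>\<^bsub>base_change R V S\<^esub> = tclass R V S 0"
proof -
  show "carrier (base_change R V S) = {tclass R V S c | c. Poly_Mapping.keys c \<subseteq> pairs V S}"
  proof -
    have "carrier (base_change R V S) = rcosets\<^bsub>tensor_free V S\<^esub> tensor_kernel R V S"
      unfolding base_change_def tensor_group_def FactGroup_def by (simp only: module.simps partial_object.simps)
    also have "\<dots> = tclass R V S ` carrier (tensor_free V S)"
      unfolding RCOSETS_def tclass_def by blast
    also have "carrier (tensor_free V S) = {c. Poly_Mapping.keys c \<subseteq> pairs V S}"
      unfolding tensor_free_def free_Abelian_group_def by (simp only: partial_object.simps)
    finally show ?thesis by blast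
  qed
  show "\<zero>\<^bsub>base_change R V S\<^esub> = tclass R V S 0"
    unfolding base_change_def tensor_group_def FactGroup_def tclass_eq
    by (simp only: module.simps monoid.simps ring.simps) simp
qed

lemma tclass_closed:
  "Poly_Mapping.keys c \<subseteq> pairs V S \<Longrightarrow> tclass R V S c \<in> carrier (base_change R V S)"
  unfolding base_change_sel by blast

lemma base_change_tclassE:
  assumes "x \<in> carrier (base_change R V S)"
  obtains c where "x = tclass R V S c" "Poly_Mapping.keys c \<subseteq> pairs V S"
  using assms unfolding base_change_sel by blast

lemma tclass_add:
  assumes "module R V" "module R S" "Poly_Mapping.keys c \<subseteq> pairs V S" "Poly_Mapping.keys d \<subseteq> pairs V S"
  shows "tclass R V S c \<oplus>\<^bsub>base_change R V S\<^esub> tclass R V S d = tclass R V S (c + d)"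
proof -
  interpret normal "tensor_kernel R V S" "tensor_free V S"
    by (rule tensor_kernel_normal[OF assms(1,2)])
  show ?thesis
    using rcos_sum[of c d] assms(3,4)
    by (simp add: base_change_def tensor_group_def tclass_def tensor_free_def)
qed

lemma abelian_group_base_change:
  assumes "module R V" "module R S"
  shows "abelian_group (base_change R V S)"
proof -
  have sel: "carrier (base_change R V S) = carrier (tensor_group R V S)"
    "\<zero>\<^bsub>base_change R V S\<^esub> = \<one>\<^bsub>tensor_group R V S\<^esub>"
    "x \<oplus>\<^bsub>base_change R V S\<^esub> y = x \<otimes>\<^bsub>tensor_group R V S\<^esub> y" for x y
    by (simp_all add: base_change_def)
  interpret G: comm_group "tensor_group R V S"
    unfolding tensor_group_def
    by (rule comm_group.abelian_FactGroup[OF _ tensor_kernel_subgroup[OF assms]])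
      (simp add: tensor_free_def abelian_free_Abelian_group)
  show ?thesis
    by (rule abelian_groupI) (auto simp: sel G.m_ac intro: G.l_inv_ex)
qed

lemma pure_closed:
  "v \<in> carrier V \<Longrightarrow> s \<in> carrier S \<Longrightarrow> pure R V S v s \<in> carrier (base_change R V S)"
  by (rule tclass_closed) simp

lemma relator_in_kernel:
  "c \<in> tensor_relators R V W \<Longrightarrow> c \<in> tensor_kernel R V W"
  by (simp add: tensor_kernel_def generate.incl)

lemma pure_add_left:
  assumes "module R V" "module R S" "v \<in> carrier V" "v' \<in> carrier V" "s \<in> carrier S"
  shows "pure R V S (v \<oplus>\<^bsub>V\<^esub> v') s = pure R V S v s \<oplus>\<^bsub>base_change R V S\<^esub> pure R V S v' s"
proof -
  have "frag_of (v \<oplus>\<^bsub>V\<^esub> v', s) - frag_of (v, s) - frag_of (v', s) \<in> tensor_kernel R V S"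
    by (rule relator_in_kernel) (use assms in \<open>auto simp: tensor_relators_def\<close>)
  then show ?thesis using assms
    by (simp add: tclass_add tclass_cong_iff diff_diff_eq)
qed

lemma pure_add_right:
  assumes "module R V" "module R S" "v \<in> carrier V" "s \<in> carrier S" "s' \<in> carrier S"
  shows "pure R V S v (s \<oplus>\<^bsub>S\<^esub> s') = pure R V S v s \<oplus>\<^bsub>base_change R V S\<^esub> pure R V S v s'"
proof -
  have "frag_of (v, s \<oplus>\<^bsub>S\<^esub> s') - frag_of (v, s) - frag_of (v, s') \<in> tensor_kernel R V S"
    by (rule relator_in_kernel) (use assms in \<open>auto simp: tensor_relators_def\<close>)
  then show ?thesis using assms
    by (simp add: tclass_add tclass_cong_iff diff_diff_eq)
qed

lemma pure_smult:
  assumes "module R V" "module R S" "r \<in> carrier R" "v \<in> carrier V" "s \<in> carrier S"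
  shows "pure R V S (r \<odot>\<^bsub>V\<^esub> v) s = pure R V S v (r \<odot>\<^bsub>S\<^esub> s)"
proof -
  have "frag_of (r \<odot>\<^bsub>V\<^esub> v, s) - frag_of (v, r \<odot>\<^bsub>S\<^esub> s) \<in> tensor_kernel R V S"
    by (rule relator_in_kernel) (use assms in \<open>auto simp: tensor_relators_def\<close>)
  then show ?thesis using assms
    by (simp add: tclass_cong_iff)
qed

lemma pure_zero_right:
  assumes "module R V" "module R S" "v \<in> carrier V"
  shows "pure R V S v \<zero>\<^bsub>S\<^esub> = \<zero>\<^bsub>base_change R V S\<^esub>"
proof -
  interpret S: module R S by fact
  show ?thesis
    by (rule additive_zero[OF S.abelian_group_axioms abelian_group_base_change[OF assms(1,2)],
          where g="pure R V S v"])
      (simp_all add: pure_closed assms pure_add_right)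
qed

lemma pure_zero_left:
  assumes "module R V" "module R S" "s \<in> carrier S"
  shows "pure R V S \<zero>\<^bsub>V\<^esub> s = \<zero>\<^bsub>base_change R V S\<^esub>"
proof -
  interpret V: module R V by fact
  show ?thesis
    by (rule additive_zero[OF V.abelian_group_axioms abelian_group_base_change[OF assms(1,2)],
          where g="\<lambda>v. pure R V S v s"])
      (simp_all add: pure_closed assms pure_add_left)
qed

text \<open>Inverses need no case of their own, since \<open>- (v \<otimes> s) = (- v) \<otimes> s\<close>. In the induction over the free
  group this is seen by carrying the property for a chain and for its negative along together.\<close>

lemma tensor_induct [consumes 3, case_names zero pure add]:
  assumes VS: "module R V" "module R S" and u: "u \<in> carrier (base_change R V S)"
    and zero: "Q \<zero>\<^bsub>base_change R V S\<^esub>"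
    and pure: "\<And>v s. v \<in> carrier V \<Longrightarrow> s \<in> carrier S \<Longrightarrow> Q (pure R V S v s)"
    and add: "\<And>x y. x \<in> carrier (base_change R V S) \<Longrightarrow> y \<in> carrier (base_change R V S) \<Longrightarrow>
      Q x \<Longrightarrow> Q y \<Longrightarrow> Q (x \<oplus>\<^bsub>base_change R V S\<^esub> y)"
  shows "Q u"
proof -
  interpret V: module R V by fact
  have "Poly_Mapping.keys c \<subseteq> pairs V S \<Longrightarrow> Q (tclass R V S c) \<and> Q (tclass R V S (- c))
    \<and> Poly_Mapping.keys c \<subseteq> pairs V S" for c
  proof (induction c rule: frag_induction)
    case zero
    then show ?case using assms(4) by (simp add: base_change_sel)
  next
    case (one p)
    then obtain v s where p: "p = (v, s)" "v \<in> carrier V" "s \<in> carrier S" by auto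
    have "tclass R V S (- frag_of p) = pure R V S (\<ominus>\<^bsub>V\<^esub> v) s"
    proof -
      have "pure R V S v s \<oplus>\<^bsub>base_change R V S\<^esub> pure R V S (\<ominus>\<^bsub>V\<^esub> v) s = tclass R V S 0"
        using p pure_add_left[OF VS, of v "\<ominus>\<^bsub>V\<^esub> v" s] pure_zero_left[OF VS, of s]
        by (simp add: V.r_neg base_change_sel)
      then have "frag_of (v, s) + frag_of (\<ominus>\<^bsub>V\<^esub> v, s) \<in> tensor_kernel R V S"
        using p VS by (simp add: tclass_add tclass_cong_iff)
      then have "- (frag_of (v, s) + frag_of (\<ominus>\<^bsub>V\<^esub> v, s)) \<in> tensor_kernel R V S"
        by (rule tensor_kernel_closed[OF VS])
      then show ?thesis using p VS by (simp add: tclass_cong_iff)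
    qed
    then show ?case using p pure by simp
  next
    case (diff a b)
    then have k: "Poly_Mapping.keys a \<subseteq> pairs V S" "Poly_Mapping.keys b \<subseteq> pairs V S" by auto
    have ka: "Poly_Mapping.keys (- a) \<subseteq> pairs V S" "Poly_Mapping.keys (- b) \<subseteq> pairs V S"
      using k by simp_all
    have "Q (tclass R V S (a + - b))"
      using diff k ka by (subst tclass_add[OF VS, symmetric]) (simp_all add: add tclass_closed)
    moreover have "Q (tclass R V S (b + - a))"
      using diff k ka by (subst tclass_add[OF VS, symmetric]) (simp_all add: add tclass_closed)
    ultimately show ?case using k by (simp add: keys_diff_subset)
  qed
  then show ?thesis using u by (elim base_change_tclassE) simp
qed

lemma tensor_ext:
  assumes VS: "module R V" "module R S" and G: "abelian_group G" and u: "u \<in> carrier (base_change R V S)"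
    and f: "\<And>x. x \<in> carrier (base_change R V S) \<Longrightarrow> f x \<in> carrier G"
      "\<And>x y. x \<in> carrier (base_change R V S) \<Longrightarrow> y \<in> carrier (base_change R V S) \<Longrightarrow>
        f (x \<oplus>\<^bsub>base_change R V S\<^esub> y) = f x \<oplus>\<^bsub>G\<^esub> f y"
    and g: "\<And>x. x \<in> carrier (base_change R V S) \<Longrightarrow> g x \<in> carrier G"
      "\<And>x y. x \<in> carrier (base_change R V S) \<Longrightarrow> y \<in> carrier (base_change R V S) \<Longrightarrow>
        g (x \<oplus>\<^bsub>base_change R V S\<^esub> y) = g x \<oplus>\<^bsub>G\<^esub> g y"
    and eq: "\<And>v s. v \<in> carrier V \<Longrightarrow> s \<in> carrier S \<Longrightarrow> f (pure R V S v s) = g (pure R V S v s)"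
  shows "f u = g u"
  using VS u
proof (induction rule: tensor_induct)
  case zero
  show ?case
    using additive_zero[OF abelian_group_base_change[OF VS] G, of f, OF f]
      additive_zero[OF abelian_group_base_change[OF VS] G, of g, OF g] by simp
qed (simp_all add: f g eq)

section \<open>The universal property of the tensor product\<close>

definition frag_sum :: "('b, 'y) ring_scheme \<Rightarrow> ('c \<Rightarrow> 'b) \<Rightarrow> ('c \<Rightarrow>\<^sub>0 int) \<Rightarrow> 'b" where
  "frag_sum G \<phi> c = (\<Oplus>\<^bsub>G\<^esub>p\<in>Poly_Mapping.keys c. add_pow G (Poly_Mapping.lookup c p) (\<phi> p))"

text \<open>The homomorphism \<open>V \<otimes> W \<rightarrow> G\<close> with \<open>v \<otimes> w \<mapsto> \<phi> (v, w)\<close>, given by evaluating on a representative.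
  The natural morphism \<open>M(K) \<otimes> S \<rightarrow> M(S)\<close> in the definition of D-proquasi-coherence is literally of
  this form.\<close>

definition tensor_lift :: "('b, 'y) ring_scheme \<Rightarrow> ('v \<times> 'w \<Rightarrow> 'b) \<Rightarrow> (('v \<times> 'w) \<Rightarrow>\<^sub>0 int) set \<Rightarrow> 'b"
  where "tensor_lift G \<phi> C = the_elem (frag_sum G \<phi> ` C)"

definition balanced ::
    "('a, 'x) ring_scheme \<Rightarrow> ('a, 'v) module \<Rightarrow> ('a, 'w) module \<Rightarrow> ('b, 'y) ring_scheme
      \<Rightarrow> ('v \<times> 'w \<Rightarrow> 'b) \<Rightarrow> bool" where
  "balanced R V W G \<phi> \<longleftrightarrow>
     (\<forall>v\<in>carrier V. \<forall>w\<in>carrier W. \<phi> (v, w) \<in> carrier G) \<and>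
     (\<forall>v\<in>carrier V. \<forall>v'\<in>carrier V. \<forall>w\<in>carrier W. \<phi> (v \<oplus>\<^bsub>V\<^esub> v', w) = \<phi> (v, w) \<oplus>\<^bsub>G\<^esub> \<phi> (v', w)) \<and>
     (\<forall>v\<in>carrier V. \<forall>w\<in>carrier W. \<forall>w'\<in>carrier W. \<phi> (v, w \<oplus>\<^bsub>W\<^esub> w') = \<phi> (v, w) \<oplus>\<^bsub>G\<^esub> \<phi> (v, w')) \<and>
     (\<forall>r\<in>carrier R. \<forall>v\<in>carrier V. \<forall>w\<in>carrier W. \<phi> (r \<odot>\<^bsub>V\<^esub> v, w) = \<phi> (v, r \<odot>\<^bsub>W\<^esub> w))"

lemma frag_sum_hom:
  fixes G (structure)
  assumes "abelian_group G" "\<phi> \<in> B \<rightarrow> carrier G"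
  defines "h \<equiv> frag_sum G \<phi>"
  shows "Poly_Mapping.keys c \<subseteq> B \<Longrightarrow> h c \<in> carrier G"
    and "x \<in> B \<Longrightarrow> h (frag_of x) = \<phi> x"
    and "h 0 = \<zero>"
    and "Poly_Mapping.keys c \<subseteq> B \<Longrightarrow> Poly_Mapping.keys d \<subseteq> B \<Longrightarrow> h (c + d) = h c \<oplus> h d"
    and "Poly_Mapping.keys c \<subseteq> B \<Longrightarrow> Poly_Mapping.keys d \<subseteq> B \<Longrightarrow> h (c - d) = h c \<ominus> h d"
proof -
  interpret G: abelian_group G by fact
  have phi: "\<phi> x \<in> carrier G" if "x \<in> B" for x using assms(2) that by auto
  have pow_closed: "add_pow G n (\<phi> x) \<in> carrier G" if "x \<in> B" for x and n :: int
    using phi[OF that] by (rule G.add.int_pow_closed)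
  have pow_zero: "add_pow G (0 :: int) x = \<zero>" for x
    by (simp add: add_pow_def)
  show closed: "h c \<in> carrier G" if "Poly_Mapping.keys c \<subseteq> B" for c
    unfolding h_def frag_sum_def by (intro G.finsum_closed Pi_I pow_closed) (rule subsetD[OF that])
  show "h (frag_of x) = \<phi> x" if "x \<in> B"
    using phi[OF that] by (simp add: h_def frag_sum_def keys_frag_of G.add.int_pow_1)
  show "h 0 = \<zero>" by (simp add: h_def frag_sum_def)
  have extend: "h c = (\<Oplus>p\<in>F. add_pow G (Poly_Mapping.lookup c p) (\<phi> p))"
    if "Poly_Mapping.keys c \<subseteq> F" "F \<subseteq> B" "finite F" for c F
    unfolding h_def frag_sum_def
  proof (rule G.add.finprod_mono_neutral_cong_left)
    show "add_pow G (Poly_Mapping.lookup c p) (\<phi> p) = \<zero>" if "p \<in> F - Poly_Mapping.keys c" for p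
      using that by (simp add: not_in_keys_iff_lookup_eq_zero pow_zero)
    show "(\<lambda>p. add_pow G (Poly_Mapping.lookup c p) (\<phi> p)) \<in> F \<rightarrow> carrier G"
      by (intro Pi_I pow_closed) (rule subsetD[OF that(2)])
  qed (use that in simp_all)
  show add: "h (c + d) = h c \<oplus> h d" if "Poly_Mapping.keys c \<subseteq> B" "Poly_Mapping.keys d \<subseteq> B" for c d
  proof -
    let ?F = "Poly_Mapping.keys c \<union> Poly_Mapping.keys d"
    have F: "finite ?F" "?F \<subseteq> B" using that by auto
    have cl: "(\<lambda>p. add_pow G (n p) (\<phi> p)) \<in> ?F \<rightarrow> carrier G" for n :: "_ \<Rightarrow> int"
      by (intro Pi_I pow_closed) (rule subsetD[OF F(2)])
    have "h (c + d) = (\<Oplus>p\<in>?F. add_pow G (Poly_Mapping.lookup (c + d) p) (\<phi> p))"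
      by (rule extend[OF keys_add F(2,1)])
    also have "\<dots> = (\<Oplus>p\<in>?F. add_pow G (Poly_Mapping.lookup c p) (\<phi> p) \<oplus> add_pow G (Poly_Mapping.lookup d p) (\<phi> p))"
    proof (rule G.finsum_cong')
      show "(\<lambda>p. add_pow G (Poly_Mapping.lookup c p) (\<phi> p) \<oplus> add_pow G (Poly_Mapping.lookup d p) (\<phi> p)) \<in> ?F \<rightarrow> carrier G"
        by (intro Pi_I G.add.m_closed pow_closed; rule subsetD[OF F(2)])
      show "add_pow G (Poly_Mapping.lookup (c + d) p) (\<phi> p) =
        add_pow G (Poly_Mapping.lookup c p) (\<phi> p) \<oplus> add_pow G (Poly_Mapping.lookup d p) (\<phi> p)"
        if "p \<in> ?F" for p
        using phi[OF subsetD[OF F(2) that]] by (simp add: lookup_add G.add.int_pow_mult)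
    qed simp
    also have "\<dots> = h c \<oplus> h d"
      using F by (subst G.finsum_addf[OF cl cl]) (simp add: extend[of _ ?F])
    finally show ?thesis .
  qed
  show "h (c - d) = h c \<ominus> h d" if "Poly_Mapping.keys c \<subseteq> B" "Poly_Mapping.keys d \<subseteq> B"
  proof -
    have k: "Poly_Mapping.keys (c - d) \<subseteq> B" using that by (rule keys_diff_subset)
    have "h c = h (c - d) \<oplus> h d" using add[OF k that(2)] by simp
    then show ?thesis using closed[OF k] closed[OF that(1)] closed[OF that(2)]
      by (simp add: G.minus_eq G.add.m_assoc G.r_neg)
  qed
qed

text \<open>The sum on the right kills the relators of the tensor product, hence is constant on each coset;
  this is what makes \<open>the_elem\<close> in the definition of the lift meaningful.\<close>

lemma tensor_lift_tclass:
  fixes G (structure)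
  assumes VW: "module R V" "module R W" and G: "abelian_group G" and \<phi>: "balanced R V W G \<phi>"
    and c: "Poly_Mapping.keys c \<subseteq> pairs V W"
  shows "tensor_lift G \<phi> (tclass R V W c) = frag_sum G \<phi> c"
proof -
  interpret V: module R V by fact
  interpret W: module R W by fact
  interpret G: abelian_group G by fact
  define h where "h = frag_sum G \<phi>"
  have phi': "\<phi> (v, w) \<in> carrier G" if "v \<in> carrier V" "w \<in> carrier W" for v w
    using \<phi> that by (simp add: balanced_def)
  then have phi: "\<phi> \<in> pairs V W \<rightarrow> carrier G" by auto
  note hh = frag_sum_hom[OF G phi, folded h_def]
  note relc = tensor_relators_subset[OF VW, unfolded tensor_free_def]
  have cancel: "x \<oplus> y \<ominus> x \<ominus> y = \<zero>" if "x \<in> carrier G" "y \<in> carrier G" for x y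
  proof -
    have "x \<oplus> y \<ominus> x \<ominus> y = (x \<oplus> \<ominus> x) \<oplus> (y \<oplus> \<ominus> y)"
      using that by (simp add: G.minus_eq G.add.m_ac)
    then show ?thesis using that by (simp add: G.r_neg)
  qed
  have rel2: "h (frag_of p - frag_of q) = \<phi> p \<ominus> \<phi> q" if "p \<in> pairs V W" "q \<in> pairs V W" for p q
  proof -
    have "Poly_Mapping.keys (frag_of p) \<subseteq> pairs V W" "Poly_Mapping.keys (frag_of q) \<subseteq> pairs V W"
      using that by simp_all
    then show ?thesis by (simp only: hh(5) hh(2)[OF that(1)] hh(2)[OF that(2)])
  qed
  have rel3: "h (frag_of p - frag_of q - frag_of r) = \<phi> p \<ominus> \<phi> q \<ominus> \<phi> r"
    if "p \<in> pairs V W" "q \<in> pairs V W" "r \<in> pairs V W" for p q r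
  proof -
    have "Poly_Mapping.keys (frag_of p - frag_of q) \<subseteq> pairs V W"
      by (rule keys_diff_subset) (use that in simp_all)
    moreover have "Poly_Mapping.keys (frag_of r) \<subseteq> pairs V W" using that by simp
    ultimately show ?thesis by (simp only: hh(5) hh(2)[OF that(3)] rel2[OF that(1,2)])
  qed
  have rel: "h r = \<zero>" if "r \<in> tensor_relators R V W" for r
    using that unfolding tensor_relators_def
  proof (elim UnE CollectE exE conjE)
    fix v v' w assume *: "v \<in> carrier V" "v' \<in> carrier V" "w \<in> carrier W"
      and r: "r = frag_of (v \<oplus>\<^bsub>V\<^esub> v', w) - frag_of (v, w) - frag_of (v', w)"
    then have "h r = \<phi> (v \<oplus>\<^bsub>V\<^esub> v', w) \<ominus> \<phi> (v, w) \<ominus> \<phi> (v', w)"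
      by (simp add: rel3)
    then show ?thesis using * \<phi> phi' by (simp add: balanced_def cancel)
  next
    fix v w w' assume *: "v \<in> carrier V" "w \<in> carrier W" "w' \<in> carrier W"
      and r: "r = frag_of (v, w \<oplus>\<^bsub>W\<^esub> w') - frag_of (v, w) - frag_of (v, w')"
    then have "h r = \<phi> (v, w \<oplus>\<^bsub>W\<^esub> w') \<ominus> \<phi> (v, w) \<ominus> \<phi> (v, w')"
      by (simp add: rel3)
    then show ?thesis using * \<phi> phi' by (simp add: balanced_def cancel)
  next
    fix a v w assume *: "a \<in> carrier R" "v \<in> carrier V" "w \<in> carrier W"
      and r: "r = frag_of (a \<odot>\<^bsub>V\<^esub> v, w) - frag_of (v, a \<odot>\<^bsub>W\<^esub> w)"
    then have "h r = \<phi> (a \<odot>\<^bsub>V\<^esub> v, w) \<ominus> \<phi> (v, a \<odot>\<^bsub>W\<^esub> w)"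
      by (simp add: rel2)
    then show ?thesis using * \<phi> phi' by (simp add: balanced_def G.minus_eq G.r_neg)
  qed
  have ker: "h k = \<zero> \<and> Poly_Mapping.keys k \<subseteq> pairs V W" if "k \<in> tensor_kernel R V W" for k
    using that unfolding tensor_kernel_def
  proof (induction rule: generate.induct)
    case one
    then show ?case by (simp add: hh(3) tensor_free_def)
  next
    case (incl r)
    then show ?case using rel subsetD[OF relc] by simp
  next
    case (inv r)
    then have r: "Poly_Mapping.keys r \<subseteq> pairs V W" using subsetD[OF relc] by simp
    have "h (0 - r) = \<zero> \<ominus> \<zero>" using r rel[OF inv] by (subst hh(5)) (simp_all add: hh(3))
    then show ?case using r by (simp add: tensor_free_def G.minus_eq)
  next
    case (eng a b)
    then have k: "Poly_Mapping.keys a \<subseteq> pairs V W" "Poly_Mapping.keys b \<subseteq> pairs V W" by blast+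
    then have "Poly_Mapping.keys (a + b) \<subseteq> pairs V W" using keys_add[of a b] by blast
    then show ?case using eng k by (simp add: tensor_free_def hh(4))
  qed
  have "h d = h c" if d: "d \<in> tclass R V W c" for d
  proof -
    obtain k where "k \<in> tensor_kernel R V W" "d = k + c" using d by (auto simp: tclass_eq)
    then show ?thesis using ker[of k] hh(4)[OF _ c, of k] hh(1)[OF c] by simp
  qed
  moreover have "c \<in> tclass R V W c"
    using tensor_kernel_closed(1)[OF VW] by (force simp: tclass_eq)
  ultimately have "h ` tclass R V W c = {h c}" by blast
  then show ?thesis by (simp add: tensor_lift_def h_def)
qed

lemma
  assumes VS: "module R V" "module R S" and G: "abelian_group G" and \<phi>: "balanced R V S G \<phi>"
  shows tensor_lift_pure: "v \<in> carrier V \<Longrightarrow> s \<in> carrier S \<Longrightarrow> tensor_lift G \<phi> (pure R V S v s) = \<phi> (v, s)"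
    and tensor_lift_closed: "x \<in> carrier (base_change R V S) \<Longrightarrow> tensor_lift G \<phi> x \<in> carrier G"
    and tensor_lift_add: "x \<in> carrier (base_change R V S) \<Longrightarrow> y \<in> carrier (base_change R V S) \<Longrightarrow>
      tensor_lift G \<phi> (x \<oplus>\<^bsub>base_change R V S\<^esub> y) = tensor_lift G \<phi> x \<oplus>\<^bsub>G\<^esub> tensor_lift G \<phi> y"
    and tensor_lift_zero: "tensor_lift G \<phi> \<zero>\<^bsub>base_change R V S\<^esub> = \<zero>\<^bsub>G\<^esub>"
proof -
  have phi: "\<phi> \<in> pairs V S \<rightarrow> carrier G" using \<phi> by (auto simp: balanced_def)
  note hh = frag_sum_hom[OF G phi]
  note lift = tensor_lift_tclass[OF VS G \<phi>]
  show "tensor_lift G \<phi> (pure R V S v s) = \<phi> (v, s)" if "v \<in> carrier V" "s \<in> carrier S"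
  proof -
    have "(v, s) \<in> pairs V S" using that by simp
    then show ?thesis using hh(2)[of "(v, s)"] lift[of "frag_of (v, s)"] by simp
  qed
  show closed: "tensor_lift G \<phi> x \<in> carrier G" if "x \<in> carrier (base_change R V S)" for x
    using that by (elim base_change_tclassE) (simp add: lift hh(1))
  show "tensor_lift G \<phi> (x \<oplus>\<^bsub>base_change R V S\<^esub> y) = tensor_lift G \<phi> x \<oplus>\<^bsub>G\<^esub> tensor_lift G \<phi> y"
    if x: "x \<in> carrier (base_change R V S)" and y: "y \<in> carrier (base_change R V S)"
  proof -
    obtain c d where c: "x = tclass R V S c" "Poly_Mapping.keys c \<subseteq> pairs V S"
      and d: "y = tclass R V S d" "Poly_Mapping.keys d \<subseteq> pairs V S"
      using x y by (elim base_change_tclassE)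
    have "Poly_Mapping.keys (c + d) \<subseteq> pairs V S" using c d keys_add[of c d] by blast
    then show ?thesis using c d by (simp add: tclass_add[OF VS] lift hh(4))
  qed
  show "tensor_lift G \<phi> \<zero>\<^bsub>base_change R V S\<^esub> = \<zero>\<^bsub>G\<^esub>"
    using hh(3) lift[of 0] by (simp add: base_change_sel)
qed

section \<open>Functoriality of the tensor product\<close>

lemma tensor_relators_map:
  assumes g: "linear_on R S T g" and r: "r \<in> tensor_relators R V S"
  shows "frag_extend (\<lambda>(v, s). frag_of (v, g s)) r \<in> tensor_relators R V T"
  using r unfolding tensor_relators_def
proof (elim UnE CollectE exE conjE, goal_cases)
  case (1 v v' w)
  then show ?case using linear_onD(1)[OF g, of w]
    by (intro UnI1 CollectI exI[of _ v] exI[of _ v'] exI[of _ "g w"]) (simp add: frag_extend_diff)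
next
  case (2 v w w')
  then show ?case using linear_onD(1)[OF g, of w] linear_onD(1)[OF g, of w'] linear_onD(2)[OF g, of w w']
    by (intro UnI1 UnI2 CollectI exI[of _ v] exI[of _ "g w"] exI[of _ "g w'"]) (simp add: frag_extend_diff)
next
  case (3 a v w)
  then show ?case using linear_onD(1)[OF g, of w] linear_onD(3)[OF g, of a w]
    by (intro UnI2 CollectI exI[of _ a] exI[of _ v] exI[of _ "g w"]) (simp add: frag_extend_diff)
qed

lemma tensor_map_tclass:
  assumes V: "module R V" and S: "module R S" and T: "module R T" and g: "linear_on R S T g"
    and c: "Poly_Mapping.keys c \<subseteq> pairs V S"
  shows "tensor_map R V T g (tclass R V S c) = tclass R V T (frag_extend (\<lambda>(v, s). frag_of (v, g s)) c)"
    and "Poly_Mapping.keys (frag_extend (\<lambda>(v, s). frag_of (v, g s)) c) \<subseteq> pairs V T"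
proof -
  let ?e = "frag_extend (\<lambda>(v, s). frag_of (v, g s))"
  show "Poly_Mapping.keys (?e c) \<subseteq> pairs V T"
    by (rule order_trans[OF keys_frag_extend]) (use c linear_onD(1)[OF g] in fastforce)
  note KT = tensor_kernel_closed[OF V T]
  have ker: "?e k \<in> tensor_kernel R V T" if "k \<in> tensor_kernel R V S" for k
    using that unfolding tensor_kernel_def[of R V S]
  proof (induction rule: generate.induct)
    case one
    then show ?case by (simp add: KT tensor_free_def)
  next
    case (incl r)
    then show ?case by (rule relator_in_kernel[OF tensor_relators_map[OF g]])
  next
    case (inv r)
    have "Poly_Mapping.keys r \<subseteq> pairs V S"
      using subsetD[OF tensor_relators_subset[OF V S] inv] by (simp add: tensor_free_def)
    then show ?case using KT(4)[OF relator_in_kernel[OF tensor_relators_map[OF g inv]]]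
      by (simp add: tensor_free_def frag_extend_minus)
  next
    case (eng a b)
    then show ?case by (simp add: tensor_free_def frag_extend_add KT)
  qed
  show "tensor_map R V T g (tclass R V S c) = tclass R V T (?e c)"
  proof (intro equalityI subsetI)
    fix x assume "x \<in> tensor_map R V T g (tclass R V S c)"
    then obtain k k' where k: "k \<in> tensor_kernel R V T" "k' \<in> tensor_kernel R V S" "x = k + ?e (k' + c)"
      by (auto simp: tensor_map_def set_mult_def tclass_eq tensor_free_def)
    then have "x = (k + ?e k') + ?e c" by (simp add: frag_extend_add)
    then show "x \<in> tclass R V T (?e c)"
      unfolding tclass_eq using KT(3)[OF k(1) ker[OF k(2)]] by (rule image_eqI)
  next
    fix x assume "x \<in> tclass R V T (?e c)"
    then obtain k where "k \<in> tensor_kernel R V T" "x = k + ?e (0 + c)" by (auto simp: tclass_eq)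
    then show "x \<in> tensor_map R V T g (tclass R V S c)"
      using tensor_kernel_closed(1)[OF V S]
      unfolding tensor_map_def set_mult_def tclass_eq tensor_free_def mult_free_Abelian_group by blast
  qed
qed

lemma
  assumes V: "module R V" and S: "module R S" and T: "module R T" and g: "linear_on R S T g"
  shows tensor_map_pure: "v \<in> carrier V \<Longrightarrow> s \<in> carrier S \<Longrightarrow>
      tensor_map R V T g (pure R V S v s) = pure R V T v (g s)"
    and tensor_map_closed: "x \<in> carrier (base_change R V S) \<Longrightarrow>
      tensor_map R V T g x \<in> carrier (base_change R V T)"
    and tensor_map_add: "x \<in> carrier (base_change R V S) \<Longrightarrow> y \<in> carrier (base_change R V S) \<Longrightarrow>
      tensor_map R V T g (x \<oplus>\<^bsub>base_change R V S\<^esub> y) =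
      tensor_map R V T g x \<oplus>\<^bsub>base_change R V T\<^esub> tensor_map R V T g y"
    and tensor_map_zero: "tensor_map R V T g \<zero>\<^bsub>base_change R V S\<^esub> = \<zero>\<^bsub>base_change R V T\<^esub>"
proof -
  note tm = tensor_map_tclass[OF V S T g]
  show "tensor_map R V T g (pure R V S v s) = pure R V T v (g s)" if "v \<in> carrier V" "s \<in> carrier S"
    using that by (simp add: tm)
  show "tensor_map R V T g x \<in> carrier (base_change R V T)" if "x \<in> carrier (base_change R V S)"
    using that by (elim base_change_tclassE) (simp add: tm tclass_closed)
  show "tensor_map R V T g (x \<oplus>\<^bsub>base_change R V S\<^esub> y) =
      tensor_map R V T g x \<oplus>\<^bsub>base_change R V T\<^esub> tensor_map R V T g y"
    if x: "x \<in> carrier (base_change R V S)" and y: "y \<in> carrier (base_change R V S)"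
  proof -
    obtain c d where c: "x = tclass R V S c" "Poly_Mapping.keys c \<subseteq> pairs V S"
      and d: "y = tclass R V S d" "Poly_Mapping.keys d \<subseteq> pairs V S"
      using x y by (elim base_change_tclassE)
    have "Poly_Mapping.keys (c + d) \<subseteq> pairs V S" using c d keys_add[of c d] by blast
    then show ?thesis using c d by (simp add: tclass_add[OF V S] tclass_add[OF V T] tm frag_extend_add)
  qed
  show "tensor_map R V T g \<zero>\<^bsub>base_change R V S\<^esub> = \<zero>\<^bsub>base_change R V T\<^esub>"
    using tm(1)[of 0] by (simp add: base_change_sel)
qed

lemma tensor_map_comp:
  assumes V: "module R V" and S: "module R S" and T: "module R T" and U: "module R U"
    and g: "linear_on R S T g" and h: "linear_on R T U h" and x: "x \<in> carrier (base_change R V S)"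
  shows "tensor_map R V U h (tensor_map R V T g x) = tensor_map R V U (\<lambda>s. h (g s)) x"
proof -
  note gh = linear_on_comp[OF g h]
  show ?thesis using V S x
  proof (induction rule: tensor_induct)
    case zero
    then show ?case by (simp add: tensor_map_zero[OF V S T g] tensor_map_zero[OF V T U h] tensor_map_zero[OF V S U gh])
  next
    case (pure v s)
    then show ?case
      by (simp add: tensor_map_pure[OF V S T g] tensor_map_pure[OF V T U h] tensor_map_pure[OF V S U gh] linear_onD[OF g])
  next
    case (add x y)
    then show ?case
      by (simp add: tensor_map_add[OF V S T g] tensor_map_add[OF V T U h] tensor_map_add[OF V S U gh]
          tensor_map_closed[OF V S T g])
  qed
qed

lemma tensor_map_cong:
  assumes V: "module R V" and S: "module R S" and T: "module R T"
    and g: "linear_on R S T g" and h: "linear_on R S T h" and eq: "\<And>s. s \<in> carrier S \<Longrightarrow> g s = h s"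
    and x: "x \<in> carrier (base_change R V S)"
  shows "tensor_map R V T g x = tensor_map R V T h x"
  using V S x
proof (induction rule: tensor_induct)
  case zero
  then show ?case by (simp add: tensor_map_zero[OF V S T g] tensor_map_zero[OF V S T h])
next
  case (pure v s)
  then show ?case by (simp add: tensor_map_pure[OF V S T g] tensor_map_pure[OF V S T h] eq)
next
  case (add x y)
  then show ?case by (simp add: tensor_map_add[OF V S T g] tensor_map_add[OF V S T h])
qed

lemma tensor_map_sum:
  assumes V: "module R V" and S: "module R S" and T: "module R T"
    and g: "linear_on R S T g" and h: "linear_on R S T h" and gh: "linear_on R S T (\<lambda>s. g s \<oplus>\<^bsub>T\<^esub> h s)"
    and x: "x \<in> carrier (base_change R V S)"
  shows "tensor_map R V T (\<lambda>s. g s \<oplus>\<^bsub>T\<^esub> h s) x =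
    tensor_map R V T g x \<oplus>\<^bsub>base_change R V T\<^esub> tensor_map R V T h x"
proof -
  interpret B: abelian_group "base_change R V T" by (rule abelian_group_base_change[OF V T])
  show ?thesis using V S x
  proof (induction rule: tensor_induct)
    case zero
    then show ?case by (simp add: tensor_map_zero[OF V S T g] tensor_map_zero[OF V S T h] tensor_map_zero[OF V S T gh])
  next
    case (pure v s)
    then show ?case by (simp add: tensor_map_pure[OF V S T g] tensor_map_pure[OF V S T h]
          tensor_map_pure[OF V S T gh] pure_add_right[OF V T] linear_onD[OF g] linear_onD[OF h])
  next
    case (add x y)
    then show ?case by (simp add: tensor_map_add[OF V S T g] tensor_map_add[OF V S T h]
          tensor_map_add[OF V S T gh] tensor_map_closed[OF V S T g] tensor_map_closed[OF V S T h] B.add.m_ac)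
  qed
qed

section \<open>Linear functionals\<close>

lemma regular_sel [simp]:
  "carrier (regular S) = carrier S" "\<zero>\<^bsub>regular S\<^esub> = \<zero>\<^bsub>S\<^esub>" "\<one>\<^bsub>regular S\<^esub> = \<one>\<^bsub>S\<^esub>"
  "x \<oplus>\<^bsub>regular S\<^esub> y = x \<oplus>\<^bsub>S\<^esub> y" "x \<otimes>\<^bsub>regular S\<^esub> y = x \<otimes>\<^bsub>S\<^esub> y" "x \<odot>\<^bsub>regular S\<^esub> y = x \<otimes>\<^bsub>S\<^esub> y"
  by (simp_all add: regular_def with_smult_def)

lemma cring_regular:
  assumes "cring K"
  shows "cring (regular K)"
proof -
  interpret cring K by fact
  show ?thesis
    by (intro cringI abelian_groupI comm_monoidI)
      (auto simp: a_ac m_ac l_distr r_distr intro: add.l_inv_ex)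
qed

lemma algebra_regular:
  assumes "cring K"
  shows "algebra K (regular K)"
proof -
  interpret cring K by fact
  show ?thesis
    by (rule algebraI[OF assms cring_regular[OF assms]])
      (simp_all add: l_distr r_distr m_assoc)
qed

text \<open>By Zorn's lemma there is a submodule \<open>N \<supseteq> W\<close> maximal among those that do not contain \<open>x\<close>.
  Then \<open>E = N \<oplus> K x\<close>: if \<open>y\<close> is not in \<open>N\<close>, then \<open>x\<close> lies in \<open>N + K y\<close>, and the coefficient of \<open>y\<close>
  can be inverted. The functional is the coordinate along \<open>x\<close>.\<close>

lemma exists_linear_functional:
  assumes K: "field K" and E: "module K E" and W: "submodule W K E"
    and x: "x \<in> carrier E" "x \<notin> W"
  obtains l where "linear_on K E (regular K) l" "\<And>w. w \<in> W \<Longrightarrow> l w = \<zero>\<^bsub>K\<^esub>" "l x = \<one>\<^bsub>K\<^esub>"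
proof -
  interpret K: field K by fact
  interpret E: module K E by fact
  have zero_mem: "\<zero>\<^bsub>E\<^esub> \<in> N" if N: "submodule N K E" for N
  proof -
    interpret submodule N K E by fact
    show ?thesis using one_closed by simp
  qed
  define \<A> where "\<A> = {N. submodule N K E \<and> W \<subseteq> N \<and> x \<notin> N}"
  have "\<exists>N\<in>\<A>. \<forall>Y\<in>\<A>. N \<subseteq> Y \<longrightarrow> Y = N"
  proof (rule subset_Zorn_nonempty)
    show "\<A> \<noteq> {}" using W x by (auto simp: \<A>_def)
    fix \<C> assume ne: "\<C> \<noteq> {}" and chain: "subset.chain \<A> \<C>"
    have sub: "submodule N K E" "W \<subseteq> N" "x \<notin> N" if "N \<in> \<C>" for N
      using that chain by (auto simp: subset.chain_def \<A>_def)
    have "submodule (\<Union>\<C>) K E"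
    proof (rule E.submoduleI)
      show "\<Union>\<C> \<subseteq> carrier E" using sub(1) E.submoduleE(1) by blast
      show "\<zero>\<^bsub>E\<^esub> \<in> \<Union>\<C>" using ne sub(1) zero_mem by blast
      show "\<ominus>\<^bsub>E\<^esub> a \<in> \<Union>\<C>" if "a \<in> \<Union>\<C>" for a
        using that sub(1) E.submoduleE(3) by blast
      show "a \<oplus>\<^bsub>E\<^esub> b \<in> \<Union>\<C>" if ab: "a \<in> \<Union>\<C>" "b \<in> \<Union>\<C>" for a b
      proof -
        obtain N M where NM: "N \<in> \<C>" "a \<in> N" "M \<in> \<C>" "b \<in> M" using ab by blast
        then have "N \<subseteq> M \<or> M \<subseteq> N" using chain by (auto simp: subset.chain_def)
        then show ?thesis using NM E.submoduleE(5)[OF sub(1)] by blast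
      qed
      show "a \<odot>\<^bsub>E\<^esub> b \<in> \<Union>\<C>" if "a \<in> carrier K" "b \<in> \<Union>\<C>" for a b
        using that sub(1) E.submoduleE(4) by blast
    qed
    moreover have "W \<subseteq> \<Union>\<C>" using ne sub(2) by blast
    ultimately show "\<Union>\<C> \<in> \<A>" using sub(3) by (auto simp: \<A>_def)
  qed
  then obtain N where NA: "N \<in> \<A>" and NM: "\<forall>Y\<in>\<A>. N \<subseteq> Y \<longrightarrow> Y = N" by (elim bexE)
  have N: "submodule N K E" "W \<subseteq> N" "x \<notin> N" using NA by (simp_all add: \<A>_def)
  have max: "Y = N" if "submodule Y K E" "N \<subseteq> Y" "x \<notin> Y" for Y
    using bspec[OF NM, of Y] that N(2) by (simp add: \<A>_def)
  note NE = E.submoduleE[OF N(1)] zero_mem[OF N(1)]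
  have NC: "n \<in> carrier E" if "n \<in> N" for n using NE(1) that by auto
  have diff_zero: "c = \<zero>\<^bsub>K\<^esub>" if c: "c \<in> carrier K" "c \<odot>\<^bsub>E\<^esub> x \<in> N" for c
  proof (rule ccontr)
    assume "c \<noteq> \<zero>\<^bsub>K\<^esub>"
    then have u: "inv\<^bsub>K\<^esub> c \<in> carrier K" "inv\<^bsub>K\<^esub> c \<otimes>\<^bsub>K\<^esub> c = \<one>\<^bsub>K\<^esub>"
      using c K.field_Units by auto
    then have "x = inv\<^bsub>K\<^esub> c \<odot>\<^bsub>E\<^esub> (c \<odot>\<^bsub>E\<^esub> x)" using c x by (simp flip: E.smult_assoc1)
    then show False using NE(4)[OF u(1) c(2)] N(3) by simp
  qed
  have uniq: "c = d" if c: "c \<in> carrier K" "d \<in> carrier K" "n \<in> N" "m \<in> N"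
    and eq: "n \<oplus>\<^bsub>E\<^esub> c \<odot>\<^bsub>E\<^esub> x = m \<oplus>\<^bsub>E\<^esub> d \<odot>\<^bsub>E\<^esub> x" for c d n m
  proof -
    have cl: "c \<odot>\<^bsub>E\<^esub> x \<in> carrier E" "d \<odot>\<^bsub>E\<^esub> x \<in> carrier E" "n \<in> carrier E" "m \<in> carrier E"
      using c x NC by auto
    have "(c \<ominus>\<^bsub>K\<^esub> d) \<odot>\<^bsub>E\<^esub> x = c \<odot>\<^bsub>E\<^esub> x \<oplus>\<^bsub>E\<^esub> \<ominus>\<^bsub>E\<^esub> (d \<odot>\<^bsub>E\<^esub> x)"
      using c x by (simp add: K.minus_eq E.smult_l_distr E.smult_l_minus)
    also have "\<dots> = \<ominus>\<^bsub>E\<^esub> n \<oplus>\<^bsub>E\<^esub> (n \<oplus>\<^bsub>E\<^esub> c \<odot>\<^bsub>E\<^esub> x) \<oplus>\<^bsub>E\<^esub> \<ominus>\<^bsub>E\<^esub> (d \<odot>\<^bsub>E\<^esub> x)"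
      using cl by (simp add: E.M.r_neg1)
    also have "\<dots> = \<ominus>\<^bsub>E\<^esub> n \<oplus>\<^bsub>E\<^esub> m"
      unfolding eq using cl by (simp add: E.add.m_assoc E.M.r_neg)
    also have "\<dots> \<in> N" using c NE by simp
    finally have "c \<ominus>\<^bsub>K\<^esub> d = \<zero>\<^bsub>K\<^esub>" using c by (intro diff_zero) auto
    then show ?thesis using c by simp
  qed
  have decomp: "\<exists>c\<in>carrier K. \<exists>n\<in>N. y = n \<oplus>\<^bsub>E\<^esub> c \<odot>\<^bsub>E\<^esub> x" if y: "y \<in> carrier E" for y
  proof (cases "y \<in> N")
    case True
    then show ?thesis using x by (intro bexI[of _ "\<zero>\<^bsub>K\<^esub>"] bexI[of _ y]) (auto simp: NC)
  next
    case False
    define M where "M = {n \<oplus>\<^bsub>E\<^esub> c \<odot>\<^bsub>E\<^esub> y | n c. n \<in> N \<and> c \<in> carrier K}"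
    have MI: "n \<oplus>\<^bsub>E\<^esub> c \<odot>\<^bsub>E\<^esub> y \<in> M" if "n \<in> N" "c \<in> carrier K" for n c
      using that by (auto simp: M_def)
    have "submodule M K E"
    proof (rule E.submoduleI)
      show "M \<subseteq> carrier E" using y NC by (auto simp: M_def)
      show "\<zero>\<^bsub>E\<^esub> \<in> M" unfolding M_def using y NE
        by (intro CollectI exI[of _ "\<zero>\<^bsub>E\<^esub>"] exI[of _ "\<zero>\<^bsub>K\<^esub>"]) auto
      show "\<ominus>\<^bsub>E\<^esub> a \<in> M" if aM: "a \<in> M" for a
      proof -
        obtain n c where a: "a = n \<oplus>\<^bsub>E\<^esub> c \<odot>\<^bsub>E\<^esub> y" "n \<in> N" "c \<in> carrier K" using aM by (auto simp: M_def)
        then have "\<ominus>\<^bsub>E\<^esub> a = \<ominus>\<^bsub>E\<^esub> n \<oplus>\<^bsub>E\<^esub> (\<ominus>\<^bsub>K\<^esub> c) \<odot>\<^bsub>E\<^esub> y"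
          using y NC by (simp add: E.smult_l_minus E.minus_add)
        then show ?thesis using a NE(3) by (simp only: MI K.a_inv_closed)
      qed
      show "a \<oplus>\<^bsub>E\<^esub> b \<in> M" if ab: "a \<in> M" "b \<in> M" for a b
      proof -
        obtain n c where a: "a = n \<oplus>\<^bsub>E\<^esub> c \<odot>\<^bsub>E\<^esub> y" "n \<in> N" "c \<in> carrier K" using ab(1) by (auto simp: M_def)
        obtain m d where b: "b = m \<oplus>\<^bsub>E\<^esub> d \<odot>\<^bsub>E\<^esub> y" "m \<in> N" "d \<in> carrier K" using ab(2) by (auto simp: M_def)
        have "a \<oplus>\<^bsub>E\<^esub> b = (n \<oplus>\<^bsub>E\<^esub> m) \<oplus>\<^bsub>E\<^esub> (c \<oplus>\<^bsub>K\<^esub> d) \<odot>\<^bsub>E\<^esub> y"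
          using a b y NC by (simp add: E.smult_l_distr E.add.m_ac)
        then show ?thesis using a b NE(5) by (simp only: MI K.a_closed)
      qed
      show "r \<odot>\<^bsub>E\<^esub> a \<in> M" if r: "r \<in> carrier K" "a \<in> M" for r a
      proof -
        obtain n c where a: "a = n \<oplus>\<^bsub>E\<^esub> c \<odot>\<^bsub>E\<^esub> y" "n \<in> N" "c \<in> carrier K" using r by (auto simp: M_def)
        then have "r \<odot>\<^bsub>E\<^esub> a = r \<odot>\<^bsub>E\<^esub> n \<oplus>\<^bsub>E\<^esub> (r \<otimes>\<^bsub>K\<^esub> c) \<odot>\<^bsub>E\<^esub> y"
          using y r NC by (simp add: E.smult_r_distr E.smult_assoc1)
        then show ?thesis using a r NE(4) by (simp only: MI K.m_closed)
      qed
    qed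
    moreover have "N \<subseteq> M"
    proof
      fix n assume "n \<in> N"
      then show "n \<in> M" unfolding M_def using y NC
        by (intro CollectI exI[of _ n] exI[of _ "\<zero>\<^bsub>K\<^esub>"]) auto
    qed
    moreover have "y \<in> M" unfolding M_def using y NE
      by (intro CollectI exI[of _ "\<zero>\<^bsub>E\<^esub>"] exI[of _ "\<one>\<^bsub>K\<^esub>"]) auto
    ultimately have "x \<in> M" using max[of M] False by blast
    then obtain n c where nc: "x = n \<oplus>\<^bsub>E\<^esub> c \<odot>\<^bsub>E\<^esub> y" "n \<in> N" "c \<in> carrier K" by (auto simp: M_def)
    have "c \<noteq> \<zero>\<^bsub>K\<^esub>"
    proof
      assume "c = \<zero>\<^bsub>K\<^esub>"
      then have "x = n" using nc y NC by simp
      then show False using nc N(3) by simp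
    qed
    then have u: "inv\<^bsub>K\<^esub> c \<in> carrier K" "inv\<^bsub>K\<^esub> c \<otimes>\<^bsub>K\<^esub> c = \<one>\<^bsub>K\<^esub>"
      using nc K.field_Units by auto
    have n: "n \<in> carrier E" using nc NC by simp
    have "y = inv\<^bsub>K\<^esub> c \<odot>\<^bsub>E\<^esub> (c \<odot>\<^bsub>E\<^esub> y)" using u nc y by (simp flip: E.smult_assoc1)
    also have "c \<odot>\<^bsub>E\<^esub> y = \<ominus>\<^bsub>E\<^esub> n \<oplus>\<^bsub>E\<^esub> x" unfolding nc(1) using n nc y by (simp add: E.M.r_neg1)
    also have "inv\<^bsub>K\<^esub> c \<odot>\<^bsub>E\<^esub> (\<ominus>\<^bsub>E\<^esub> n \<oplus>\<^bsub>E\<^esub> x) = inv\<^bsub>K\<^esub> c \<odot>\<^bsub>E\<^esub> (\<ominus>\<^bsub>E\<^esub> n) \<oplus>\<^bsub>E\<^esub> inv\<^bsub>K\<^esub> c \<odot>\<^bsub>E\<^esub> x"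
      using u n x by (simp add: E.smult_r_distr)
    finally show ?thesis using u(1) NE(4)[OF u(1) NE(3)[OF nc(2)]] by (intro bexI)
  qed
  define l where "l y = (THE c. c \<in> carrier K \<and> (\<exists>n\<in>N. y = n \<oplus>\<^bsub>E\<^esub> c \<odot>\<^bsub>E\<^esub> x))" for y
  have l_eq: "l (n \<oplus>\<^bsub>E\<^esub> c \<odot>\<^bsub>E\<^esub> x) = c" if "n \<in> N" "c \<in> carrier K" for n c
    unfolding l_def
  proof (rule the_equality)
    show "c \<in> carrier K \<and> (\<exists>m\<in>N. n \<oplus>\<^bsub>E\<^esub> c \<odot>\<^bsub>E\<^esub> x = m \<oplus>\<^bsub>E\<^esub> c \<odot>\<^bsub>E\<^esub> x)" using that by blast
    show "d = c" if "d \<in> carrier K \<and> (\<exists>m\<in>N. n \<oplus>\<^bsub>E\<^esub> c \<odot>\<^bsub>E\<^esub> x = m \<oplus>\<^bsub>E\<^esub> d \<odot>\<^bsub>E\<^esub> x)" for d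
      using that uniq[OF \<open>c \<in> carrier K\<close> _ \<open>n \<in> N\<close>, of d] by (elim conjE bexE) simp
  qed
  have lin: "linear_on K E (regular K) l"
  proof (rule linear_onI)
    fix y assume "y \<in> carrier E"
    then obtain c n where y: "c \<in> carrier K" "n \<in> N" "y = n \<oplus>\<^bsub>E\<^esub> c \<odot>\<^bsub>E\<^esub> x" using decomp by blast
    then show "l y \<in> carrier (regular K)" by (simp add: l_eq)
    fix a assume a: "a \<in> carrier K"
    have "a \<odot>\<^bsub>E\<^esub> y = a \<odot>\<^bsub>E\<^esub> n \<oplus>\<^bsub>E\<^esub> (a \<otimes>\<^bsub>K\<^esub> c) \<odot>\<^bsub>E\<^esub> x"
      using a y x NC by (simp add: E.smult_r_distr E.smult_assoc1)
    then show "l (a \<odot>\<^bsub>E\<^esub> y) = a \<odot>\<^bsub>regular K\<^esub> l y" using a y NE by (simp add: l_eq)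
  next
    fix y z assume yz: "y \<in> carrier E" "z \<in> carrier E"
    obtain c n d m where y: "c \<in> carrier K" "n \<in> N" "y = n \<oplus>\<^bsub>E\<^esub> c \<odot>\<^bsub>E\<^esub> x"
      and z: "d \<in> carrier K" "m \<in> N" "z = m \<oplus>\<^bsub>E\<^esub> d \<odot>\<^bsub>E\<^esub> x"
      using decomp[OF yz(1)] decomp[OF yz(2)] by (elim bexE)
    have "y \<oplus>\<^bsub>E\<^esub> z = (n \<oplus>\<^bsub>E\<^esub> m) \<oplus>\<^bsub>E\<^esub> (c \<oplus>\<^bsub>K\<^esub> d) \<odot>\<^bsub>E\<^esub> x"
      using y z x NC by (simp add: E.smult_l_distr E.add.m_ac)
    then show "l (y \<oplus>\<^bsub>E\<^esub> z) = l y \<oplus>\<^bsub>regular K\<^esub> l z" using y z NE by (simp add: l_eq)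
  qed
  show ?thesis
  proof (rule that[OF lin])
    show "l w = \<zero>\<^bsub>K\<^esub>" if "w \<in> W" for w
      using l_eq[of w "\<zero>\<^bsub>K\<^esub>"] that N(2) NC x by auto
    show "l x = \<one>\<^bsub>K\<^esub>" using l_eq[of "\<zero>\<^bsub>E\<^esub>" "\<one>\<^bsub>K\<^esub>"] NE x by simp
  qed
qed

lemma linear_on_add_rank_one:
  assumes E: "module K E" and L: "linear_on K E E L" and l: "linear_on K E (regular K) l" and c: "c \<in> carrier E"
  shows "linear_on K E E (\<lambda>x. L x \<oplus>\<^bsub>E\<^esub> l x \<odot>\<^bsub>E\<^esub> c)"
proof -
  interpret E: module K E by fact
  show ?thesis
    using linear_onD[OF L] linear_onD[OF l] c
    by (intro linear_onI) (simp_all add: E.smult_l_distr E.smult_r_distr E.smult_assoc1 E.add.m_ac)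
qed

text \<open>A linear map of finite rank is one that is reached from \<open>0\<close> by adding maps \<open>x \<mapsto> l(x) c\<close>; stating
  this as closure of an arbitrary property \<open>Z\<close> avoids speaking of rank. The set is enlarged by one
  point \<open>x\<close> at a time: the correction is \<open>l(_) (x - L x)\<close>, where \<open>l\<close> vanishes on the vectors already
  fixed by \<open>L\<close> and \<open>l(x) = 1\<close>.\<close>

lemma finite_rank_fixing_finite_set:
  assumes K: "field K" and E: "module K E" and F: "finite F" "F \<subseteq> carrier E"
    and zero: "Z (\<lambda>_. \<zero>\<^bsub>E\<^esub>)"
    and step: "\<And>L c l. linear_on K E E L \<Longrightarrow> Z L \<Longrightarrow> c \<in> carrier E \<Longrightarrow> linear_on K E (regular K) l \<Longrightarrow>
      Z (\<lambda>x. L x \<oplus>\<^bsub>E\<^esub> l x \<odot>\<^bsub>E\<^esub> c)"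
  shows "\<exists>L. linear_on K E E L \<and> Z L \<and> (\<forall>x\<in>F. L x = x)"
  using F
proof (induction F)
  case empty
  interpret E: module K E by fact
  show ?case using zero by (intro exI[of _ "\<lambda>_. \<zero>\<^bsub>E\<^esub>"]) (auto simp: linear_on_def)
next
  case (insert x F)
  interpret E: module K E by fact
  obtain L where L: "linear_on K E E L" "Z L" "\<And>y. y \<in> F \<Longrightarrow> L y = y" using insert by auto
  note LD = linear_onD[OF L(1)]
  define W where "W = {y \<in> carrier E. L y = y}"
  have x: "x \<in> carrier E" using insert by simp
  show ?case
  proof (cases "L x = x")
    case True
    then show ?thesis using L by blast
  next
    case False
    have "submodule W K E"
    proof (rule E.submoduleI)
      show "\<zero>\<^bsub>E\<^esub> \<in> W" using additive_zero[OF E.abelian_group_axioms E.abelian_group_axioms, of L] LD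
        by (simp add: W_def)
      show "\<ominus>\<^bsub>E\<^esub> a \<in> W" if "a \<in> W" for a
        using that LD(3)[of "\<ominus>\<^bsub>K\<^esub> \<one>\<^bsub>K\<^esub>" a] by (simp add: W_def E.smult_l_minus)
    qed (auto simp: W_def LD)
    then obtain l where l: "linear_on K E (regular K) l" "\<And>w. w \<in> W \<Longrightarrow> l w = \<zero>\<^bsub>K\<^esub>" "l x = \<one>\<^bsub>K\<^esub>"
      using exists_linear_functional[OF K E, of W x] x False by (auto simp: W_def)
    define c where "c = x \<ominus>\<^bsub>E\<^esub> L x"
    have c: "c \<in> carrier E" using x LD by (simp add: c_def)
    have "L x \<oplus>\<^bsub>E\<^esub> l x \<odot>\<^bsub>E\<^esub> c = x"
      using x c LD by (simp add: l c_def E.minus_eq E.add.m_ac E.M.r_neg)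
    moreover have "L y \<oplus>\<^bsub>E\<^esub> l y \<odot>\<^bsub>E\<^esub> c = y" if "y \<in> F" for y
    proof -
      have "y \<in> W" using that insert L by (auto simp: W_def)
      then show ?thesis using l(2) c by (auto simp: W_def)
    qed
    ultimately show ?thesis
      using linear_on_add_rank_one[OF E L(1) l(1) c] step[OF L(1,2) c l(1)]
      by (intro exI[of _ "\<lambda>x. L x \<oplus>\<^bsub>E\<^esub> l x \<odot>\<^bsub>E\<^esub> c"]) auto
  qed
qed

section \<open>Tensors over a field are separated by slices\<close>

text \<open>The map \<open>l \<otimes> 1 : V \<otimes> S \<rightarrow> K \<otimes> S = S\<close>.\<close>

definition slice :: "'u alg \<Rightarrow> ('v \<Rightarrow> 'u) \<Rightarrow> ('u, 'v) tensors \<Rightarrow> 'u" where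
  "slice S l = tensor_lift S (\<lambda>(v, s). l v \<odot>\<^bsub>S\<^esub> s)"

lemma
  assumes V: "module K V" and S: "algebra K S" and l: "linear_on K V (regular K) l"
  shows slice_pure: "v \<in> carrier V \<Longrightarrow> s \<in> carrier S \<Longrightarrow> slice S l (pure K V S v s) = l v \<odot>\<^bsub>S\<^esub> s"
    and slice_closed: "x \<in> carrier (base_change K V S) \<Longrightarrow> slice S l x \<in> carrier S"
    and slice_add: "x \<in> carrier (base_change K V S) \<Longrightarrow> y \<in> carrier (base_change K V S) \<Longrightarrow>
      slice S l (x \<oplus>\<^bsub>base_change K V S\<^esub> y) = slice S l x \<oplus>\<^bsub>S\<^esub> slice S l y"
proof -
  interpret S: algebra K S by fact
  have "balanced K V S S (\<lambda>(v, s). l v \<odot>\<^bsub>S\<^esub> s)"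
    using linear_onD[OF l]
    by (simp add: balanced_def S.smult_l_distr S.smult_r_distr S.smult_assoc1 S.R.m_comm flip: S.smult_assoc1)
  note * = V S.module S.abelian_group_axioms this
  show "v \<in> carrier V \<Longrightarrow> s \<in> carrier S \<Longrightarrow> slice S l (pure K V S v s) = l v \<odot>\<^bsub>S\<^esub> s"
    "x \<in> carrier (base_change K V S) \<Longrightarrow> slice S l x \<in> carrier S"
    "x \<in> carrier (base_change K V S) \<Longrightarrow> y \<in> carrier (base_change K V S) \<Longrightarrow>
      slice S l (x \<oplus>\<^bsub>base_change K V S\<^esub> y) = slice S l x \<oplus>\<^bsub>S\<^esub> slice S l y"
    unfolding slice_def
    using tensor_lift_pure[OF *] tensor_lift_closed[OF *] tensor_lift_add[OF *]
    by simp_all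
qed

lemma slice_tensor_map:
  assumes V: "module K V" and S: "algebra K S" and T: "algebra K T" and l: "linear_on K V (regular K) l"
    and g: "linear_on K S T g" and u: "u \<in> carrier (base_change K V S)"
  shows "slice T l (tensor_map K V T g u) = g (slice S l u)"
proof -
  interpret S: algebra K S by fact
  interpret T: algebra K T by fact
  note tm = tensor_map_pure[OF V S.module T.module g] tensor_map_closed[OF V S.module T.module g]
    tensor_map_add[OF V S.module T.module g]
  note sl = slice_pure[OF V S l] slice_pure[OF V T l] slice_closed[OF V S l] slice_closed[OF V T l]
    slice_add[OF V S l] slice_add[OF V T l]
  show ?thesis
    by (rule tensor_ext[OF V S.module T.abelian_group_axioms u, where f="\<lambda>u. slice T l (tensor_map K V T g u)"])
      (use linear_onD[OF g] linear_onD(1)[OF l] in \<open>simp_all add: tm sl\<close>)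
qed

text \<open>The map \<open>L \<otimes> 1\<close> on \<open>V \<otimes> S\<close>.\<close>

definition tensor_left :: "('u, 'x) ring_scheme \<Rightarrow> ('u, 'v) module \<Rightarrow> 'u alg \<Rightarrow> ('v \<Rightarrow> 'v)
    \<Rightarrow> ('u, 'v) tensors \<Rightarrow> ('u, 'v) tensors" where
  "tensor_left K V S L = tensor_lift (base_change K V S) (\<lambda>(v, s). pure K V S (L v) s)"

lemma
  assumes VS: "module K V" "module K S" and L: "linear_on K V V L"
  shows tensor_left_pure: "v \<in> carrier V \<Longrightarrow> s \<in> carrier S \<Longrightarrow>
      tensor_left K V S L (pure K V S v s) = pure K V S (L v) s"
    and tensor_left_closed: "x \<in> carrier (base_change K V S) \<Longrightarrow>
      tensor_left K V S L x \<in> carrier (base_change K V S)"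
    and tensor_left_add: "x \<in> carrier (base_change K V S) \<Longrightarrow> y \<in> carrier (base_change K V S) \<Longrightarrow>
      tensor_left K V S L (x \<oplus>\<^bsub>base_change K V S\<^esub> y) =
      tensor_left K V S L x \<oplus>\<^bsub>base_change K V S\<^esub> tensor_left K V S L y"
    and tensor_left_zero: "tensor_left K V S L \<zero>\<^bsub>base_change K V S\<^esub> = \<zero>\<^bsub>base_change K V S\<^esub>"
proof -
  interpret S: module K S by fact
  have "balanced K V S (base_change K V S) (\<lambda>(v, s). pure K V S (L v) s)"
    using linear_onD[OF L]
    by (simp add: balanced_def pure_closed pure_add_left[OF VS] pure_add_right[OF VS] pure_smult[OF VS])
  note * = VS abelian_group_base_change[OF VS] this
  show "v \<in> carrier V \<Longrightarrow> s \<in> carrier S \<Longrightarrow>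
      tensor_left K V S L (pure K V S v s) = pure K V S (L v) s"
    "x \<in> carrier (base_change K V S) \<Longrightarrow> tensor_left K V S L x \<in> carrier (base_change K V S)"
    "x \<in> carrier (base_change K V S) \<Longrightarrow> y \<in> carrier (base_change K V S) \<Longrightarrow>
      tensor_left K V S L (x \<oplus>\<^bsub>base_change K V S\<^esub> y) =
      tensor_left K V S L x \<oplus>\<^bsub>base_change K V S\<^esub> tensor_left K V S L y"
    "tensor_left K V S L \<zero>\<^bsub>base_change K V S\<^esub> = \<zero>\<^bsub>base_change K V S\<^esub>"
    unfolding tensor_left_def
    using tensor_lift_pure[OF *] tensor_lift_closed[OF *] tensor_lift_add[OF *] tensor_lift_zero[OF *]
    by simp_all
qed

text \<open>The finite set consists of the left factors in an expression of \<open>u\<close> as a sum of pure tensors.\<close>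

lemma tensor_left_fixes:
  assumes VS: "module K V" "module K S" and u: "u \<in> carrier (base_change K V S)"
  shows "\<exists>F. finite F \<and> F \<subseteq> carrier V \<and>
    (\<forall>L. linear_on K V V L \<longrightarrow> (\<forall>v\<in>F. L v = v) \<longrightarrow> tensor_left K V S L u = u)"
  using VS u
proof (induction rule: tensor_induct)
  case zero
  show ?case using tensor_left_zero[OF VS] by (intro exI[of _ "{}"]) simp
next
  case (pure v s)
  then show ?case using tensor_left_pure[OF VS] by (intro exI[of _ "{v}"]) simp
next
  case (add x y)
  obtain F where F: "finite F" "F \<subseteq> carrier V"
    "\<And>L. linear_on K V V L \<Longrightarrow> \<forall>v\<in>F. L v = v \<Longrightarrow> tensor_left K V S L x = x" using add.IH(1) by blast
  obtain G where G: "finite G" "G \<subseteq> carrier V"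
    "\<And>L. linear_on K V V L \<Longrightarrow> \<forall>v\<in>G. L v = v \<Longrightarrow> tensor_left K V S L y = y" using add.IH(2) by blast
  show ?case
    using F G tensor_left_add[OF VS _ add.hyps]
    by (intro exI[of _ "F \<union> G"]) simp
qed

text \<open>Choose \<open>L = l\<^sub>1(_) c\<^sub>1 + \<dots> + l\<^sub>n(_) c\<^sub>n\<close> of finite rank with \<open>(L \<otimes> 1) u = u\<close>. As
  \<open>(L \<otimes> 1) u\<close> is the sum of the \<open>c\<^sub>i \<otimes> (l\<^sub>i \<otimes> 1) u\<close>, it is zero.\<close>

lemma tensor_eq_zero:
  assumes K: "field K" and V: "module K V" and S: "algebra K S" and u: "u \<in> carrier (base_change K V S)"
    and slices: "\<And>l. linear_on K V (regular K) l \<Longrightarrow> slice S l u = \<zero>\<^bsub>S\<^esub>"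
  shows "u = \<zero>\<^bsub>base_change K V S\<^esub>"
proof -
  interpret V: module K V by fact
  interpret S: algebra K S by fact
  note VS = V S.module
  interpret B: abelian_group "base_change K V S" by (rule abelian_group_base_change[OF VS])
  obtain F where F: "finite F" "F \<subseteq> carrier V"
    "\<And>L. linear_on K V V L \<Longrightarrow> \<forall>v\<in>F. L v = v \<Longrightarrow> tensor_left K V S L u = u"
    using tensor_left_fixes[OF VS u] by blast
  have zero_lin: "linear_on K V V (\<lambda>_. \<zero>\<^bsub>V\<^esub>)" by (simp add: linear_on_def)
  have "\<exists>L. linear_on K V V L \<and> tensor_left K V S L u = \<zero>\<^bsub>base_change K V S\<^esub> \<and> (\<forall>v\<in>F. L v = v)"
  proof (rule finite_rank_fixing_finite_set[OF K V F(1,2)])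
    show "tensor_left K V S (\<lambda>_. \<zero>\<^bsub>V\<^esub>) u = \<zero>\<^bsub>base_change K V S\<^esub>"
      by (rule tensor_ext[OF VS B.abelian_group_axioms u, where g="\<lambda>_. \<zero>\<^bsub>base_change K V S\<^esub>"])
        (simp_all add: tensor_left_closed[OF VS zero_lin] tensor_left_add[OF VS zero_lin]
          tensor_left_pure[OF VS zero_lin] pure_zero_left[OF VS])
    fix L c l
    assume L: "linear_on K V V L" "tensor_left K V S L u = \<zero>\<^bsub>base_change K V S\<^esub>"
      and c: "c \<in> carrier V" and l: "linear_on K V (regular K) l"
    note M = linear_on_add_rank_one[OF V L(1) l c]
    note Ld = linear_onD[OF L(1)]
    note ld = linear_onD[OF l]
    have "tensor_left K V S (\<lambda>x. L x \<oplus>\<^bsub>V\<^esub> l x \<odot>\<^bsub>V\<^esub> c) u =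
      tensor_left K V S L u \<oplus>\<^bsub>base_change K V S\<^esub> pure K V S c (slice S l u)"
    proof (rule tensor_ext[OF VS B.abelian_group_axioms u,
          where g="\<lambda>u. tensor_left K V S L u \<oplus>\<^bsub>base_change K V S\<^esub> pure K V S c (slice S l u)"])
      fix x assume x: "x \<in> carrier (base_change K V S)"
      note cl = tensor_left_closed[OF VS L(1)] pure_closed slice_closed[OF V S l] c
      show "tensor_left K V S L x \<oplus>\<^bsub>base_change K V S\<^esub> pure K V S c (slice S l x) \<in> carrier (base_change K V S)"
        using x by (simp add: cl)
      fix y assume y: "y \<in> carrier (base_change K V S)"
      have cl': "tensor_left K V S L x \<in> carrier (base_change K V S)"
        "tensor_left K V S L y \<in> carrier (base_change K V S)"
        "pure K V S c (slice S l x) \<in> carrier (base_change K V S)"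
        "pure K V S c (slice S l y) \<in> carrier (base_change K V S)"
        using x y by (simp_all add: cl)
      show "tensor_left K V S L (x \<oplus>\<^bsub>base_change K V S\<^esub> y) \<oplus>\<^bsub>base_change K V S\<^esub>
          pure K V S c (slice S l (x \<oplus>\<^bsub>base_change K V S\<^esub> y)) =
        (tensor_left K V S L x \<oplus>\<^bsub>base_change K V S\<^esub> pure K V S c (slice S l x)) \<oplus>\<^bsub>base_change K V S\<^esub>
        (tensor_left K V S L y \<oplus>\<^bsub>base_change K V S\<^esub> pure K V S c (slice S l y))"
        using x y cl' by (simp add: tensor_left_add[OF VS L(1)] slice_add[OF V S l]
            pure_add_right[OF VS c] slice_closed[OF V S l] B.add.m_ac)
    next
      fix v s assume v: "v \<in> carrier V" "s \<in> carrier S"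
      show "tensor_left K V S (\<lambda>x. L x \<oplus>\<^bsub>V\<^esub> l x \<odot>\<^bsub>V\<^esub> c) (pure K V S v s) =
        tensor_left K V S L (pure K V S v s) \<oplus>\<^bsub>base_change K V S\<^esub> pure K V S c (slice S l (pure K V S v s))"
        using v c Ld(1)[of v] ld(1)[of v]
        by (simp add: tensor_left_pure[OF VS M] tensor_left_pure[OF VS L(1)] slice_pure[OF V S l]
            pure_add_left[OF VS] pure_smult[OF VS])
    qed (simp_all add: tensor_left_closed[OF VS M] tensor_left_add[OF VS M])
    then show "tensor_left K V S (\<lambda>x. L x \<oplus>\<^bsub>V\<^esub> l x \<odot>\<^bsub>V\<^esub> c) u = \<zero>\<^bsub>base_change K V S\<^esub>"
      by (simp add: L slices[OF l] pure_zero_right[OF VS c])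
  qed
  then show ?thesis using F(3) by auto
qed

section \<open>Proquasi-coherent modules\<close>

lemma alg_hom_linear:
  assumes "h \<in> alg_hom K S T"
  shows "linear_on K S T h"
  using assms by (intro linear_onI) (auto simp: alg_hom_def ring_hom_def)

lemma mult_linear:
  assumes "algebra K S" "s \<in> carrier S"
  shows "linear_on K S S (\<lambda>t. s \<otimes>\<^bsub>S\<^esub> t)"
proof -
  interpret algebra K S by fact
  show ?thesis using assms(2)
    by (intro linear_onI) (simp_all add: r_distr m_comm[of s] smult_assoc2)
qed

lemma unit_hom_alg_hom:
  assumes "algebra K S"
  shows "unit_hom K S \<in> alg_hom K (regular K) S"
proof -
  interpret algebra K S by fact
  have "(a \<odot>\<^bsub>S\<^esub> \<one>\<^bsub>S\<^esub>) \<otimes>\<^bsub>S\<^esub> (b \<odot>\<^bsub>S\<^esub> \<one>\<^bsub>S\<^esub>) = (a \<otimes>\<^bsub>K\<^esub> b) \<odot>\<^bsub>S\<^esub> \<one>\<^bsub>S\<^esub>"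
    if "a \<in> carrier K" "b \<in> carrier K" for a b
    using that by (simp add: smult_assoc2 smult_assoc1)
  then show ?thesis
    by (auto simp: alg_hom_def ring_hom_def unit_hom_def smult_l_distr smult_assoc1)
qed

lemma quasi_coherent_sel [simp]:
  "Ob (quasi_coherent K V) = base_change K V"
  "Ar (quasi_coherent K V) S T h = tensor_map K V T h"
  "s \<odot>\<^bsub>base_change K V S\<^esub> x = tensor_map K V S (\<lambda>t. s \<otimes>\<^bsub>S\<^esub> t) x"
  by (simp_all add: quasi_coherent_def base_change_def)

text \<open>A morphism \<open>t\<close> between quasi-coherent modules is \<open>t\<^sub>K \<otimes> 1\<close>, so it commutes with \<open>1 \<otimes> g\<close> for every linear
  \<open>g\<close>, although naturality gives this only for homomorphisms of algebras.\<close>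

lemma quasi_coherent_hom_tensor_map:
  assumes V: "module K V" and V': "module K V'" and S: "algebra K S" and T: "algebra K T"
    and t: "t \<in> functor_hom K (quasi_coherent K V) (quasi_coherent K V')"
    and g: "linear_on K S T g" and u: "u \<in> carrier (base_change K V S)"
  shows "t T (tensor_map K V T g u) = tensor_map K V' T g (t S u)"
proof -
  interpret S: algebra K S by fact
  interpret T: algebra K T by fact
  note R = algebra_regular[OF S.R_cring]
  interpret R: algebra K "regular K" by (rule R)
  have lin: "t S x \<in> carrier (base_change K V' S)"
    "y \<in> carrier (base_change K V S) \<Longrightarrow> t S (x \<oplus>\<^bsub>base_change K V S\<^esub> y) = t S x \<oplus>\<^bsub>base_change K V' S\<^esub> t S y"
    "s \<in> carrier S \<Longrightarrow> t S (tensor_map K V S (\<lambda>t. s \<otimes>\<^bsub>S\<^esub> t) x) = tensor_map K V' S (\<lambda>t. s \<otimes>\<^bsub>S\<^esub> t) (t S x)"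
    if "algebra K S" "x \<in> carrier (base_change K V S)" for S x y s
  proof -
    have "t S \<in> linear_maps S (base_change K V S) (base_change K V' S)"
      using t that by (auto simp: functor_hom_def)
    then show "t S x \<in> carrier (base_change K V' S)"
      "y \<in> carrier (base_change K V S) \<Longrightarrow> t S (x \<oplus>\<^bsub>base_change K V S\<^esub> y) = t S x \<oplus>\<^bsub>base_change K V' S\<^esub> t S y"
      "s \<in> carrier S \<Longrightarrow> t S (tensor_map K V S (\<lambda>t. s \<otimes>\<^bsub>S\<^esub> t) x) = tensor_map K V' S (\<lambda>t. s \<otimes>\<^bsub>S\<^esub> t) (t S x)"
      using that by (auto simp: linear_maps_def)
  qed
  have nat: "t T (tensor_map K V T h x) = tensor_map K V' T h (t S x)"
    if "algebra K S" "algebra K T" "h \<in> alg_hom K S T" "x \<in> carrier (base_change K V S)" for S T h x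
    using t that by (simp add: functor_hom_def)
  define w where "w v = t (regular K) (pure K V (regular K) v \<one>\<^bsub>K\<^esub>)" for v
  have w: "w v \<in> carrier (base_change K V' (regular K))" if "v \<in> carrier V" for v
    using that unfolding w_def by (intro lin(1)[OF R] pure_closed) simp_all
  \<comment> \<open>A morphism is determined by \<open>t\<^sub>K\<close>, since \<open>v \<otimes> s = s \<cdot> (v \<otimes> 1)\<close>.\<close>
  have formula: "t U (pure K V U v s) = tensor_map K V' U (\<lambda>c. s \<otimes>\<^bsub>U\<^esub> unit_hom K U c) (w v)"
    and formula_lin: "linear_on K (regular K) U (\<lambda>c. s \<otimes>\<^bsub>U\<^esub> unit_hom K U c)"
    if U: "algebra K U" and v: "v \<in> carrier V" and s: "s \<in> carrier U" for U v s
  proof -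
    interpret U: algebra K U by fact
    let ?e = "pure K V (regular K) v \<one>\<^bsub>K\<^esub>" and ?u = "unit_hom K U"
    note u = unit_hom_alg_hom[OF U]
    note ul = alg_hom_linear[OF u] and sl = mult_linear[OF U s]
    have e: "?e \<in> carrier (base_change K V (regular K))" using v by (intro pure_closed) simp_all
    have ue: "tensor_map K V U ?u ?e \<in> carrier (base_change K V U)"
      by (rule tensor_map_closed[OF V R.module U.module ul e])
    have "pure K V U v s = tensor_map K V U (\<lambda>t. s \<otimes>\<^bsub>U\<^esub> t) (tensor_map K V U ?u ?e)"
    proof -
      have "tensor_map K V U ?u ?e = pure K V U v \<one>\<^bsub>U\<^esub>"
        using v tensor_map_pure[OF V R.module U.module ul, of v "\<one>\<^bsub>K\<^esub>"] by (simp add: unit_hom_def)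
      then show ?thesis using v s tensor_map_pure[OF V U.module U.module sl, of v "\<one>\<^bsub>U\<^esub>"] by simp
    qed
    then have "t U (pure K V U v s) = tensor_map K V' U (\<lambda>t. s \<otimes>\<^bsub>U\<^esub> t) (tensor_map K V' U ?u (w v))"
      using lin(3)[OF U ue s] nat[OF R U u e] by (simp add: w_def)
    then show "t U (pure K V U v s) = tensor_map K V' U (\<lambda>c. s \<otimes>\<^bsub>U\<^esub> ?u c) (w v)"
      by (simp add: tensor_map_comp[OF V' R.module U.module U.module ul sl w[OF v]])
    show "linear_on K (regular K) U (\<lambda>c. s \<otimes>\<^bsub>U\<^esub> unit_hom K U c)"
      by (rule linear_on_comp[OF ul sl])
  qed
  note tm = tensor_map_closed[OF V S.module T.module g] tensor_map_add[OF V S.module T.module g]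
  note tm' = tensor_map_closed[OF V' S.module T.module g] tensor_map_add[OF V' S.module T.module g]
  show ?thesis
  proof (rule tensor_ext[OF V S.module abelian_group_base_change[OF V' T.module] u,
        where f="\<lambda>u. t T (tensor_map K V T g u)"])
    fix v s assume v: "v \<in> carrier V" and s: "s \<in> carrier S"
    have gs: "g s \<in> carrier T" using s linear_onD(1)[OF g] by simp
    have "t T (tensor_map K V T g (pure K V S v s)) =
        tensor_map K V' T (\<lambda>c. g s \<otimes>\<^bsub>T\<^esub> unit_hom K T c) (w v)"
      using v s gs by (simp add: tensor_map_pure[OF V S.module T.module g] formula[OF T])
    also have "\<dots> = tensor_map K V' T (\<lambda>c. g (s \<otimes>\<^bsub>S\<^esub> unit_hom K S c)) (w v)"
    proof (rule tensor_map_cong[OF V' R.module T.module formula_lin[OF T v gs]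
          linear_on_comp[OF formula_lin[OF S v s] g] _ w[OF v]])
      fix c assume "c \<in> carrier (regular K)"
      then have c: "c \<in> carrier K" by simp
      have "s \<otimes>\<^bsub>S\<^esub> (c \<odot>\<^bsub>S\<^esub> \<one>\<^bsub>S\<^esub>) = c \<odot>\<^bsub>S\<^esub> s"
        using c s S.m_comm[of s "c \<odot>\<^bsub>S\<^esub> \<one>\<^bsub>S\<^esub>"] by (simp add: S.smult_assoc2)
      moreover have "g s \<otimes>\<^bsub>T\<^esub> (c \<odot>\<^bsub>T\<^esub> \<one>\<^bsub>T\<^esub>) = c \<odot>\<^bsub>T\<^esub> g s"
        using c gs T.m_comm[of "g s" "c \<odot>\<^bsub>T\<^esub> \<one>\<^bsub>T\<^esub>"] by (simp add: T.smult_assoc2)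
      ultimately show "g s \<otimes>\<^bsub>T\<^esub> unit_hom K T c = g (s \<otimes>\<^bsub>S\<^esub> unit_hom K S c)"
        using c s linear_onD(3)[OF g] by (simp add: unit_hom_def)
    qed
    also have "\<dots> = tensor_map K V' T g (tensor_map K V' S (\<lambda>c. s \<otimes>\<^bsub>S\<^esub> unit_hom K S c) (w v))"
      by (rule tensor_map_comp[OF V' R.module S.module T.module formula_lin[OF S v s] g w[OF v], symmetric])
    finally show "t T (tensor_map K V T g (pure K V S v s)) = tensor_map K V' T g (t S (pure K V S v s))"
      using v s by (simp add: formula[OF S])
  qed (simp_all add: tm tm' lin[OF S] lin[OF T])
qed

lemma module_functorD:
  assumes "module_functor R M"
  shows "algebra R S \<Longrightarrow> module S (Ob M S)"
    and "algebra R S \<Longrightarrow> algebra R T \<Longrightarrow> h \<in> alg_hom R S T \<Longrightarrow> x \<in> carrier (Ob M S) \<Longrightarrow>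
      Ar M S T h x \<in> carrier (Ob M T)"
    and "algebra R S \<Longrightarrow> algebra R T \<Longrightarrow> h \<in> alg_hom R S T \<Longrightarrow> x \<in> carrier (Ob M S) \<Longrightarrow>
      y \<in> carrier (Ob M S) \<Longrightarrow>
      Ar M S T h (x \<oplus>\<^bsub>Ob M S\<^esub> y) = Ar M S T h x \<oplus>\<^bsub>Ob M T\<^esub> Ar M S T h y"
    and "algebra R S \<Longrightarrow> algebra R T \<Longrightarrow> h \<in> alg_hom R S T \<Longrightarrow> s \<in> carrier S \<Longrightarrow>
      x \<in> carrier (Ob M S) \<Longrightarrow>
      Ar M S T h (s \<odot>\<^bsub>Ob M S\<^esub> x) = h s \<odot>\<^bsub>Ob M T\<^esub> Ar M S T h x"
    and "algebra R S \<Longrightarrow> x \<in> carrier (Ob M S) \<Longrightarrow> Ar M S S (\<lambda>s\<in>carrier S. s) x = x"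
    and "algebra R S \<Longrightarrow> algebra R T \<Longrightarrow> algebra R U \<Longrightarrow> g \<in> alg_hom R S T \<Longrightarrow> h \<in> alg_hom R T U \<Longrightarrow>
      x \<in> carrier (Ob M S) \<Longrightarrow>
      Ar M S U (compose (carrier S) h g) x = Ar M T U h (Ar M S T g x)"
  using assms unfolding module_functor_def by (blast+)

lemma functor_homD:
  assumes f: "f \<in> functor_hom R M N"
  shows "algebra R S \<Longrightarrow> x \<in> carrier (Ob M S) \<Longrightarrow> f S x \<in> carrier (Ob N S)"
    and "algebra R S \<Longrightarrow> x \<in> carrier (Ob M S) \<Longrightarrow> y \<in> carrier (Ob M S) \<Longrightarrow>
      f S (x \<oplus>\<^bsub>Ob M S\<^esub> y) = f S x \<oplus>\<^bsub>Ob N S\<^esub> f S y"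
    and "algebra R S \<Longrightarrow> s \<in> carrier S \<Longrightarrow> x \<in> carrier (Ob M S) \<Longrightarrow>
      f S (s \<odot>\<^bsub>Ob M S\<^esub> x) = s \<odot>\<^bsub>Ob N S\<^esub> f S x"
    and "algebra R S \<Longrightarrow> algebra R T \<Longrightarrow> h \<in> alg_hom R S T \<Longrightarrow> x \<in> carrier (Ob M S) \<Longrightarrow>
      f T (Ar M S T h x) = Ar N S T h (f S x)"
proof -
  have lin: "f S \<in> linear_maps S (Ob M S) (Ob N S)" if "algebra R S"
    using f that by (simp add: functor_hom_def)
  show "algebra R S \<Longrightarrow> x \<in> carrier (Ob M S) \<Longrightarrow> f S x \<in> carrier (Ob N S)"
    "algebra R S \<Longrightarrow> x \<in> carrier (Ob M S) \<Longrightarrow> y \<in> carrier (Ob M S) \<Longrightarrow>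
      f S (x \<oplus>\<^bsub>Ob M S\<^esub> y) = f S x \<oplus>\<^bsub>Ob N S\<^esub> f S y"
    "algebra R S \<Longrightarrow> s \<in> carrier S \<Longrightarrow> x \<in> carrier (Ob M S) \<Longrightarrow>
      f S (s \<odot>\<^bsub>Ob M S\<^esub> x) = s \<odot>\<^bsub>Ob N S\<^esub> f S x"
    using lin by (auto simp: linear_maps_def)
  show "algebra R S \<Longrightarrow> algebra R T \<Longrightarrow> h \<in> alg_hom R S T \<Longrightarrow> x \<in> carrier (Ob M S) \<Longrightarrow>
      f T (Ar M S T h x) = Ar N S T h (f S x)"
    using f by (simp add: functor_hom_def)
qed

lemma functor_homI:
  assumes "\<And>S x. algebra R S \<Longrightarrow> x \<in> carrier (Ob M S) \<Longrightarrow> f S x \<in> carrier (Ob N S)"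
    and "\<And>S x y. algebra R S \<Longrightarrow> x \<in> carrier (Ob M S) \<Longrightarrow> y \<in> carrier (Ob M S) \<Longrightarrow>
      f S (x \<oplus>\<^bsub>Ob M S\<^esub> y) = f S x \<oplus>\<^bsub>Ob N S\<^esub> f S y"
    and "\<And>S s x. algebra R S \<Longrightarrow> s \<in> carrier S \<Longrightarrow> x \<in> carrier (Ob M S) \<Longrightarrow>
      f S (s \<odot>\<^bsub>Ob M S\<^esub> x) = s \<odot>\<^bsub>Ob N S\<^esub> f S x"
    and "\<And>S T h x. algebra R S \<Longrightarrow> algebra R T \<Longrightarrow> h \<in> alg_hom R S T \<Longrightarrow> x \<in> carrier (Ob M S) \<Longrightarrow>
      f T (Ar M S T h x) = Ar N S T h (f S x)"
    and M: "module_functor R M"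
  shows "(\<lambda>S. if algebra R S then restrict (f S) (carrier (Ob M S)) else (\<lambda>_. undefined)) \<in> functor_hom R M N"
proof -
  have cl: "x \<oplus>\<^bsub>Ob M S\<^esub> y \<in> carrier (Ob M S)" "s \<in> carrier S \<Longrightarrow> s \<odot>\<^bsub>Ob M S\<^esub> x \<in> carrier (Ob M S)"
    if "algebra R S" "x \<in> carrier (Ob M S)" "y \<in> carrier (Ob M S)" for S x y s
  proof -
    interpret module S "Ob M S" by (rule module_functorD(1)[OF M that(1)])
    show "x \<oplus>\<^bsub>Ob M S\<^esub> y \<in> carrier (Ob M S)" "s \<in> carrier S \<Longrightarrow> s \<odot>\<^bsub>Ob M S\<^esub> x \<in> carrier (Ob M S)"
      using that by simp_all
  qed
  show ?thesis
    using assms cl module_functorD(2)[OF M]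
    unfolding functor_hom_def linear_maps_def by simp
qed

lemma scalar_functor_sel [simp]:
  "Ob scalar_functor = regular" "Ar scalar_functor S T h = h"
  by (simp_all add: scalar_functor_def)

text \<open>The family of morphisms \<open>P(S) \<rightarrow> V\<^sub>i \<otimes> S\<close> that identifies \<open>P\<close> with a limit of quasi-coherent modules.
  The last clause is all that is needed of the universal property of the limit: a point of \<open>P(S)\<close> can be
  transported along any linear map \<open>S \<rightarrow> T\<close>.\<close>

definition tensor_coordinates ::
    "('u, 'x) ring_scheme \<Rightarrow> ('u, 'p) mod_functor \<Rightarrow> 'i set \<Rightarrow> ('i \<Rightarrow> ('u, 'v) module)
      \<Rightarrow> ('u alg \<Rightarrow> 'p \<Rightarrow> 'i \<Rightarrow> ('u, 'v) tensors) \<Rightarrow> bool" where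
  "tensor_coordinates K P I V c \<longleftrightarrow>
     (\<forall>i\<in>I. module K (V i)) \<and>
     (\<forall>S. algebra K S \<longrightarrow> (\<forall>i\<in>I. \<forall>x\<in>carrier (Ob P S). c S x i \<in> carrier (base_change K (V i) S))) \<and>
     (\<forall>S. algebra K S \<longrightarrow> (\<forall>i\<in>I. \<forall>x\<in>carrier (Ob P S). \<forall>y\<in>carrier (Ob P S).
        c S (x \<oplus>\<^bsub>Ob P S\<^esub> y) i = c S x i \<oplus>\<^bsub>base_change K (V i) S\<^esub> c S y i)) \<and>
     (\<forall>S. algebra K S \<longrightarrow> (\<forall>i\<in>I. \<forall>s\<in>carrier S. \<forall>x\<in>carrier (Ob P S).
        c S (s \<odot>\<^bsub>Ob P S\<^esub> x) i = tensor_map K (V i) S (\<lambda>t. s \<otimes>\<^bsub>S\<^esub> t) (c S x i))) \<and>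
     (\<forall>S T h. algebra K S \<longrightarrow> algebra K T \<longrightarrow> h \<in> alg_hom K S T \<longrightarrow>
        (\<forall>i\<in>I. \<forall>x\<in>carrier (Ob P S). c T (Ar P S T h x) i = tensor_map K (V i) T h (c S x i))) \<and>
     (\<forall>S. algebra K S \<longrightarrow> (\<forall>x\<in>carrier (Ob P S). \<forall>y\<in>carrier (Ob P S).
        (\<forall>i\<in>I. c S x i = c S y i) \<longrightarrow> x = y)) \<and>
     (\<forall>S T g. algebra K S \<longrightarrow> algebra K T \<longrightarrow> linear_on K S T g \<longrightarrow> (\<forall>x\<in>carrier (Ob P S).
        \<exists>y\<in>carrier (Ob P T). \<forall>i\<in>I. c T y i = tensor_map K (V i) T g (c S x i)))"

lemma tensor_coordinatesD:
  assumes "tensor_coordinates K P I V c"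
  shows "i \<in> I \<Longrightarrow> module K (V i)"
    and "i \<in> I \<Longrightarrow> algebra K S \<Longrightarrow> x \<in> carrier (Ob P S) \<Longrightarrow> c S x i \<in> carrier (base_change K (V i) S)"
    and "i \<in> I \<Longrightarrow> algebra K S \<Longrightarrow> x \<in> carrier (Ob P S) \<Longrightarrow> y \<in> carrier (Ob P S) \<Longrightarrow>
      c S (x \<oplus>\<^bsub>Ob P S\<^esub> y) i = c S x i \<oplus>\<^bsub>base_change K (V i) S\<^esub> c S y i"
    and "i \<in> I \<Longrightarrow> algebra K S \<Longrightarrow> s \<in> carrier S \<Longrightarrow> x \<in> carrier (Ob P S) \<Longrightarrow>
      c S (s \<odot>\<^bsub>Ob P S\<^esub> x) i = tensor_map K (V i) S (\<lambda>t. s \<otimes>\<^bsub>S\<^esub> t) (c S x i)"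
    and "i \<in> I \<Longrightarrow> algebra K S \<Longrightarrow> algebra K T \<Longrightarrow> h \<in> alg_hom K S T \<Longrightarrow> x \<in> carrier (Ob P S) \<Longrightarrow>
      c T (Ar P S T h x) i = tensor_map K (V i) T h (c S x i)"
    and "algebra K S \<Longrightarrow> x \<in> carrier (Ob P S) \<Longrightarrow> y \<in> carrier (Ob P S) \<Longrightarrow>
      (\<And>i. i \<in> I \<Longrightarrow> c S x i = c S y i) \<Longrightarrow> x = y"
    and "algebra K S \<Longrightarrow> algebra K T \<Longrightarrow> linear_on K S T g \<Longrightarrow> x \<in> carrier (Ob P S) \<Longrightarrow>
      \<exists>y\<in>carrier (Ob P T). \<forall>i\<in>I. c T y i = tensor_map K (V i) T g (c S x i)"
  using assms by (simp_all add: tensor_coordinates_def)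

text \<open>For the transport along \<open>g\<close>, apply \<open>1 \<otimes> g\<close> to each coordinate. The result is again compatible with the
  transition morphisms by \<open>quasi_coherent_hom_tensor_map\<close>.\<close>

lemma proquasi_coherent_coordinates:
  fixes P :: "('u, 'p) mod_functor" and K :: "('u, 'x) ring_scheme"
  assumes "proquasi_coherent TYPE('i) TYPE('v) K P"
  obtains I :: "'i set" and V :: "'i \<Rightarrow> ('u, 'v) module" and c where "tensor_coordinates K P I V c"
proof -
  obtain I :: "'i set" and V :: "'i \<Rightarrow> ('u, 'v) module" and D where
    H: "(\<forall>i\<in>I. module K (V i)) \<and>
        (\<forall>i\<in>I. \<forall>j\<in>I. D i j \<subseteq> functor_hom K (quasi_coherent K (V i)) (quasi_coherent K (V j))) \<and>
        functor_iso K P (limit_functor I (\<lambda>i. quasi_coherent K (V i)) D)"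
    using assms unfolding proquasi_coherent_def by (elim conjE exE) (rule that, intro conjI)
  have V: "module K (V i)" if "i \<in> I" for i using H that by (elim conjE) (rule bspec)
  have D: "D i j \<subseteq> functor_hom K (quasi_coherent K (V i)) (quasi_coherent K (V j))"
    if "i \<in> I" "j \<in> I" for i j
    using H that by simp
  let ?L = "limit_functor I (\<lambda>i. quasi_coherent K (V i)) D"
  have "functor_iso K P ?L" using H by simp
  then obtain c where c: "c \<in> functor_hom K P ?L"
    and bij': "\<forall>S. algebra K S \<longrightarrow> bij_betw (c S) (carrier (Ob P S)) (carrier (Ob ?L S))"
    unfolding functor_iso_def by (elim bexE)
  have bij: "bij_betw (c S) (carrier (Ob P S)) (carrier (Ob ?L S))" if "algebra K S" for S
    using bij' that by simp
  note cD = functor_homD[OF c]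
  have carrier_L: "carrier (Ob ?L S) = {x \<in> (\<Pi>\<^sub>E i\<in>I. carrier (base_change K (V i) S)).
      \<forall>i\<in>I. \<forall>j\<in>I. \<forall>t\<in>D i j. t S (x i) = x j}" for S
    by (simp add: limit_functor_def)
  have "tensor_coordinates K P I V c"
    unfolding tensor_coordinates_def
  proof (intro conjI allI impI ballI)
    show "module K (V i)" if "i \<in> I" for i using that by (rule V)
    show cl: "c S x i \<in> carrier (base_change K (V i) S)"
      if "i \<in> I" "algebra K S" "x \<in> carrier (Ob P S)" for i S x
      using cD(1)[OF that(2,3)] that(1) unfolding carrier_L by auto
    show "c S (x \<oplus>\<^bsub>Ob P S\<^esub> y) i = c S x i \<oplus>\<^bsub>base_change K (V i) S\<^esub> c S y i"
      if "i \<in> I" "algebra K S" "x \<in> carrier (Ob P S)" "y \<in> carrier (Ob P S)" for i S x y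
      using cD(2)[OF that(2-4)] that(1) by (simp add: limit_functor_def)
    show "c S (s \<odot>\<^bsub>Ob P S\<^esub> x) i = tensor_map K (V i) S (\<lambda>t. s \<otimes>\<^bsub>S\<^esub> t) (c S x i)"
      if "i \<in> I" "algebra K S" "s \<in> carrier S" "x \<in> carrier (Ob P S)" for i S s x
      using cD(3)[OF that(2-4)] that(1) by (simp add: limit_functor_def)
    show "c T (Ar P S T h x) i = tensor_map K (V i) T h (c S x i)"
      if "i \<in> I" "algebra K S" "algebra K T" "h \<in> alg_hom K S T" "x \<in> carrier (Ob P S)" for i S T h x
      using cD(4)[OF that(2-5)] that(1) by (simp add: limit_functor_def)
    show "x = y" if S: "algebra K S" and x: "x \<in> carrier (Ob P S)" and y: "y \<in> carrier (Ob P S)"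
      and eq: "\<forall>i\<in>I. c S x i = c S y i" for S x y
    proof -
      have "c S x = c S y"
        using cD(1)[OF S x] cD(1)[OF S y] eq unfolding carrier_L by (intro PiE_ext) auto
      then show ?thesis using bij_betw_imp_inj_on[OF bij[OF S]] x y by (simp add: inj_on_def)
    qed
    show "\<exists>y\<in>carrier (Ob P T). \<forall>i\<in>I. c T y i = tensor_map K (V i) T g (c S x i)"
      if S: "algebra K S" and T: "algebra K T" and g: "linear_on K S T g" and x: "x \<in> carrier (Ob P S)"
      for S T g x
    proof -
      interpret S: algebra K S by fact
      interpret T: algebra K T by fact
      define z where "z = (\<lambda>i\<in>I. tensor_map K (V i) T g (c S x i))"
      have "z \<in> carrier (Ob ?L T)" unfolding carrier_L
      proof (intro CollectI conjI ballI PiE_I)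
        show "z i \<in> carrier (base_change K (V i) T)" if "i \<in> I" for i
          using that by (simp add: z_def tensor_map_closed[OF V[OF that] S.module T.module g] cl S x)
        show "t T (z i) = z j" if i: "i \<in> I" and j: "j \<in> I" and t: "t \<in> D i j" for i j t
        proof -
          have "t S (c S x i) = c S x j" using cD(1)[OF S x] i j t unfolding carrier_L by blast
          moreover have "t T (tensor_map K (V i) T g (c S x i)) = tensor_map K (V j) T g (t S (c S x i))"
            by (rule quasi_coherent_hom_tensor_map[OF V[OF i] V[OF j] S T subsetD[OF D[OF i j] t] g
                  cl[OF i S x]])
          ultimately show ?thesis using i j by (simp add: z_def)
        qed
      qed (simp add: z_def)
      then have "z \<in> c T ` carrier (Ob P T)" by (simp only: bij_betw_imp_surj_on[OF bij[OF T]])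
      then obtain y where y: "z = c T y" "y \<in> carrier (Ob P T)" by (rule imageE)
      then have "c T y i = tensor_map K (V i) T g (c S x i)" if "i \<in> I" for i
        using that by (simp add: z_def flip: y(1))
      with y(2) show ?thesis by (intro bexI[of _ y] ballI)
    qed
  qed
  then show ?thesis by (rule that)
qed

text \<open>The functionals used are a coordinate \<open>P(S) \<rightarrow> V\<^sub>i \<otimes> S\<close> followed by a slice.\<close>

lemma proquasi_coherent_separated:
  assumes K: "field K" and P: "proquasi_coherent TYPE('i) TYPE('v) K P"
    and S: "algebra K S" and x: "x \<in> carrier (Ob P S)"
    and eq: "\<And>w. w \<in> functor_hom K P scalar_functor \<Longrightarrow> w S x = \<zero>\<^bsub>S\<^esub>"
  shows "x = \<zero>\<^bsub>Ob P S\<^esub>"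
proof -
  have M: "module_functor K P" using P by (simp add: proquasi_coherent_def)
  interpret S: algebra K S by fact
  interpret PS: module S "Ob P S" by (rule module_functorD(1)[OF M S])
  obtain I :: "'i set" and V :: "'i \<Rightarrow> ('a, 'v) module" and c where C: "tensor_coordinates K P I V c"
    by (rule proquasi_coherent_coordinates[OF P])
  note V = tensor_coordinatesD(1)[OF C] and cl = tensor_coordinatesD(2)[OF C]
    and add = tensor_coordinatesD(3)[OF C] and smult = tensor_coordinatesD(4)[OF C]
    and nat = tensor_coordinatesD(5)[OF C] and inj = tensor_coordinatesD(6)[OF C]
  show ?thesis
  proof (rule inj[OF S x PS.zero_closed])
    fix i assume i: "i \<in> I"
    have "c S x i = \<zero>\<^bsub>base_change K (V i) S\<^esub>"
    proof (rule tensor_eq_zero[OF K V[OF i] S cl[OF i S x]])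
      fix l assume l: "linear_on K (V i) (regular K) l"
      let ?w = "\<lambda>S x. slice S l (c S x i)"
      have "(\<lambda>S. if algebra K S then restrict (?w S) (carrier (Ob P S)) else (\<lambda>_. undefined))
        \<in> functor_hom K P scalar_functor"
        by (rule functor_homI[OF _ _ _ _ M])
          (simp_all add: i add smult nat cl slice_closed[OF V[OF i] _ l] slice_add[OF V[OF i] _ l]
            slice_tensor_map[OF V[OF i] _ _ l] mult_linear alg_hom_linear)
      from eq[OF this] show "slice S l (c S x i) = \<zero>\<^bsub>S\<^esub>" using S x by simp
    qed
    also have "\<dots> = c S \<zero>\<^bsub>Ob P S\<^esub> i"
      by (rule additive_zero[OF PS.M.abelian_group_axioms abelian_group_base_change[OF V[OF i] S.module],
            where g="\<lambda>x. c S x i", symmetric]) (simp_all add: i S cl add)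
    finally show "c S x i = c S \<zero>\<^bsub>Ob P S\<^esub> i" .
  qed
qed

text \<open>\<open>F\<close> makes \<open>S \<mapsto> P(S)\<close> a functor on \<open>K\<close>-algebras and \<open>K\<close>-linear maps that extends \<open>P\<close> and is
  linear in the map.\<close>

definition linear_extension ::
    "('u, 'x) ring_scheme \<Rightarrow> ('u, 'p) mod_functor \<Rightarrow> ('u alg \<Rightarrow> 'u alg \<Rightarrow> ('u \<Rightarrow> 'u) \<Rightarrow> 'p \<Rightarrow> 'p) \<Rightarrow> bool" where
  "linear_extension K P F \<longleftrightarrow>
     (\<forall>S T g. algebra K S \<longrightarrow> algebra K T \<longrightarrow> linear_on K S T g \<longrightarrow>
        (\<forall>x\<in>carrier (Ob P S). F S T g x \<in> carrier (Ob P T))) \<and>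
     (\<forall>S T h. algebra K S \<longrightarrow> algebra K T \<longrightarrow> h \<in> alg_hom K S T \<longrightarrow>
        (\<forall>x\<in>carrier (Ob P S). F S T h x = Ar P S T h x)) \<and>
     (\<forall>S T U g h. algebra K S \<longrightarrow> algebra K T \<longrightarrow> algebra K U \<longrightarrow>
        linear_on K S T g \<longrightarrow> linear_on K T U h \<longrightarrow>
        (\<forall>x\<in>carrier (Ob P S). F T U h (F S T g x) = F S U (\<lambda>s. h (g s)) x)) \<and>
     (\<forall>S T g h. algebra K S \<longrightarrow> algebra K T \<longrightarrow> linear_on K S T g \<longrightarrow> linear_on K S T h \<longrightarrow>
        (\<forall>s\<in>carrier S. g s = h s) \<longrightarrow> (\<forall>x\<in>carrier (Ob P S). F S T g x = F S T h x)) \<and>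
     (\<forall>S T g. algebra K S \<longrightarrow> algebra K T \<longrightarrow> linear_on K S T g \<longrightarrow>
        (\<forall>a\<in>carrier T. \<forall>x\<in>carrier (Ob P S). F S T (\<lambda>s. a \<otimes>\<^bsub>T\<^esub> g s) x = a \<odot>\<^bsub>Ob P T\<^esub> F S T g x)) \<and>
     (\<forall>S T g h. algebra K S \<longrightarrow> algebra K T \<longrightarrow> linear_on K S T g \<longrightarrow> linear_on K S T h \<longrightarrow>
        (\<forall>x\<in>carrier (Ob P S). F S T (\<lambda>s. g s \<oplus>\<^bsub>T\<^esub> h s) x = F S T g x \<oplus>\<^bsub>Ob P T\<^esub> F S T h x))"

lemma linear_on_sum:
  assumes "module K S" "module K T" "linear_on K S T g" "linear_on K S T h"
  shows "linear_on K S T (\<lambda>s. g s \<oplus>\<^bsub>T\<^esub> h s)"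
proof -
  interpret T: module K T by fact
  show ?thesis using linear_onD[OF assms(3)] linear_onD[OF assms(4)]
    by (intro linear_onI) (simp_all add: T.smult_r_distr T.add.m_ac)
qed

lemma proquasi_coherent_linear_extension:
  assumes P: "proquasi_coherent TYPE('i) TYPE('v) K P"
  obtains F where "linear_extension K P F"
proof -
  have M: "module_functor K P" using P by (simp add: proquasi_coherent_def)
  obtain I :: "'i set" and V :: "'i \<Rightarrow> ('a, 'v) module" and c where C: "tensor_coordinates K P I V c"
    by (rule proquasi_coherent_coordinates[OF P])
  note V = tensor_coordinatesD(1)[OF C] and cl = tensor_coordinatesD(2)[OF C]
    and add = tensor_coordinatesD(3)[OF C] and smult = tensor_coordinatesD(4)[OF C]
    and nat = tensor_coordinatesD(5)[OF C] and inj = tensor_coordinatesD(6)[OF C]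
    and lin = tensor_coordinatesD(7)[OF C]
  define F where "F S T g x = (SOME y. y \<in> carrier (Ob P T) \<and>
    (\<forall>i\<in>I. c T y i = tensor_map K (V i) T g (c S x i)))" for S T g x
  have F: "F S T g x \<in> carrier (Ob P T) \<and> (\<forall>i\<in>I. c T (F S T g x) i = tensor_map K (V i) T g (c S x i))"
    if "algebra K S" "algebra K T" "linear_on K S T g" "x \<in> carrier (Ob P S)" for S T g x
    using someI_ex[OF lin[OF that, unfolded Bex_def]] unfolding F_def .
  have Fc: "F S T g x \<in> carrier (Ob P T)"
    if "algebra K S" "algebra K T" "linear_on K S T g" "x \<in> carrier (Ob P S)" for S T g x
    using F[OF that] by blast
  have Fi: "c T (F S T g x) i = tensor_map K (V i) T g (c S x i)"
    if "algebra K S" "algebra K T" "linear_on K S T g" "x \<in> carrier (Ob P S)" "i \<in> I" for S T g x i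
    using F[OF that(1-4)] that(5) by blast
  have Feq: "F S T g x = y"
    if "algebra K S" "algebra K T" "linear_on K S T g" "x \<in> carrier (Ob P S)" "y \<in> carrier (Ob P T)"
      "\<And>i. i \<in> I \<Longrightarrow> c T y i = tensor_map K (V i) T g (c S x i)" for S T g x y
    using inj[OF that(2) Fc[OF that(1-4)] that(5)] Fi[OF that(1-4)] that(6) by simp
  have mod: "module K S" if "algebra K S" for S using that by (rule algebra.module)
  have "linear_extension K P F"
    unfolding linear_extension_def
  proof (intro conjI allI impI ballI)
    fix S T :: "'a alg" and h x assume "algebra K S" "algebra K T" "h \<in> alg_hom K S T" "x \<in> carrier (Ob P S)"
    then show "F S T h x = Ar P S T h x"
      by (intro Feq) (simp_all add: alg_hom_linear nat module_functorD(2)[OF M])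
  next
    fix S T U :: "'a alg" and g h x
    assume S: "algebra K S" and T: "algebra K T" and U: "algebra K U" and g: "linear_on K S T g"
      and h: "linear_on K T U h" and x: "x \<in> carrier (Ob P S)"
    show "F T U h (F S T g x) = F S U (\<lambda>s. h (g s)) x"
      using S T U x g h
      by (intro Feq)
        (simp_all add: Fc Fi linear_on_comp[OF g h] cl tensor_map_comp[OF V mod mod mod g h])
  next
    fix S T :: "'a alg" and g h x
    assume S: "algebra K S" and T: "algebra K T" and g: "linear_on K S T g" and h: "linear_on K S T h"
      and x: "x \<in> carrier (Ob P S)" and eq: "\<forall>s\<in>carrier S. g s = h s"
    show "F S T g x = F S T h x"
      using S T g h x
      by (intro Feq) (simp_all add: Fc Fi tensor_map_cong[OF V mod mod h g] cl eq)
  next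
    fix S T :: "'a alg" and g a x
    assume S: "algebra K S" and T: "algebra K T" and g: "linear_on K S T g" and a: "a \<in> carrier T"
      and x: "x \<in> carrier (Ob P S)"
    interpret PT: module T "Ob P T" by (rule module_functorD(1)[OF M T])
    note al = mult_linear[OF T a]
    show "F S T (\<lambda>s. a \<otimes>\<^bsub>T\<^esub> g s) x = a \<odot>\<^bsub>Ob P T\<^esub> F S T g x"
      using S T g a x
      by (intro Feq)
        (simp_all add: Fc Fi linear_on_comp[OF g al] smult cl tensor_map_comp[OF V mod mod mod g al])
  next
    fix S T :: "'a alg" and g h x
    assume S: "algebra K S" and T: "algebra K T" and g: "linear_on K S T g" and h: "linear_on K S T h"
      and x: "x \<in> carrier (Ob P S)"
    interpret PT: module T "Ob P T" by (rule module_functorD(1)[OF M T])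
    note gh = linear_on_sum[OF mod[OF S] mod[OF T] g h]
    show "F S T (\<lambda>s. g s \<oplus>\<^bsub>T\<^esub> h s) x = F S T g x \<oplus>\<^bsub>Ob P T\<^esub> F S T h x"
      using S T g h x
      by (intro Feq) (simp_all add: Fc Fi gh add cl tensor_map_sum[OF V mod mod g h gh])
  qed (simp add: Fc)
  then show ?thesis by (rule that)
qed

lemma linear_extensionD:
  assumes F: "linear_extension K P F" and S: "algebra K S" and T: "algebra K T" and x: "x \<in> carrier (Ob P S)"
  shows "linear_on K S T g \<Longrightarrow> F S T g x \<in> carrier (Ob P T)"
    and "h \<in> alg_hom K S T \<Longrightarrow> F S T h x = Ar P S T h x"
    and "algebra K U \<Longrightarrow> linear_on K S T g \<Longrightarrow> linear_on K T U h \<Longrightarrow>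
      F T U h (F S T g x) = F S U (\<lambda>s. h (g s)) x"
    and "linear_on K S T g \<Longrightarrow> linear_on K S T h \<Longrightarrow> (\<And>s. s \<in> carrier S \<Longrightarrow> g s = h s) \<Longrightarrow>
      F S T g x = F S T h x"
    and "linear_on K S T g \<Longrightarrow> a \<in> carrier T \<Longrightarrow> F S T (\<lambda>s. a \<otimes>\<^bsub>T\<^esub> g s) x = a \<odot>\<^bsub>Ob P T\<^esub> F S T g x"
    and "linear_on K S T g \<Longrightarrow> linear_on K S T h \<Longrightarrow>
      F S T (\<lambda>s. g s \<oplus>\<^bsub>T\<^esub> h s) x = F S T g x \<oplus>\<^bsub>Ob P T\<^esub> F S T h x"
proof -
  note * = F[unfolded linear_extension_def]
  show "linear_on K S T g \<Longrightarrow> F S T g x \<in> carrier (Ob P T)"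
    by (rule *[THEN conjunct1, rule_format, OF S T _ x])
  show "h \<in> alg_hom K S T \<Longrightarrow> F S T h x = Ar P S T h x"
    by (rule *[THEN conjunct2, THEN conjunct1, rule_format, OF S T _ x])
  show "algebra K U \<Longrightarrow> linear_on K S T g \<Longrightarrow> linear_on K T U h \<Longrightarrow>
      F T U h (F S T g x) = F S U (\<lambda>s. h (g s)) x"
    by (rule *[THEN conjunct2, THEN conjunct2, THEN conjunct1, rule_format, OF S T _ _ _ x])
  show "linear_on K S T g \<Longrightarrow> linear_on K S T h \<Longrightarrow> (\<And>s. s \<in> carrier S \<Longrightarrow> g s = h s) \<Longrightarrow>
      F S T g x = F S T h x"
    by (rule *[THEN conjunct2, THEN conjunct2, THEN conjunct2, THEN conjunct1, rule_format,
          OF S T _ _ _ x])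
  show "linear_on K S T g \<Longrightarrow> a \<in> carrier T \<Longrightarrow>
      F S T (\<lambda>s. a \<otimes>\<^bsub>T\<^esub> g s) x = a \<odot>\<^bsub>Ob P T\<^esub> F S T g x"
    by (rule *[THEN conjunct2, THEN conjunct2, THEN conjunct2, THEN conjunct2, THEN conjunct1,
          rule_format, OF S T _ _ x])
  show "linear_on K S T g \<Longrightarrow> linear_on K S T h \<Longrightarrow>
      F S T (\<lambda>s. g s \<oplus>\<^bsub>T\<^esub> h s) x = F S T g x \<oplus>\<^bsub>Ob P T\<^esub> F S T h x"
    by (rule *[THEN conjunct2, THEN conjunct2, THEN conjunct2, THEN conjunct2, THEN conjunct2,
          rule_format, OF S T _ _ x])
qed

lemma restrict_alg_hom:
  assumes S: "algebra K S"
    and "\<And>x. x \<in> carrier S \<Longrightarrow> g x \<in> carrier T"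
    and "\<And>x y. x \<in> carrier S \<Longrightarrow> y \<in> carrier S \<Longrightarrow> g (x \<otimes>\<^bsub>S\<^esub> y) = g x \<otimes>\<^bsub>T\<^esub> g y"
    and "\<And>x y. x \<in> carrier S \<Longrightarrow> y \<in> carrier S \<Longrightarrow> g (x \<oplus>\<^bsub>S\<^esub> y) = g x \<oplus>\<^bsub>T\<^esub> g y"
    and "g \<one>\<^bsub>S\<^esub> = \<one>\<^bsub>T\<^esub>"
    and "\<And>k x. k \<in> carrier K \<Longrightarrow> x \<in> carrier S \<Longrightarrow> g (k \<odot>\<^bsub>S\<^esub> x) = k \<odot>\<^bsub>T\<^esub> g x"
  shows "restrict g (carrier S) \<in> alg_hom K S T"
proof -
  interpret S: algebra K S by fact
  show ?thesis using assms(2-) by (auto simp: alg_hom_def ring_hom_def)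
qed

section \<open>Dual numbers\<close>

text \<open>The subalgebra \<open>B + \<epsilon> S\<close> of \<open>S[\<epsilon>] = S + \<epsilon> S\<close>, \<open>\<epsilon>\<^sup>2 = 0\<close>. All algebras have their carriers in the type
  \<open>'u\<close>, so the pair \<open>(a, s)\<close>, which stands for \<open>a + \<epsilon> s\<close>, is coded by an injection \<open>e\<close>.\<close>

definition dual_numbers :: "('u \<times> 'u \<Rightarrow> 'u) \<Rightarrow> 'u alg \<Rightarrow> 'u set \<Rightarrow> 'u alg" where
  "dual_numbers e S B = (let p = inv_into (carrier S \<times> carrier S) e in
     \<lparr>carrier = e ` (B \<times> carrier S),
      monoid.mult = (\<lambda>x y. e (fst (p x) \<otimes>\<^bsub>S\<^esub> fst (p y),
        fst (p x) \<otimes>\<^bsub>S\<^esub> snd (p y) \<oplus>\<^bsub>S\<^esub> fst (p y) \<otimes>\<^bsub>S\<^esub> snd (p x))),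
      monoid.one = e (\<one>\<^bsub>S\<^esub>, \<zero>\<^bsub>S\<^esub>),
      ring.zero = e (\<zero>\<^bsub>S\<^esub>, \<zero>\<^bsub>S\<^esub>),
      ring.add = (\<lambda>x y. e (fst (p x) \<oplus>\<^bsub>S\<^esub> fst (p y), snd (p x) \<oplus>\<^bsub>S\<^esub> snd (p y))),
      smult = (\<lambda>k x. e (k \<odot>\<^bsub>S\<^esub> fst (p x), k \<odot>\<^bsub>S\<^esub> snd (p x)))\<rparr>)"

lemma dual_numbers_sel:
  assumes e: "inj_on e (carrier S \<times> carrier S)"
  shows "carrier (dual_numbers e S B) = e ` (B \<times> carrier S)"
    and "\<one>\<^bsub>dual_numbers e S B\<^esub> = e (\<one>\<^bsub>S\<^esub>, \<zero>\<^bsub>S\<^esub>)"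
    and "\<zero>\<^bsub>dual_numbers e S B\<^esub> = e (\<zero>\<^bsub>S\<^esub>, \<zero>\<^bsub>S\<^esub>)"
    and "a \<in> carrier S \<Longrightarrow> s \<in> carrier S \<Longrightarrow> b \<in> carrier S \<Longrightarrow> t \<in> carrier S \<Longrightarrow>
      e (a, s) \<otimes>\<^bsub>dual_numbers e S B\<^esub> e (b, t) = e (a \<otimes>\<^bsub>S\<^esub> b, a \<otimes>\<^bsub>S\<^esub> t \<oplus>\<^bsub>S\<^esub> b \<otimes>\<^bsub>S\<^esub> s)"
    and "a \<in> carrier S \<Longrightarrow> s \<in> carrier S \<Longrightarrow> b \<in> carrier S \<Longrightarrow> t \<in> carrier S \<Longrightarrow>
      e (a, s) \<oplus>\<^bsub>dual_numbers e S B\<^esub> e (b, t) = e (a \<oplus>\<^bsub>S\<^esub> b, s \<oplus>\<^bsub>S\<^esub> t)"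
    and "a \<in> carrier S \<Longrightarrow> s \<in> carrier S \<Longrightarrow>
      k \<odot>\<^bsub>dual_numbers e S B\<^esub> e (a, s) = e (k \<odot>\<^bsub>S\<^esub> a, k \<odot>\<^bsub>S\<^esub> s)"
  using inv_into_f_f[OF e] by (simp_all add: dual_numbers_def Let_def)

text \<open>Additive inverses are obtained from scalar multiplication by \<open>- 1\<close>.\<close>

definition subalgebra_set :: "('u, 'x) ring_scheme \<Rightarrow> 'u alg \<Rightarrow> 'u set \<Rightarrow> bool" where
  "subalgebra_set K S B \<longleftrightarrow> B \<subseteq> carrier S \<and> \<one>\<^bsub>S\<^esub> \<in> B \<and>
     (\<forall>a\<in>B. \<forall>b\<in>B. a \<oplus>\<^bsub>S\<^esub> b \<in> B \<and> a \<otimes>\<^bsub>S\<^esub> b \<in> B) \<and> (\<forall>k\<in>carrier K. \<forall>a\<in>B. k \<odot>\<^bsub>S\<^esub> a \<in> B)"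

lemma algebra_dual_numbers:
  assumes S: "algebra K S" and e: "inj_on e (carrier S \<times> carrier S)" and B: "subalgebra_set K S B"
  shows "algebra K (dual_numbers e S B)"
proof -
  interpret S: algebra K S by fact
  let ?D = "dual_numbers e S B"
  note sel = dual_numbers_sel[OF e]
  have sub: "\<And>a. a \<in> B \<Longrightarrow> a \<in> carrier S" and one: "\<one>\<^bsub>S\<^esub> \<in> B"
    and add: "\<And>a b. a \<in> B \<Longrightarrow> b \<in> B \<Longrightarrow> a \<oplus>\<^bsub>S\<^esub> b \<in> B"
    and mult: "\<And>a b. a \<in> B \<Longrightarrow> b \<in> B \<Longrightarrow> a \<otimes>\<^bsub>S\<^esub> b \<in> B"
    and smult: "\<And>k a. k \<in> carrier K \<Longrightarrow> a \<in> B \<Longrightarrow> k \<odot>\<^bsub>S\<^esub> a \<in> B"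
    using B by (auto simp: subalgebra_set_def)
  have zero: "\<zero>\<^bsub>S\<^esub> \<in> B" using smult[OF S.R.zero_closed one] by simp
  have neg: "\<ominus>\<^bsub>S\<^esub> a \<in> B" if "a \<in> B" for a
    using smult[OF S.R.a_inv_closed[OF S.R.one_closed] that] that sub by (simp add: S.smult_l_minus)
  have D: "\<exists>a s. x = e (a, s) \<and> a \<in> B \<and> s \<in> carrier S" if "x \<in> carrier ?D" for x
    using that by (auto simp: sel)
  have DI: "e (a, s) \<in> carrier ?D" if "a \<in> B" "s \<in> carrier S" for a s
    using that by (simp add: sel)
  note ops = sel(2-6) sub zero one add mult smult DI
  have comm: "cring ?D"
  proof (rule cringI)
    show "abelian_group ?D"
    proof (rule abelian_groupI)
      fix x assume "x \<in> carrier ?D"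
      then obtain a s where x: "x = e (a, s)" "a \<in> B" "s \<in> carrier S" using D by blast
      show "\<exists>y\<in>carrier ?D. y \<oplus>\<^bsub>?D\<^esub> x = \<zero>\<^bsub>?D\<^esub>"
        using x neg by (intro bexI[of _ "e (\<ominus>\<^bsub>S\<^esub> a, \<ominus>\<^bsub>S\<^esub> s)"]) (simp_all add: ops S.l_neg S.M.l_neg)
      show "\<zero>\<^bsub>?D\<^esub> \<oplus>\<^bsub>?D\<^esub> x = x" using x by (simp add: ops)
      fix y assume "y \<in> carrier ?D"
      then obtain b t where y: "y = e (b, t)" "b \<in> B" "t \<in> carrier S" using D by blast
      show "x \<oplus>\<^bsub>?D\<^esub> y \<in> carrier ?D" using x y by (simp add: ops)
      show "x \<oplus>\<^bsub>?D\<^esub> y = y \<oplus>\<^bsub>?D\<^esub> x" using x y by (simp add: ops S.a_comm)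
      fix z assume "z \<in> carrier ?D"
      then obtain c u where z: "z = e (c, u)" "c \<in> B" "u \<in> carrier S" using D by blast
      show "x \<oplus>\<^bsub>?D\<^esub> y \<oplus>\<^bsub>?D\<^esub> z = x \<oplus>\<^bsub>?D\<^esub> (y \<oplus>\<^bsub>?D\<^esub> z)"
        using x y z by (simp add: ops S.a_assoc)
    qed (simp add: ops)
    show "comm_monoid ?D"
    proof (rule comm_monoidI)
      fix x assume "x \<in> carrier ?D"
      then obtain a s where x: "x = e (a, s)" "a \<in> B" "s \<in> carrier S" using D by blast
      show "\<one>\<^bsub>?D\<^esub> \<otimes>\<^bsub>?D\<^esub> x = x" using x by (simp add: ops)
      fix y assume "y \<in> carrier ?D"
      then obtain b t where y: "y = e (b, t)" "b \<in> B" "t \<in> carrier S" using D by blast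
      show "x \<otimes>\<^bsub>?D\<^esub> y \<in> carrier ?D" using x y by (simp add: ops)
      show "x \<otimes>\<^bsub>?D\<^esub> y = y \<otimes>\<^bsub>?D\<^esub> x" using x y by (simp add: ops S.m_comm S.a_comm)
      fix z assume "z \<in> carrier ?D"
      then obtain c u where z: "z = e (c, u)" "c \<in> B" "u \<in> carrier S" using D by blast
      show "x \<otimes>\<^bsub>?D\<^esub> y \<otimes>\<^bsub>?D\<^esub> z = x \<otimes>\<^bsub>?D\<^esub> (y \<otimes>\<^bsub>?D\<^esub> z)"
        using x y z by (simp add: ops S.r_distr S.l_distr S.m_ac S.a_ac)
    qed (simp add: ops)
    fix x y z assume "x \<in> carrier ?D" "y \<in> carrier ?D" "z \<in> carrier ?D"
    then obtain a s b t c u where *: "x = e (a, s)" "a \<in> B" "s \<in> carrier S"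
      "y = e (b, t)" "b \<in> B" "t \<in> carrier S" "z = e (c, u)" "c \<in> B" "u \<in> carrier S"
      using D by meson
    show "(x \<oplus>\<^bsub>?D\<^esub> y) \<otimes>\<^bsub>?D\<^esub> z = x \<otimes>\<^bsub>?D\<^esub> z \<oplus>\<^bsub>?D\<^esub> y \<otimes>\<^bsub>?D\<^esub> z"
      using * by (simp add: ops S.r_distr S.l_distr S.a_ac)
  qed
  show ?thesis
  proof (rule algebraI[OF S.R_cring comm])
    fix x assume "x \<in> carrier ?D"
    then obtain a s where x: "x = e (a, s)" "a \<in> B" "s \<in> carrier S" using D by blast
    show "\<one>\<^bsub>K\<^esub> \<odot>\<^bsub>?D\<^esub> x = x" using x by (simp add: ops)
    fix k assume k: "k \<in> carrier K"
    show "k \<odot>\<^bsub>?D\<^esub> x \<in> carrier ?D" using x k by (simp add: ops)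
    {
      fix l assume l: "l \<in> carrier K"
      show "(k \<oplus>\<^bsub>K\<^esub> l) \<odot>\<^bsub>?D\<^esub> x = k \<odot>\<^bsub>?D\<^esub> x \<oplus>\<^bsub>?D\<^esub> l \<odot>\<^bsub>?D\<^esub> x"
        using x k l by (simp add: ops S.smult_l_distr)
      show "(k \<otimes>\<^bsub>K\<^esub> l) \<odot>\<^bsub>?D\<^esub> x = k \<odot>\<^bsub>?D\<^esub> (l \<odot>\<^bsub>?D\<^esub> x)"
        using x k l by (simp add: ops S.smult_assoc1)
    }
    fix y assume "y \<in> carrier ?D"
    then obtain b t where y: "y = e (b, t)" "b \<in> B" "t \<in> carrier S" using D by blast
    show "k \<odot>\<^bsub>?D\<^esub> (x \<oplus>\<^bsub>?D\<^esub> y) = k \<odot>\<^bsub>?D\<^esub> x \<oplus>\<^bsub>?D\<^esub> k \<odot>\<^bsub>?D\<^esub> y"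
      using x y k by (simp add: ops S.smult_r_distr)
    have "b \<otimes>\<^bsub>S\<^esub> (k \<odot>\<^bsub>S\<^esub> s) = k \<odot>\<^bsub>S\<^esub> (b \<otimes>\<^bsub>S\<^esub> s)"
      using x y k S.m_comm[of b "k \<odot>\<^bsub>S\<^esub> s"] S.m_comm[of s b] by (simp add: sub S.smult_assoc2)
    then show "k \<odot>\<^bsub>?D\<^esub> x \<otimes>\<^bsub>?D\<^esub> y = k \<odot>\<^bsub>?D\<^esub> (x \<otimes>\<^bsub>?D\<^esub> y)"
      using x y k by (simp add: ops S.smult_r_distr S.smult_assoc2)
  qed
qed

section \<open>Functionals on a proquasi-coherent module\<close>

text \<open>Let \<open>j : S \<rightarrow> K + \<epsilon> S\<close> be the linear map \<open>s \<mapsto> \<epsilon> s\<close>. Inside \<open>S[\<epsilon>]\<close> the element \<open>P(j) y\<close> becomes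
  \<open>\<epsilon> y\<close>, so linearity of \<open>w\<close> over \<open>S[\<epsilon>]\<close> gives \<open>w (P(j) y) = j (w y)\<close>. Since \<open>j L = \<Lambda> j\<close> for the
  algebra endomorphism \<open>\<Lambda> : k + \<epsilon> s \<mapsto> k + \<epsilon> L s\<close> of \<open>K + \<epsilon> S\<close>, naturality of \<open>w\<close> for \<open>\<Lambda>\<close> yields
  \<open>j (w (P(L) x)) = j (L (w x))\<close>.\<close>

lemma functional_commutes_linear:
  assumes M: "module_functor K P" and F: "linear_extension K P F" and w: "w \<in> functor_hom K P scalar_functor"
    and S: "algebra K S" and inf: "infinite (carrier S)" and L: "linear_on K S S L" and x: "x \<in> carrier (Ob P S)"
  shows "w S (F S S L x) = L (w S x)"
proof -
  interpret S: algebra K S by fact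
  obtain e where "bij_betw e (carrier S \<times> carrier S) (carrier S)"
    using card_of_Times_same_infinite[OF inf] unfolding card_of_ordIso[symmetric] by blast
  then have e: "inj_on e (carrier S \<times> carrier S)" by (rule bij_betw_imp_inj_on)
  \<comment> \<open>\<open>C\<close> is the image of \<open>K\<close> in \<open>S\<close>, so \<open>D\<close> below is \<open>K + \<epsilon> S\<close> and \<open>E\<close> is \<open>S[\<epsilon>]\<close>. Enlarging \<open>D\<close> is not
    possible: \<open>\<Lambda>\<close> is multiplicative only because \<open>L\<close> commutes with the elements of \<open>C\<close>.\<close>
  define C where "C = (\<lambda>k. k \<odot>\<^bsub>S\<^esub> \<one>\<^bsub>S\<^esub>) ` carrier K"
  have C: "subalgebra_set K S C"
    unfolding subalgebra_set_def
  proof (intro conjI ballI)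
    show "C \<subseteq> carrier S" by (auto simp: C_def)
    show "\<one>\<^bsub>S\<^esub> \<in> C" unfolding C_def by (rule image_eqI[of _ _ "\<one>\<^bsub>K\<^esub>"]) simp_all
    fix b assume "b \<in> C"
    then obtain l where l: "b = l \<odot>\<^bsub>S\<^esub> \<one>\<^bsub>S\<^esub>" "l \<in> carrier K" by (auto simp: C_def)
    show "k \<odot>\<^bsub>S\<^esub> b \<in> C" if "k \<in> carrier K" for k
      unfolding C_def using l that by (intro image_eqI[of _ _ "k \<otimes>\<^bsub>K\<^esub> l"]) (simp_all add: S.smult_assoc1)
    fix a assume "a \<in> C"
    then obtain k where k: "a = k \<odot>\<^bsub>S\<^esub> \<one>\<^bsub>S\<^esub>" "k \<in> carrier K" by (auto simp: C_def)
    show "a \<oplus>\<^bsub>S\<^esub> b \<in> C"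
      unfolding C_def using k l by (intro image_eqI[of _ _ "k \<oplus>\<^bsub>K\<^esub> l"]) (simp_all add: S.smult_l_distr)
    show "a \<otimes>\<^bsub>S\<^esub> b \<in> C"
      unfolding C_def using k l
      by (intro image_eqI[of _ _ "k \<otimes>\<^bsub>K\<^esub> l"]) (simp_all add: S.smult_assoc1 S.smult_assoc2)
  qed
  have CS: "a \<in> carrier S" if "a \<in> C" for a using that by (auto simp: C_def)
  have zC: "\<zero>\<^bsub>S\<^esub> \<in> C" unfolding C_def by (rule image_eqI[of _ _ "\<zero>\<^bsub>K\<^esub>"]) simp_all
  have S': "subalgebra_set K S (carrier S)" by (auto simp: subalgebra_set_def)
  define D where "D = dual_numbers e S C"
  define E where "E = dual_numbers e S (carrier S)"
  note sel = dual_numbers_sel[OF e, where B = C, folded D_def] dual_numbers_sel[OF e, where B = "carrier S", folded E_def]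
  have D: "algebra K D" unfolding D_def by (rule algebra_dual_numbers[OF S e C])
  have E: "algebra K E" unfolding E_def by (rule algebra_dual_numbers[OF S e S'])
  interpret D: algebra K D by (rule D)
  interpret E: algebra K E by (rule E)
  have inj: "s = t" if "e (a, s) = e (b, t)" "a \<in> carrier S" "b \<in> carrier S" "s \<in> carrier S" "t \<in> carrier S" for a s b t
    using inj_onD[OF e that(1)] that by simp
  define j where "j s = e (\<zero>\<^bsub>S\<^esub>, s)" for s
  define \<epsilon> where "\<epsilon> = e (\<zero>\<^bsub>S\<^esub>, \<one>\<^bsub>S\<^esub>)"
  define inc where "inc = (\<lambda>s\<in>carrier S. e (s, \<zero>\<^bsub>S\<^esub>))"
  define \<iota> where "\<iota> = (\<lambda>d\<in>carrier D. d)"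
  define \<Lambda> where "\<Lambda> = (\<lambda>d\<in>carrier D. let (a, s) = inv_into (carrier S \<times> carrier S) e d in e (a, L s))"
  have j: "linear_on K S D j"
    by (rule linear_onI) (simp_all add: j_def sel zC)
  have \<epsilon>: "\<epsilon> \<in> carrier E" by (simp add: \<epsilon>_def sel)
  have inc: "inc \<in> alg_hom K S E"
    unfolding inc_def by (rule restrict_alg_hom[OF S]) (simp_all add: sel)
  have \<iota>: "\<iota> \<in> alg_hom K D E"
  proof -
    have eq: "x \<otimes>\<^bsub>D\<^esub> y = x \<otimes>\<^bsub>E\<^esub> y \<and> x \<oplus>\<^bsub>D\<^esub> y = x \<oplus>\<^bsub>E\<^esub> y" if "x \<in> carrier D" "y \<in> carrier D" for x y
      using that CS by (auto simp: sel)
    moreover have "k \<odot>\<^bsub>D\<^esub> x = k \<odot>\<^bsub>E\<^esub> x" if "x \<in> carrier D" for k x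
      using that CS by (auto simp: sel)
    moreover have "x \<in> carrier E" if "x \<in> carrier D" for x
      using that CS by (auto simp: sel)
    moreover have "\<one>\<^bsub>D\<^esub> = \<one>\<^bsub>E\<^esub>" by (simp add: sel)
    ultimately show ?thesis
      unfolding \<iota>_def by (intro restrict_alg_hom[OF D]) blast+
  qed
  have \<Lambda>_eq: "\<Lambda> (e (a, s)) = e (a, L s)" if "a \<in> C" "s \<in> carrier S" for a s
    using that inv_into_f_f[OF e, of "(a, s)"] CS by (simp add: \<Lambda>_def sel)
  have \<Lambda>: "\<Lambda> \<in> alg_hom K D D"
  proof -
    have LS: "L s \<in> carrier S" if "s \<in> carrier S" for s using linear_onD(1)[OF L that] .
    have LC: "L (a \<otimes>\<^bsub>S\<^esub> s) = a \<otimes>\<^bsub>S\<^esub> L s" if "a \<in> C" "s \<in> carrier S" for a s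
      using that LS linear_onD(3)[OF L] by (auto simp: C_def S.smult_assoc2)
    have CC: "a \<otimes>\<^bsub>S\<^esub> b \<in> C" "a \<oplus>\<^bsub>S\<^esub> b \<in> C" if "a \<in> C" "b \<in> C" for a b
      using C that by (auto simp: subalgebra_set_def)
    have CK: "k \<odot>\<^bsub>S\<^esub> a \<in> C" "\<one>\<^bsub>S\<^esub> \<in> C" if "k \<in> carrier K" "a \<in> C" for k a
      using C that by (auto simp: subalgebra_set_def)
    have L0: "L \<zero>\<^bsub>S\<^esub> = \<zero>\<^bsub>S\<^esub>"
      by (rule additive_zero[OF S.abelian_group_axioms S.abelian_group_axioms]) (simp_all add: linear_onD[OF L])
    have "\<Lambda> (x \<otimes>\<^bsub>D\<^esub> y) = \<Lambda> x \<otimes>\<^bsub>D\<^esub> \<Lambda> y \<and> \<Lambda> (x \<oplus>\<^bsub>D\<^esub> y) = \<Lambda> x \<oplus>\<^bsub>D\<^esub> \<Lambda> y"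
      if xy: "x \<in> carrier D" "y \<in> carrier D" for x y
    proof -
      obtain a s where x: "x = e (a, s)" "a \<in> C" "s \<in> carrier S" using xy(1) by (auto simp: sel)
      obtain b t where y: "y = e (b, t)" "b \<in> C" "t \<in> carrier S" using xy(2) by (auto simp: sel)
      show ?thesis using x y
        by (simp add: sel CS LS \<Lambda>_eq CC LC linear_onD(2)[OF L])
    qed
    moreover have "\<Lambda> (k \<odot>\<^bsub>D\<^esub> x) = k \<odot>\<^bsub>D\<^esub> \<Lambda> x" if k: "k \<in> carrier K" and xD: "x \<in> carrier D" for k x
    proof -
      obtain a s where x: "x = e (a, s)" "a \<in> C" "s \<in> carrier S" using xD by (auto simp: sel)
      then show ?thesis using k by (simp add: sel CS LS \<Lambda>_eq CK linear_onD(3)[OF L])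
    qed
    moreover have "\<Lambda> x \<in> carrier D" if xD: "x \<in> carrier D" for x
    proof -
      obtain a s where x: "x = e (a, s)" "a \<in> C" "s \<in> carrier S" using xD by (auto simp: sel)
      then show ?thesis by (simp add: sel(1) LS \<Lambda>_eq)
    qed
    moreover have "\<Lambda> \<one>\<^bsub>D\<^esub> = \<one>\<^bsub>D\<^esub>" using C by (simp add: sel \<Lambda>_eq L0 subalgebra_set_def)
    moreover have "\<Lambda> \<in> extensional (carrier D)" by (simp add: \<Lambda>_def)
    ultimately show ?thesis unfolding alg_hom_def ring_hom_def by simp
  qed
  note wD = functor_homD[OF w]
  note FS = linear_extensionD[OF F]
  note lin = alg_hom_linear[OF inc] alg_hom_linear[OF \<iota>] alg_hom_linear[OF \<Lambda>]
  have wj: "w D (F S D j y) = j (w S y)" if y: "y \<in> carrier (Ob P S)" for y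
  proof -
    have jy: "F S D j y \<in> carrier (Ob P D)" using FS(1)[OF S D y j] .
    have wy: "w S y \<in> carrier S" using wD(1)[OF S y] by simp
    have wjy: "w D (F S D j y) \<in> carrier D" using wD(1)[OF D jy] by simp
    have incy: "F S E inc y \<in> carrier (Ob P E)" using FS(1)[OF S E y lin(1)] .
    have "\<iota> (w D (F S D j y)) = w E (F D E \<iota> (F S D j y))"
      using wD(4)[OF D E \<iota> jy] FS(2)[OF D E jy \<iota>] by simp
    also have "F D E \<iota> (F S D j y) = F S E (\<lambda>s. \<iota> (j s)) y"
      by (rule FS(3)[OF S D y E j lin(2)])
    also have "\<dots> = F S E (\<lambda>s. \<epsilon> \<otimes>\<^bsub>E\<^esub> inc s) y"
    proof (rule FS(4)[OF S E y linear_on_comp[OF j lin(2)] linear_on_comp[OF lin(1) mult_linear[OF E \<epsilon>]]])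
      fix s assume "s \<in> carrier S"
      then show "\<iota> (j s) = \<epsilon> \<otimes>\<^bsub>E\<^esub> inc s"
        using zC by (simp add: \<iota>_def j_def \<epsilon>_def inc_def sel)
    qed
    also have "\<dots> = \<epsilon> \<odot>\<^bsub>Ob P E\<^esub> F S E inc y" by (rule FS(5)[OF S E y lin(1) \<epsilon>])
    also have "w E \<dots> = \<epsilon> \<otimes>\<^bsub>E\<^esub> w E (F S E inc y)" using wD(3)[OF E \<epsilon> incy] by simp
    also have "w E (F S E inc y) = inc (w S y)"
      using wD(4)[OF S E inc y] FS(2)[OF S E y inc] by simp
    also have "\<epsilon> \<otimes>\<^bsub>E\<^esub> inc (w S y) = j (w S y)"
      using wy by (simp add: j_def \<epsilon>_def inc_def sel)
    finally show ?thesis using wjy by (simp add: \<iota>_def)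
  qed
  have Lx: "F S S L x \<in> carrier (Ob P S)" using FS(1)[OF S S x L] .
  have jx: "F S D j x \<in> carrier (Ob P D)" using FS(1)[OF S D x j] .
  have wx: "w S x \<in> carrier S" and wLx: "w S (F S S L x) \<in> carrier S"
    using wD(1)[OF S x] wD(1)[OF S Lx] by simp_all
  have "j (w S (F S S L x)) = w D (F S D (\<lambda>s. j (L s)) x)"
    using wj[OF Lx] FS(3)[OF S S x D L j] by simp
  also have "F S D (\<lambda>s. j (L s)) x = F S D (\<lambda>s. \<Lambda> (j s)) x"
    by (rule FS(4)[OF S D x linear_on_comp[OF L j] linear_on_comp[OF j lin(3)]])
      (simp add: j_def \<Lambda>_eq zC)
  also have "\<dots> = Ar P D D \<Lambda> (F S D j x)"
    using FS(3)[OF S D x D j lin(3)] FS(2)[OF D D jx \<Lambda>] by simp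
  also have "w D \<dots> = \<Lambda> (j (w S x))" using wD(4)[OF D D \<Lambda> jx] wj[OF x] by simp
  also have "\<dots> = j (L (w S x))" using wx by (simp add: j_def \<Lambda>_eq zC)
  finally show ?thesis
    using inj[of "\<zero>\<^bsub>S\<^esub>" "w S (F S S L x)" "\<zero>\<^bsub>S\<^esub>" "L (w S x)"] wx wLx linear_onD(1)[OF L]
    by (simp add: j_def)
qed

text \<open>For \<open>L = l(_) c\<close> with \<open>l : S \<rightarrow> K\<close>, the map \<open>P(L)\<close> is \<open>c\<close> times the composite of \<open>P(l) : P(S) \<rightarrow> P(K)\<close>
  and \<open>P(K) \<rightarrow> P(S)\<close>, so \<open>w P(L) = 0\<close>; the same then holds for every \<open>L\<close> of finite rank. It remains to
  choose \<open>L\<close>: it fixes all of \<open>S\<close> if \<open>S\<close> is finite, and it fixes \<open>w x\<close> otherwise.\<close>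

lemma functional_eq_zero:
  assumes K: "field K" and P: "proquasi_coherent TYPE('i) TYPE('v) K P"
    and w: "w \<in> functor_hom K P scalar_functor"
    and w0: "\<And>y. y \<in> carrier (Ob P (regular K)) \<Longrightarrow> w (regular K) y = \<zero>\<^bsub>K\<^esub>"
    and S: "algebra K S" and x: "x \<in> carrier (Ob P S)"
  shows "w S x = \<zero>\<^bsub>S\<^esub>"
proof -
  interpret K: field K by fact
  interpret S: algebra K S by fact
  have R: "algebra K (regular K)" by (rule algebra_regular[OF K.is_cring])
  have M: "module_functor K P" using P by (simp add: proquasi_coherent_def)
  interpret PS: module S "Ob P S" by (rule module_functorD(1)[OF M S])
  obtain F where F: "linear_extension K P F" by (rule proquasi_coherent_linear_extension[OF P])
  note FS = linear_extensionD[OF F]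
  note wD = functor_homD[OF w]
  have wx: "w S x \<in> carrier S" using wD(1)[OF S x] by simp
  have id: "linear_on K S S (\<lambda>s. s)" by (simp add: linear_on_def)
  define Y where "Y = (if finite (carrier S) then carrier S else {w S x})"
  have Y: "finite Y" "Y \<subseteq> carrier S" using wx by (auto simp: Y_def)
  have "\<exists>L. linear_on K S S L \<and> w S (F S S L x) = \<zero>\<^bsub>S\<^esub> \<and> (\<forall>s\<in>Y. L s = s)"
  proof (rule finite_rank_fixing_finite_set[OF K S.module Y])
    have "F S S (\<lambda>_. \<zero>\<^bsub>S\<^esub>) x = F S S (\<lambda>s. \<zero>\<^bsub>S\<^esub> \<otimes>\<^bsub>S\<^esub> s) x"
      by (rule FS(4)[OF S S x _ mult_linear[OF S S.M.zero_closed]]) (simp_all add: linear_on_def)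
    also have "\<dots> = \<zero>\<^bsub>S\<^esub> \<odot>\<^bsub>Ob P S\<^esub> F S S (\<lambda>s. s) x" by (rule FS(5)[OF S S x id S.M.zero_closed])
    finally show "w S (F S S (\<lambda>_. \<zero>\<^bsub>S\<^esub>) x) = \<zero>\<^bsub>S\<^esub>"
      using wD(3)[OF S S.M.zero_closed FS(1)[OF S S x id]] wD(1)[OF S FS(1)[OF S S x id]] by simp
  next
    fix L c l
    assume L: "linear_on K S S L" "w S (F S S L x) = \<zero>\<^bsub>S\<^esub>" and c: "c \<in> carrier S"
      and l: "linear_on K S (regular K) l"
    note u = unit_hom_alg_hom[OF S]
    note ul = linear_on_comp[OF l alg_hom_linear[OF u]]
    note cul = linear_on_comp[OF ul mult_linear[OF S c]]
    have lS: "l s \<in> carrier K" if "s \<in> carrier S" for s using linear_onD(1)[OF l that] by simp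
    have eq: "l s \<odot>\<^bsub>S\<^esub> c = c \<otimes>\<^bsub>S\<^esub> unit_hom K S (l s)" if "s \<in> carrier S" for s
      using lS[OF that] c S.m_comm[of c "l s \<odot>\<^bsub>S\<^esub> \<one>\<^bsub>S\<^esub>"] by (simp add: unit_hom_def S.smult_assoc2)
    note y = FS(1)[OF S R x l]
    note Fu = FS(1)[OF S S x ul] and Fcu = FS(1)[OF S S x cul] and FL = FS(1)[OF S S x L(1)]
    have "w S (F S S (\<lambda>s. c \<otimes>\<^bsub>S\<^esub> unit_hom K S (l s)) x) = c \<otimes>\<^bsub>S\<^esub> w S (F S S (\<lambda>s. unit_hom K S (l s)) x)"
      using FS(5)[OF S S x ul c] wD(3)[OF S c Fu] by simp
    also have "F S S (\<lambda>s. unit_hom K S (l s)) x = Ar P (regular K) S (unit_hom K S) (F S (regular K) l x)"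
      using FS(3)[OF S R x S l alg_hom_linear[OF u]] FS(2)[OF R S y u] by simp
    also have "w S \<dots> = unit_hom K S \<zero>\<^bsub>K\<^esub>" using wD(4)[OF R S u y] w0[OF y] by simp
    also have "c \<otimes>\<^bsub>S\<^esub> \<dots> = \<zero>\<^bsub>S\<^esub>" using c by (simp add: unit_hom_def)
    finally have wc: "w S (F S S (\<lambda>s. c \<otimes>\<^bsub>S\<^esub> unit_hom K S (l s)) x) = \<zero>\<^bsub>S\<^esub>" .
    have "F S S (\<lambda>s. L s \<oplus>\<^bsub>S\<^esub> l s \<odot>\<^bsub>S\<^esub> c) x = F S S (\<lambda>s. L s \<oplus>\<^bsub>S\<^esub> c \<otimes>\<^bsub>S\<^esub> unit_hom K S (l s)) x"
      by (rule FS(4)[OF S S x linear_on_add_rank_one[OF S.module L(1) l c]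
            linear_on_sum[OF S.module S.module L(1) cul]]) (simp add: eq)
    also have "\<dots> = F S S L x \<oplus>\<^bsub>Ob P S\<^esub> F S S (\<lambda>s. c \<otimes>\<^bsub>S\<^esub> unit_hom K S (l s)) x"
      by (rule FS(6)[OF S S x L(1) cul])
    finally show "w S (F S S (\<lambda>s. L s \<oplus>\<^bsub>S\<^esub> l s \<odot>\<^bsub>S\<^esub> c) x) = \<zero>\<^bsub>S\<^esub>"
      using wD(2)[OF S FL Fcu] L(2) wc by simp
  qed
  then obtain L where L: "linear_on K S S L" "w S (F S S L x) = \<zero>\<^bsub>S\<^esub>" "\<And>s. s \<in> Y \<Longrightarrow> L s = s" by blast
  show ?thesis
  proof (cases "finite (carrier S)")
    case True
    have idh: "(\<lambda>s\<in>carrier S. s) \<in> alg_hom K S S"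
      by (rule restrict_alg_hom[OF S]) simp_all
    have "F S S L x = F S S (\<lambda>s\<in>carrier S. s) x"
      by (rule FS(4)[OF S S x L(1) alg_hom_linear[OF idh]]) (simp add: L(3) Y_def True)
    also have "\<dots> = x" using FS(2)[OF S S x idh] module_functorD(5)[OF M S x] by simp
    finally show ?thesis using L(2) by simp
  next
    case False
    then show ?thesis
      using functional_commutes_linear[OF M F w S False L(1) x] L(2) L(3)[of "w S x"] by (simp add: Y_def)
  qed
qed

section \<open>Morphisms of functors and restriction of scalars\<close>

lemma functor_hom_comp:
  assumes f: "f \<in> functor_hom R M N" and g: "g \<in> functor_hom R N Q" and M: "module_functor R M"
  obtains k where "k \<in> functor_hom R M Q"
    and "\<And>S x. algebra R S \<Longrightarrow> x \<in> carrier (Ob M S) \<Longrightarrow> k S x = g S (f S x)"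
proof -
  note fD = functor_homD[OF f] and gD = functor_homD[OF g]
  have "(\<lambda>S. if algebra R S then restrict (\<lambda>x. g S (f S x)) (carrier (Ob M S)) else (\<lambda>_. undefined))
    \<in> functor_hom R M Q"
    by (rule functor_homI[OF _ _ _ _ M]) (simp_all add: fD gD)
  then show ?thesis by (rule that) simp
qed

lemma functor_hom_diff:
  assumes f: "f \<in> functor_hom R M N" and g: "g \<in> functor_hom R M N"
    and M: "module_functor R M" and N: "module_functor R N"
  obtains k where "k \<in> functor_hom R M N"
    and "\<And>S x. algebra R S \<Longrightarrow> x \<in> carrier (Ob M S) \<Longrightarrow> k S x = f S x \<ominus>\<^bsub>Ob N S\<^esub> g S x"
proof -
  note fD = functor_homD[OF f] and gD = functor_homD[OF g]
  have "(\<lambda>S. if algebra R S then restrict (\<lambda>x. f S x \<ominus>\<^bsub>Ob N S\<^esub> g S x) (carrier (Ob M S))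
      else (\<lambda>_. undefined)) \<in> functor_hom R M N"
  proof (rule functor_homI[OF _ _ _ _ M])
    fix S x assume S: "algebra R S" and x: "x \<in> carrier (Ob M S)"
    interpret NS: module S "Ob N S" by (rule module_functorD(1)[OF N S])
    have cl: "f S x \<in> carrier (Ob N S)" "g S x \<in> carrier (Ob N S)"
      using fD(1)[OF S x] gD(1)[OF S x] by simp_all
    show "f S x \<ominus>\<^bsub>Ob N S\<^esub> g S x \<in> carrier (Ob N S)" using cl by simp
    show "f S (s \<odot>\<^bsub>Ob M S\<^esub> x) \<ominus>\<^bsub>Ob N S\<^esub> g S (s \<odot>\<^bsub>Ob M S\<^esub> x) = s \<odot>\<^bsub>Ob N S\<^esub> (f S x \<ominus>\<^bsub>Ob N S\<^esub> g S x)"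
      if "s \<in> carrier S" for s
      using that cl by (simp add: fD(3)[OF S _ x] gD(3)[OF S _ x] NS.M.minus_eq NS.smult_r_distr NS.smult_r_minus)
    {
      fix y assume y: "y \<in> carrier (Ob M S)"
      have cl': "f S y \<in> carrier (Ob N S)" "g S y \<in> carrier (Ob N S)"
        using fD(1)[OF S y] gD(1)[OF S y] by simp_all
      show "f S (x \<oplus>\<^bsub>Ob M S\<^esub> y) \<ominus>\<^bsub>Ob N S\<^esub> g S (x \<oplus>\<^bsub>Ob M S\<^esub> y) =
          (f S x \<ominus>\<^bsub>Ob N S\<^esub> g S x) \<oplus>\<^bsub>Ob N S\<^esub> (f S y \<ominus>\<^bsub>Ob N S\<^esub> g S y)"
        using cl cl' by (simp add: fD(2)[OF S x y] gD(2)[OF S x y] NS.M.minus_eq NS.M.minus_add NS.M.add.m_ac)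
    }
    fix T h assume T: "algebra R T" and h: "h \<in> alg_hom R S T"
    interpret NT: module T "Ob N T" by (rule module_functorD(1)[OF N T])
    note Nh = module_functorD(2,3)[OF N S T h]
    have d: "f S x \<ominus>\<^bsub>Ob N S\<^esub> g S x \<in> carrier (Ob N S)" using cl by simp
    have "Ar N S T h (f S x) = Ar N S T h ((f S x \<ominus>\<^bsub>Ob N S\<^esub> g S x) \<oplus>\<^bsub>Ob N S\<^esub> g S x)"
      using cl by (simp add: NS.M.minus_eq NS.M.add.m_assoc NS.M.l_neg)
    also have "\<dots> = Ar N S T h (f S x \<ominus>\<^bsub>Ob N S\<^esub> g S x) \<oplus>\<^bsub>Ob N T\<^esub> Ar N S T h (g S x)"
      by (rule Nh(2)[OF d cl(2)])
    finally have "Ar N S T h (f S x) \<ominus>\<^bsub>Ob N T\<^esub> Ar N S T h (g S x) = Ar N S T h (f S x \<ominus>\<^bsub>Ob N S\<^esub> g S x)"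
      using Nh(1)[OF d] Nh(1)[OF cl(2)] by (simp add: NT.M.minus_eq NT.M.add.m_assoc NT.M.r_neg)
    then show "f T (Ar M S T h x) \<ominus>\<^bsub>Ob N T\<^esub> g T (Ar M S T h x) = Ar N S T h (f S x \<ominus>\<^bsub>Ob N S\<^esub> g S x)"
      by (simp add: fD(4)[OF S T h x] gD(4)[OF S T h x])
  qed
  then show ?thesis by (rule that) simp
qed

lemma restrict_scalars_sel [simp]:
  "carrier (restrict_scalars S T) = carrier T" "\<zero>\<^bsub>restrict_scalars S T\<^esub> = \<zero>\<^bsub>T\<^esub>"
  "\<one>\<^bsub>restrict_scalars S T\<^esub> = \<one>\<^bsub>T\<^esub>" "x \<oplus>\<^bsub>restrict_scalars S T\<^esub> y = x \<oplus>\<^bsub>T\<^esub> y"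
  "x \<otimes>\<^bsub>restrict_scalars S T\<^esub> y = x \<otimes>\<^bsub>T\<^esub> y"
  "k \<odot>\<^bsub>restrict_scalars S T\<^esub> t = (k \<odot>\<^bsub>S\<^esub> \<one>\<^bsub>S\<^esub>) \<odot>\<^bsub>T\<^esub> t"
  by (simp_all add: restrict_scalars_def with_smult_def)

lemma restrict_functor_sel [simp]:
  "Ob (restrict_functor S M) T = Ob M (restrict_scalars S T)"
  "Ar (restrict_functor S M) T T' = Ar M (restrict_scalars S T) (restrict_scalars S T')"
  by (simp_all add: restrict_functor_def)

text \<open>An equality of records: the module structure of \<open>regular T\<close> does not see the scalar multiplication
  of \<open>T\<close>.\<close>

lemma restrict_scalar_functor: "restrict_functor S scalar_functor = scalar_functor"
  by (simp add: restrict_functor_def scalar_functor_def regular_def restrict_scalars_def with_smult_def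
      fun_eq_iff)

lemma algebra_restrict_scalars:
  assumes S: "algebra K S" and T: "algebra S T"
  shows "algebra K (restrict_scalars S T)"
proof -
  interpret S: algebra K S by fact
  interpret T: algebra S T by fact
  have comm: "cring (restrict_scalars S T)"
    by (intro cringI abelian_groupI comm_monoidI)
      (auto simp: T.a_ac T.m_ac T.l_distr T.r_distr intro: T.M.add.l_inv_ex)
  have mult: "((k \<otimes>\<^bsub>K\<^esub> l) \<odot>\<^bsub>S\<^esub> \<one>\<^bsub>S\<^esub>) = (k \<odot>\<^bsub>S\<^esub> \<one>\<^bsub>S\<^esub>) \<otimes>\<^bsub>S\<^esub> (l \<odot>\<^bsub>S\<^esub> \<one>\<^bsub>S\<^esub>)"
    if "k \<in> carrier K" "l \<in> carrier K" for k l
    using that by (simp add: S.smult_assoc1 S.smult_assoc2)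
  show ?thesis
    by (rule algebraI[OF S.R_cring comm])
      (simp_all add: S.smult_l_distr T.smult_l_distr T.smult_r_distr mult T.smult_assoc1 T.smult_assoc2)
qed

lemma alg_hom_restrict_scalars:
  assumes S: "algebra K S" and h: "h \<in> alg_hom S T U"
  shows "h \<in> alg_hom K (restrict_scalars S T) (restrict_scalars S U)"
proof -
  interpret S: algebra K S by fact
  show ?thesis using h by (auto simp: alg_hom_def ring_hom_def)
qed

lemma unit_hom_restrict_scalars:
  assumes S: "algebra K S" and T: "algebra S T"
  shows "unit_hom S T \<in> alg_hom K S (restrict_scalars S T)"
proof -
  interpret S: algebra K S by fact
  interpret T: algebra S T by fact
  have "(k \<odot>\<^bsub>S\<^esub> s) \<odot>\<^bsub>T\<^esub> \<one>\<^bsub>T\<^esub> = (k \<odot>\<^bsub>S\<^esub> \<one>\<^bsub>S\<^esub>) \<odot>\<^bsub>T\<^esub> (s \<odot>\<^bsub>T\<^esub> \<one>\<^bsub>T\<^esub>)"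
    if "k \<in> carrier K" "s \<in> carrier S" for k s
    using that by (simp add: S.smult_assoc2 flip: T.smult_assoc1)
  then show ?thesis
    unfolding unit_hom_def
    by (intro restrict_alg_hom[OF S]) (simp_all add: T.smult_l_distr T.smult_assoc1 T.smult_assoc2)
qed

lemma compose_unit_hom:
  assumes "algebra S T" "h \<in> alg_hom S T U"
  shows "compose (carrier S) h (unit_hom S T) = unit_hom S U"
proof -
  interpret T: algebra S T by fact
  show ?thesis using assms(2)
    by (auto simp: compose_def unit_hom_def alg_hom_def ring_hom_def fun_eq_iff)
qed

lemma module_functor_restrict:
  assumes S: "algebra K S" and M: "module_functor K M"
  shows "module_functor S (restrict_functor S M)"
  unfolding module_functor_def
proof (intro conjI allI impI ballI, goal_cases)
  case (1 T)
  interpret T: algebra S T by fact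
  interpret E: module "restrict_scalars S T" "Ob M (restrict_scalars S T)"
    by (rule module_functorD(1)[OF M algebra_restrict_scalars[OF S 1]])
  show ?case
    using E.smult_closed E.smult_l_distr E.smult_r_distr E.smult_assoc1 E.smult_one
    by (intro moduleI) (simp_all add: T.M_cring E.M.abelian_group_axioms)
next
  case (2 T U h)
  then show ?case
    using module_functorD(2)[OF M algebra_restrict_scalars[OF S 2(1)] algebra_restrict_scalars[OF S 2(2)]
        alg_hom_restrict_scalars[OF S 2(3)]] by auto
next
  case (3 T U h x y)
  then show ?case
    using module_functorD(3)[OF M algebra_restrict_scalars[OF S 3(1)] algebra_restrict_scalars[OF S 3(2)]
        alg_hom_restrict_scalars[OF S 3(3)]] by simp
next
  case (4 T U h s x)
  then show ?case
    using module_functorD(4)[OF M algebra_restrict_scalars[OF S 4(1)] algebra_restrict_scalars[OF S 4(2)]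
        alg_hom_restrict_scalars[OF S 4(3)]] by simp
next
  case (5 T x)
  then show ?case
    using module_functorD(5)[OF M algebra_restrict_scalars[OF S 5(1)]] by simp
next
  case (6 T U W g h x)
  then show ?case
    using module_functorD(6)[OF M algebra_restrict_scalars[OF S 6(1)] algebra_restrict_scalars[OF S 6(2)]
        algebra_restrict_scalars[OF S 6(3)] alg_hom_restrict_scalars[OF S 6(4)]
        alg_hom_restrict_scalars[OF S 6(5)]] by simp
qed

lemma functor_hom_restrict:
  assumes S: "algebra K S" and M: "module_functor K M" and f: "f \<in> functor_hom K M N"
  obtains k where "k \<in> functor_hom S (restrict_functor S M) (restrict_functor S N)"
    and "\<And>T x. algebra S T \<Longrightarrow> x \<in> carrier (Ob M (restrict_scalars S T)) \<Longrightarrow>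
      k T x = f (restrict_scalars S T) x"
proof -
  let ?r = "restrict_scalars S"
  note fD = functor_homD[OF f]
  note alg = algebra_restrict_scalars[OF S]
  have "(\<lambda>T. if algebra S T then restrict (f (?r T)) (carrier (Ob (restrict_functor S M) T))
      else (\<lambda>_. undefined)) \<in> functor_hom S (restrict_functor S M) (restrict_functor S N)"
  proof (rule functor_homI[OF _ _ _ _ module_functor_restrict[OF S M]])
    fix T x assume T: "algebra S T" and x: "x \<in> carrier (Ob (restrict_functor S M) T)"
    then have x': "x \<in> carrier (Ob M (?r T))" by simp
    show "f (?r T) x \<in> carrier (Ob (restrict_functor S N) T)" using fD(1)[OF alg[OF T] x'] by simp
    show "f (?r T) (t \<odot>\<^bsub>Ob (restrict_functor S M) T\<^esub> x) = t \<odot>\<^bsub>Ob (restrict_functor S N) T\<^esub> f (?r T) x"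
      if "t \<in> carrier T" for t using fD(3)[OF alg[OF T] _ x', of t] that by simp
    show "f (?r T) (x \<oplus>\<^bsub>Ob (restrict_functor S M) T\<^esub> y) =
        f (?r T) x \<oplus>\<^bsub>Ob (restrict_functor S N) T\<^esub> f (?r T) y"
      if "y \<in> carrier (Ob (restrict_functor S M) T)" for y
      using fD(2)[OF alg[OF T] x', of y] that by simp
    show "f (?r U) (Ar (restrict_functor S M) T U h x) = Ar (restrict_functor S N) T U h (f (?r T) x)"
      if "algebra S U" "h \<in> alg_hom S T U" for U h
      using fD(4)[OF alg[OF T] alg[OF that(1)] alg_hom_restrict_scalars[OF S that(2)] x'] by simp
  qed
  then show ?thesis by (rule that) simp
qed

section \<open>Actions of a functor of algebras\<close>

lemma underlying_sel [simp]:
  "carrier (Ob (underlying A) S) = carrier (AOb A S)"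
  "x \<oplus>\<^bsub>Ob (underlying A) S\<^esub> y = x \<oplus>\<^bsub>AOb A S\<^esub> y"
  "s \<odot>\<^bsub>Ob (underlying A) S\<^esub> x = Aunit A S s \<otimes>\<^bsub>AOb A S\<^esub> x"
  "Ar (underlying A) = AAr A"
  by (simp_all add: underlying_def with_smult_def)

lemma action_module_sel [simp]:
  "carrier (action_module P act S) = carrier (Ob P S)"
  "x \<oplus>\<^bsub>action_module P act S\<^esub> y = x \<oplus>\<^bsub>Ob P S\<^esub> y"
  "a \<odot>\<^bsub>action_module P act S\<^esub> x = act S a x"
  by (simp_all add: action_module_def with_smult_def)

lemma algebra_functorD:
  assumes "algebra_functor R A"
  shows "algebra R S \<Longrightarrow> algebra R T \<Longrightarrow> h \<in> alg_hom R S T \<Longrightarrow> a \<in> carrier (AOb A S) \<Longrightarrow>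
      AAr A S T h a \<in> carrier (AOb A T)"
    and "algebra R S \<Longrightarrow> algebra R T \<Longrightarrow> algebra R U \<Longrightarrow> g \<in> alg_hom R S T \<Longrightarrow> h \<in> alg_hom R T U \<Longrightarrow>
      a \<in> carrier (AOb A S) \<Longrightarrow> AAr A S U (compose (carrier S) h g) a = AAr A T U h (AAr A S T g a)"
    and "algebra R S \<Longrightarrow> s \<in> carrier S \<Longrightarrow> Aunit A S s \<in> carrier (AOb A S)"
    and "algebra R S \<Longrightarrow> s \<in> carrier S \<Longrightarrow> a \<in> carrier (AOb A S) \<Longrightarrow>
      Aunit A S s \<otimes>\<^bsub>AOb A S\<^esub> a = a \<otimes>\<^bsub>AOb A S\<^esub> Aunit A S s"
    and "algebra R S \<Longrightarrow> a \<in> carrier (AOb A S) \<Longrightarrow> AAr A S S (\<lambda>s\<in>carrier S. s) a = a"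
proof -
  have h: "AAr A S T h \<in> ring_hom (AOb A S) (AOb A T)" if "algebra R S" "algebra R T" "h \<in> alg_hom R S T"
    using assms that unfolding algebra_functor_def by (elim conjE) simp
  show "algebra R S \<Longrightarrow> algebra R T \<Longrightarrow> h \<in> alg_hom R S T \<Longrightarrow> a \<in> carrier (AOb A S) \<Longrightarrow>
      AAr A S T h a \<in> carrier (AOb A T)"
    using h by (rule ring_hom_closed)
  have u: "Aunit A S \<in> ring_hom S (AOb A S)" if "algebra R S"
    using assms that unfolding algebra_functor_def by (elim conjE) simp
  show "algebra R S \<Longrightarrow> s \<in> carrier S \<Longrightarrow> Aunit A S s \<in> carrier (AOb A S)"
    using u by (rule ring_hom_closed)
  show "algebra R S \<Longrightarrow> algebra R T \<Longrightarrow> algebra R U \<Longrightarrow> g \<in> alg_hom R S T \<Longrightarrow> h \<in> alg_hom R T U \<Longrightarrow>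
      a \<in> carrier (AOb A S) \<Longrightarrow> AAr A S U (compose (carrier S) h g) a = AAr A T U h (AAr A S T g a)"
    using assms unfolding algebra_functor_def by (elim conjE) simp
  show "algebra R S \<Longrightarrow> s \<in> carrier S \<Longrightarrow> a \<in> carrier (AOb A S) \<Longrightarrow>
      Aunit A S s \<otimes>\<^bsub>AOb A S\<^esub> a = a \<otimes>\<^bsub>AOb A S\<^esub> Aunit A S s"
    using assms unfolding algebra_functor_def by (elim conjE) simp
  show "algebra R S \<Longrightarrow> a \<in> carrier (AOb A S) \<Longrightarrow> AAr A S S (\<lambda>s\<in>carrier S. s) a = a"
    using assms unfolding algebra_functor_def by (elim conjE) simp
qed

lemma algebra_actionD:
  assumes act: "algebra_action R A P act" and S: "algebra R S"
  shows "a \<in> carrier (AOb A S) \<Longrightarrow> x \<in> carrier (Ob P S) \<Longrightarrow> act S a x \<in> carrier (Ob P S)"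
    and "a \<in> carrier (AOb A S) \<Longrightarrow> b \<in> carrier (AOb A S) \<Longrightarrow> x \<in> carrier (Ob P S) \<Longrightarrow>
      act S (a \<oplus>\<^bsub>AOb A S\<^esub> b) x = act S a x \<oplus>\<^bsub>Ob P S\<^esub> act S b x"
    and "a \<in> carrier (AOb A S) \<Longrightarrow> x \<in> carrier (Ob P S) \<Longrightarrow> y \<in> carrier (Ob P S) \<Longrightarrow>
      act S a (x \<oplus>\<^bsub>Ob P S\<^esub> y) = act S a x \<oplus>\<^bsub>Ob P S\<^esub> act S a y"
    and "a \<in> carrier (AOb A S) \<Longrightarrow> b \<in> carrier (AOb A S) \<Longrightarrow> x \<in> carrier (Ob P S) \<Longrightarrow>
      act S (a \<otimes>\<^bsub>AOb A S\<^esub> b) x = act S a (act S b x)"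
    and "s \<in> carrier S \<Longrightarrow> x \<in> carrier (Ob P S) \<Longrightarrow> act S (Aunit A S s) x = s \<odot>\<^bsub>Ob P S\<^esub> x"
    and "algebra R T \<Longrightarrow> h \<in> alg_hom R S T \<Longrightarrow> a \<in> carrier (AOb A S) \<Longrightarrow> x \<in> carrier (Ob P S) \<Longrightarrow>
      Ar P S T h (act S a x) = act T (AAr A S T h a) (Ar P S T h x)"
proof -
  have "left_module (AOb A S) (action_module P act S)"
    using act S unfolding algebra_action_def by (elim conjE) simp
  then show "a \<in> carrier (AOb A S) \<Longrightarrow> x \<in> carrier (Ob P S) \<Longrightarrow> act S a x \<in> carrier (Ob P S)"
    "a \<in> carrier (AOb A S) \<Longrightarrow> b \<in> carrier (AOb A S) \<Longrightarrow> x \<in> carrier (Ob P S) \<Longrightarrow>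
      act S (a \<oplus>\<^bsub>AOb A S\<^esub> b) x = act S a x \<oplus>\<^bsub>Ob P S\<^esub> act S b x"
    "a \<in> carrier (AOb A S) \<Longrightarrow> x \<in> carrier (Ob P S) \<Longrightarrow> y \<in> carrier (Ob P S) \<Longrightarrow>
      act S a (x \<oplus>\<^bsub>Ob P S\<^esub> y) = act S a x \<oplus>\<^bsub>Ob P S\<^esub> act S a y"
    "a \<in> carrier (AOb A S) \<Longrightarrow> b \<in> carrier (AOb A S) \<Longrightarrow> x \<in> carrier (Ob P S) \<Longrightarrow>
      act S (a \<otimes>\<^bsub>AOb A S\<^esub> b) x = act S a (act S b x)"
    unfolding left_module_def action_module_sel by simp_all
  show "s \<in> carrier S \<Longrightarrow> x \<in> carrier (Ob P S) \<Longrightarrow> act S (Aunit A S s) x = s \<odot>\<^bsub>Ob P S\<^esub> x"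
    "algebra R T \<Longrightarrow> h \<in> alg_hom R S T \<Longrightarrow> a \<in> carrier (AOb A S) \<Longrightarrow> x \<in> carrier (Ob P S) \<Longrightarrow>
      Ar P S T h (act S a x) = act T (AAr A S T h a) (Ar P S T h x)"
    using act S unfolding algebra_action_def by (elim conjE, simp)+
qed

text \<open>The image of \<open>a \<in> A(K)\<close> in \<open>A(S)\<close>.\<close>

abbreviation scalar_ext :: "('u, 'x) ring_scheme \<Rightarrow> ('u, 'a) alg_functor \<Rightarrow> 'u alg \<Rightarrow> 'a \<Rightarrow> 'a" where
  "scalar_ext K A S \<equiv> AAr A (regular K) S (unit_hom K S)"

text \<open>Multiplication by a constant \<open>a \<in> A(K)\<close> is an endomorphism of \<open>P\<close>; it commutes with scalars because these
  are central in \<open>A(S)\<close>.\<close>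

lemma action_functor_hom:
  assumes K: "cring K" and A: "algebra_functor K A" and P: "algebra_action K A P act"
    and a: "a \<in> carrier (AOb A (regular K))"
  obtains k where "k \<in> functor_hom K P P"
    and "\<And>S x. algebra K S \<Longrightarrow> x \<in> carrier (Ob P S) \<Longrightarrow> k S x = act S (scalar_ext K A S a) x"
proof -
  have M: "module_functor K P" using P by (simp add: algebra_action_def)
  note R = algebra_regular[OF K]
  have aS: "scalar_ext K A S a \<in> carrier (AOb A S)" if "algebra K S" for S
    by (rule algebra_functorD(1)[OF A R that unit_hom_alg_hom[OF that] a])
  note PD = algebra_actionD[OF P]
  have "(\<lambda>S. if algebra K S then restrict (act S (scalar_ext K A S a)) (carrier (Ob P S)) else (\<lambda>_. undefined))
    \<in> functor_hom K P P"
  proof (rule functor_homI[OF _ _ _ _ M])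
    fix S x assume S: "algebra K S" and x: "x \<in> carrier (Ob P S)"
    note aS = aS[OF S]
    show "act S (scalar_ext K A S a) x \<in> carrier (Ob P S)" by (rule PD(1)[OF S aS x])
    show "act S (scalar_ext K A S a) (x \<oplus>\<^bsub>Ob P S\<^esub> y) =
        act S (scalar_ext K A S a) x \<oplus>\<^bsub>Ob P S\<^esub> act S (scalar_ext K A S a) y"
      if "y \<in> carrier (Ob P S)" for y by (rule PD(3)[OF S aS x that])
    show "act S (scalar_ext K A S a) (s \<odot>\<^bsub>Ob P S\<^esub> x) = s \<odot>\<^bsub>Ob P S\<^esub> act S (scalar_ext K A S a) x"
      if s: "s \<in> carrier S" for s
    proof -
      note u = algebra_functorD(3)[OF A S s]
      have "act S (scalar_ext K A S a) (s \<odot>\<^bsub>Ob P S\<^esub> x) = act S (scalar_ext K A S a \<otimes>\<^bsub>AOb A S\<^esub> Aunit A S s) x"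
        using PD(4)[OF S aS u x] PD(5)[OF S s x] by simp
      also have "\<dots> = act S (Aunit A S s \<otimes>\<^bsub>AOb A S\<^esub> scalar_ext K A S a) x"
        using algebra_functorD(4)[OF A S s aS] by simp
      also have "\<dots> = s \<odot>\<^bsub>Ob P S\<^esub> act S (scalar_ext K A S a) x"
        using PD(4)[OF S u aS x] PD(5)[OF S s PD(1)[OF S aS x]] by simp
      finally show ?thesis .
    qed
    show "act T (scalar_ext K A T a) (Ar P S T h x) = Ar P S T h (act S (scalar_ext K A S a) x)"
      if T: "algebra K T" and h: "h \<in> alg_hom K S T" for T h
    proof -
      have "AAr A S T h (scalar_ext K A S a) = scalar_ext K A T a"
        using algebra_functorD(2)[OF A R S T unit_hom_alg_hom[OF S] h a] compose_unit_hom[OF S h] by simp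
      then show ?thesis using PD(6)[OF S T h aS x] by simp
    qed
  qed
  then show ?thesis by (rule that) simp
qed

text \<open>The orbit map \<open>a \<mapsto> a p\<close> of a point \<open>p \<in> P(S)\<close>, as a morphism of functors on \<open>S\<close>-algebras.\<close>

lemma evaluation_functor_hom:
  assumes S: "algebra K S" and A: "algebra_functor K A" and U: "module_functor K (underlying A)"
    and P: "algebra_action K A P act" and p: "p \<in> carrier (Ob P S)"
  obtains k where "k \<in> functor_hom S (restrict_functor S (underlying A)) (restrict_functor S P)"
    and "\<And>T a. algebra S T \<Longrightarrow> a \<in> carrier (AOb A (restrict_scalars S T)) \<Longrightarrow>
      k T a = act (restrict_scalars S T) a (Ar P S (restrict_scalars S T) (unit_hom S T) p)"
proof -
  have M: "module_functor K P" using P by (simp add: algebra_action_def)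
  let ?r = "restrict_scalars S"
  note alg = algebra_restrict_scalars[OF S] and uh = unit_hom_restrict_scalars[OF S]
  define q where "q T = Ar P S (?r T) (unit_hom S T) p" for T
  have q: "q T \<in> carrier (Ob P (?r T))" if "algebra S T" for T
    unfolding q_def by (rule module_functorD(2)[OF M S alg[OF that] uh[OF that] p])
  note PD = algebra_actionD[OF P]
  have "(\<lambda>T. if algebra S T then restrict (\<lambda>a. act (?r T) a (q T)) (carrier (Ob (restrict_functor S (underlying A)) T))
      else (\<lambda>_. undefined)) \<in> functor_hom S (restrict_functor S (underlying A)) (restrict_functor S P)"
  proof (rule functor_homI[OF _ _ _ _ module_functor_restrict[OF S U]])
    fix T a assume T: "algebra S T" and "a \<in> carrier (Ob (restrict_functor S (underlying A)) T)"
    then have a: "a \<in> carrier (AOb A (?r T))" by simp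
    note rT = alg[OF T] and qT = q[OF T]
    show "act (?r T) a (q T) \<in> carrier (Ob (restrict_functor S P) T)" using PD(1)[OF rT a qT] by simp
    show "act (?r T) (a \<oplus>\<^bsub>Ob (restrict_functor S (underlying A)) T\<^esub> b) (q T) =
        act (?r T) a (q T) \<oplus>\<^bsub>Ob (restrict_functor S P) T\<^esub> act (?r T) b (q T)"
      if "b \<in> carrier (Ob (restrict_functor S (underlying A)) T)" for b
      using PD(2)[OF rT a _ qT, of b] that by simp
    show "act (?r T) (t \<odot>\<^bsub>Ob (restrict_functor S (underlying A)) T\<^esub> a) (q T) =
        t \<odot>\<^bsub>Ob (restrict_functor S P) T\<^esub> act (?r T) a (q T)" if "t \<in> carrier T" for t
    proof -
      have t: "t \<in> carrier (?r T)" using that by simp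
      show ?thesis
        using PD(4)[OF rT algebra_functorD(3)[OF A rT t] a qT] PD(5)[OF rT t PD(1)[OF rT a qT]] by simp
    qed
    show "act (?r T') (Ar (restrict_functor S (underlying A)) T T' h a) (q T') =
        Ar (restrict_functor S P) T T' h (act (?r T) a (q T))"
      if T': "algebra S T'" and h: "h \<in> alg_hom S T T'" for T' h
    proof -
      note h' = alg_hom_restrict_scalars[OF S h]
      have "Ar P (?r T) (?r T') h (q T) = q T'"
        using module_functorD(6)[OF M S rT alg[OF T'] uh[OF T] h' p] compose_unit_hom[OF T h]
        by (simp add: q_def)
      then show ?thesis using PD(6)[OF rT alg[OF T'] h' a qT] by simp
    qed
  qed
  then show ?thesis by (rule that) (simp add: q_def)
qed

section \<open>From \<open>K\<close> to arbitrary algebras\<close>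

lemma eq_if_minus_eq_zero:
  assumes "abelian_group G" "x \<in> carrier G" "y \<in> carrier G" "x \<ominus>\<^bsub>G\<^esub> y = \<zero>\<^bsub>G\<^esub>"
  shows "x = y"
proof -
  interpret G: abelian_group G by fact
  have "x = (x \<ominus>\<^bsub>G\<^esub> y) \<oplus>\<^bsub>G\<^esub> y" using assms(2,3) by (simp add: G.minus_eq G.add.m_assoc G.l_neg)
  then show ?thesis using assms by simp
qed

text \<open>The defect \<open>p \<mapsto> f(a p) - a f(p)\<close> is a morphism \<open>d : P \<rightarrow> P'\<close> that vanishes over \<open>K\<close>. Composed with any
  functional of \<open>P'\<close> it is zero by \<open>functional_eq_zero\<close>, and functionals separate points.\<close>

lemma functor_hom_commutes_constant_scalars:
  assumes K: "field K" and A: "algebra_functor K A"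
    and P: "proquasi_coherent TYPE('i) TYPE('v) K P" and P': "proquasi_coherent TYPE('j) TYPE('w) K P'"
    and act: "algebra_action K A P act" and act': "algebra_action K A P' act'"
    and f: "f \<in> functor_hom K P P'"
    and a: "a \<in> carrier (AOb A (regular K))"
    and fK: "\<And>p. p \<in> carrier (Ob P (regular K)) \<Longrightarrow>
      f (regular K) (act (regular K) a p) = act' (regular K) a (f (regular K) p)"
    and S: "algebra K S" and p: "p \<in> carrier (Ob P S)"
  shows "f S (act S (scalar_ext K A S a) p) = act' S (scalar_ext K A S a) (f S p)"
proof -
  interpret K: field K by fact
  note R = algebra_regular[OF K.is_cring]
  have M: "module_functor K P" and M': "module_functor K P'"
    using P P' by (simp_all add: proquasi_coherent_def)
  interpret PS: module S "Ob P' S" by (rule module_functorD(1)[OF M' S])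
  interpret PR: module "regular K" "Ob P' (regular K)" by (rule module_functorD(1)[OF M' R])
  obtain l where l: "l \<in> functor_hom K P P"
    "\<And>S x. algebra K S \<Longrightarrow> x \<in> carrier (Ob P S) \<Longrightarrow> l S x = act S (scalar_ext K A S a) x"
    by (rule action_functor_hom[OF K.is_cring A act a]) (rule that)
  obtain l' where l': "l' \<in> functor_hom K P' P'"
    "\<And>S x. algebra K S \<Longrightarrow> x \<in> carrier (Ob P' S) \<Longrightarrow> l' S x = act' S (scalar_ext K A S a) x"
    by (rule action_functor_hom[OF K.is_cring A act' a]) (rule that)
  obtain fl where fl: "fl \<in> functor_hom K P P'"
    "\<And>S x. algebra K S \<Longrightarrow> x \<in> carrier (Ob P S) \<Longrightarrow> fl S x = f S (l S x)"
    by (rule functor_hom_comp[OF l(1) f M]) (rule that)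
  obtain lf where lf: "lf \<in> functor_hom K P P'"
    "\<And>S x. algebra K S \<Longrightarrow> x \<in> carrier (Ob P S) \<Longrightarrow> lf S x = l' S (f S x)"
    by (rule functor_hom_comp[OF f l'(1) M]) (rule that)
  obtain d where d: "d \<in> functor_hom K P P'"
    "\<And>S x. algebra K S \<Longrightarrow> x \<in> carrier (Ob P S) \<Longrightarrow> d S x = fl S x \<ominus>\<^bsub>Ob P' S\<^esub> lf S x"
    by (rule functor_hom_diff[OF fl(1) lf(1) M M']) (rule that)
  have aK: "scalar_ext K A (regular K) a = a"
  proof -
    have "unit_hom K (regular K) = (\<lambda>s\<in>carrier (regular K). s)"
      by (simp add: unit_hom_def restrict_def fun_eq_iff)
    with algebra_functorD(5)[OF A R a] show ?thesis by (simp only:)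
  qed
  have dK: "d (regular K) q = \<zero>\<^bsub>Ob P' (regular K)\<^esub>" if q: "q \<in> carrier (Ob P (regular K))" for q
  proof -
    have "fl (regular K) q = lf (regular K) q"
      by (simp add: fl(2)[OF R q] lf(2)[OF R q] l(2)[OF R q] l'(2)[OF R functor_homD(1)[OF f R q]] aK fK[OF q])
    then show ?thesis using d(2)[OF R q] functor_homD(1)[OF lf(1) R q] by (simp add: PR.M.minus_eq PR.M.r_neg)
  qed
  have "d S p = \<zero>\<^bsub>Ob P' S\<^esub>"
  proof (rule proquasi_coherent_separated[OF K P' S functor_homD(1)[OF d(1) S p]])
    fix w assume w: "w \<in> functor_hom K P' scalar_functor"
    obtain v where v: "v \<in> functor_hom K P scalar_functor"
      "\<And>S x. algebra K S \<Longrightarrow> x \<in> carrier (Ob P S) \<Longrightarrow> v S x = w S (d S x)"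
      by (rule functor_hom_comp[OF d(1) w M]) (rule that)
    have w0: "w (regular K) \<zero>\<^bsub>Ob P' (regular K)\<^esub> = \<zero>\<^bsub>K\<^esub>"
      using functor_homD(3)[OF w R, of "\<zero>\<^bsub>K\<^esub>" "\<zero>\<^bsub>Ob P' (regular K)\<^esub>"]
        functor_homD(1)[OF w R PR.zero_closed] PR.smult_r_null[of "\<zero>\<^bsub>K\<^esub>"] by simp
    have "v S p = \<zero>\<^bsub>S\<^esub>"
      by (rule functional_eq_zero[OF K P v(1) _ S p]) (simp add: v(2)[OF R] dK w0)
    then show "w S (d S p) = \<zero>\<^bsub>S\<^esub>" using v(2)[OF S p] by simp
  qed
  then have "fl S p = lf S p"
    using eq_if_minus_eq_zero[OF PS.M.abelian_group_axioms functor_homD(1)[OF fl(1) S p]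
        functor_homD(1)[OF lf(1) S p]] d(2)[OF S p] by simp
  then show ?thesis
    by (simp add: fl(2)[OF S p] lf(2)[OF S p] l(2)[OF S p] l'(2)[OF S functor_homD(1)[OF f S p]])
qed

lemma global_map_eq_tensor_lift:
  assumes "algebra K S" "x \<in> carrier (Ob (global_part K M) S)"
  shows "global_map K M S x =
    tensor_lift (Ob M S) (\<lambda>p. snd p \<odot>\<^bsub>Ob M S\<^esub> Ar M (regular K) S (unit_hom K S) (fst p)) x"
  using assms by (simp add: global_map_def tensor_lift_def frag_sum_def[abs_def])

lemma module_over_regular: "module (regular K) E \<Longrightarrow> cring K \<Longrightarrow> module K E"
proof -
  assume E: "module (regular K) E" and K: "cring K"
  interpret E: module "regular K" E by (rule E)
  show "module K E"
    using E.smult_closed E.smult_l_distr E.smult_r_distr E.smult_assoc1 E.smult_one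
    by (intro moduleI[OF K]) (simp_all add: E.M.abelian_group_axioms)
qed

text \<open>Every tensor in \<open>M(K) \<otimes> T\<close> is a sum of pure tensors, and \<open>m \<otimes> t\<close> is mapped to \<open>t\<close> times the image of
  \<open>m\<close> in \<open>M(T)\<close>.\<close>

lemma dual_map_global_eqI:
  assumes K: "cring K" and M: "module_functor K M" and S: "algebra K S"
    and w: "w \<in> dual M S" and z: "z \<in> dual M S"
    and w0: "\<And>T m. algebra S T \<Longrightarrow> m \<in> carrier (Ob M (regular K)) \<Longrightarrow>
      w T (Ar M (regular K) (restrict_scalars S T) (unit_hom K (restrict_scalars S T)) m) = 
      z T (Ar M (regular K) (restrict_scalars S T) (unit_hom K (restrict_scalars S T)) m)"
  shows "dual_map (global_part K M) (global_map K M) S w = dual_map (global_part K M) (global_map K M) S z"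
proof -
  let ?r = "restrict_scalars S"
  note R = algebra_regular[OF K]
  note V = module_over_regular[OF module_functorD(1)[OF M R] K]
  have "w T (global_map K M (?r T) x) = z T (global_map K M (?r T) x)"
    if T: "algebra S T" and x: "x \<in> carrier (Ob (global_part K M) (?r T))" for T x
  proof -
    interpret T: algebra S T by (rule T)
    note rT = algebra_restrict_scalars[OF S T]
    interpret rT: algebra K "?r T" by (rule rT)
    interpret MT: module "?r T" "Ob M (?r T)" by (rule module_functorD(1)[OF M rT])
    let ?V = "Ob M (regular K)" and ?u = "unit_hom K (?r T)"
    note u = unit_hom_alg_hom[OF rT]
    let ?\<phi> = "\<lambda>p. snd p \<odot>\<^bsub>Ob M (?r T)\<^esub> Ar M (regular K) (?r T) ?u (fst p)"
    note ArD = module_functorD(2,3,4)[OF M R rT u]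
    have bal: "balanced K ?V (?r T) (Ob M (?r T)) ?\<phi>"
      unfolding balanced_def
    proof (intro conjI ballI)
      fix v s assume v: "v \<in> carrier ?V" and s: "s \<in> carrier (?r T)"
      show "?\<phi> (v, s) \<in> carrier (Ob M (?r T))" using s ArD(1)[OF v] by simp
      show "?\<phi> (v \<oplus>\<^bsub>?V\<^esub> v', s) = ?\<phi> (v, s) \<oplus>\<^bsub>Ob M (?r T)\<^esub> ?\<phi> (v', s)" if "v' \<in> carrier ?V" for v'
        using s ArD(1)[OF v] ArD(1)[OF that] ArD(2)[OF v that] by (simp add: MT.smult_r_distr)
      show "?\<phi> (v, s \<oplus>\<^bsub>?r T\<^esub> s') = ?\<phi> (v, s) \<oplus>\<^bsub>Ob M (?r T)\<^esub> ?\<phi> (v, s')" if "s' \<in> carrier (?r T)" for s'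
        unfolding fst_conv snd_conv by (rule MT.smult_l_distr[OF s that ArD(1)[OF v]])
      show "?\<phi> (k \<odot>\<^bsub>?V\<^esub> v, s) = ?\<phi> (v, k \<odot>\<^bsub>?r T\<^esub> s)" if k: "k \<in> carrier K" for k
      proof -
        have uk: "?u k \<in> carrier (?r T)" using k u by (auto simp: alg_hom_def ring_hom_def)
        have "s \<otimes>\<^bsub>?r T\<^esub> ?u k = k \<odot>\<^bsub>?r T\<^esub> s"
        proof -
          have "?u k = k \<odot>\<^bsub>?r T\<^esub> \<one>\<^bsub>?r T\<^esub>" using k by (simp add: unit_hom_def)
          then show ?thesis
            using rT.m_comm[OF s uk] rT.smult_assoc2[OF k rT.one_closed s] rT.l_one[OF s] by simp
        qed
        then show ?thesis
          using ArD(3)[OF _ v, of k] k MT.smult_assoc1[OF s uk ArD(1)[OF v]] by simp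
      qed
    qed
    note lift = V rT.module MT.M.abelian_group_axioms bal
    have x': "x \<in> carrier (base_change K ?V (?r T))" using x by (simp add: global_part_def)
    have wz: "v T (tensor_lift (Ob M (?r T)) ?\<phi> y) \<in> carrier T"
      "v T (tensor_lift (Ob M (?r T)) ?\<phi> (y \<oplus>\<^bsub>base_change K ?V (?r T)\<^esub> y')) =
        v T (tensor_lift (Ob M (?r T)) ?\<phi> y) \<oplus>\<^bsub>T\<^esub> v T (tensor_lift (Ob M (?r T)) ?\<phi> y')"
      if v: "v \<in> dual M S" and y: "y \<in> carrier (base_change K ?V (?r T))"
        "y' \<in> carrier (base_change K ?V (?r T))" for v y y'
      using functor_homD(1,2)[OF v[unfolded dual_def] T] tensor_lift_closed[OF lift y(1)]
        tensor_lift_closed[OF lift y(2)] tensor_lift_add[OF lift y] by simp_all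
    have "w T (tensor_lift (Ob M (?r T)) ?\<phi> x) = z T (tensor_lift (Ob M (?r T)) ?\<phi> x)"
    proof (rule tensor_ext[OF V rT.module T.abelian_group_axioms x',
          where f="\<lambda>x. w T (tensor_lift (Ob M (?r T)) ?\<phi> x)"])
      fix v s assume v: "v \<in> carrier ?V" and s: "s \<in> carrier (?r T)"
      have sT: "s \<in> carrier T" using s by simp
      have "v' T (?\<phi> (v, s)) = s \<otimes>\<^bsub>T\<^esub> v' T (Ar M (regular K) (?r T) ?u v)" if "v' \<in> dual M S" for v'
        using functor_homD(3)[OF that[unfolded dual_def] T sT] ArD(1)[OF v] by simp
      from this[OF w] this[OF z]
      show "w T (tensor_lift (Ob M (?r T)) ?\<phi> (pure K ?V (?r T) v s)) =
          z T (tensor_lift (Ob M (?r T)) ?\<phi> (pure K ?V (?r T) v s))"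
        using w0[OF T v] by (simp add: tensor_lift_pure[OF lift v s])
    qed (simp_all only: wz[OF w] wz[OF z])
    then show ?thesis by (simp only: global_map_eq_tensor_lift[OF rT x])
  qed
  then show ?thesis by (auto simp: dual_map_def fun_eq_iff)
qed

lemma zero_functional:
  assumes M: "module_functor R M"
  obtains z where "z \<in> functor_hom R M scalar_functor"
    and "\<And>S x. algebra R S \<Longrightarrow> x \<in> carrier (Ob M S) \<Longrightarrow> z S x = \<zero>\<^bsub>S\<^esub>"
proof -
  have "(\<lambda>S. if algebra R S then restrict (\<lambda>_. \<zero>\<^bsub>S\<^esub>) (carrier (Ob M S)) else (\<lambda>_. undefined))
    \<in> functor_hom R M scalar_functor"
  proof (rule functor_homI[OF _ _ _ _ M])
    fix S x assume S: "algebra R S" and x: "x \<in> carrier (Ob M S)"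
    interpret S: algebra R S by (rule S)
    show "\<zero>\<^bsub>S\<^esub> \<in> carrier (Ob scalar_functor S)" "\<zero>\<^bsub>S\<^esub> = \<zero>\<^bsub>S\<^esub> \<oplus>\<^bsub>Ob scalar_functor S\<^esub> \<zero>\<^bsub>S\<^esub>"
      "s \<in> carrier S \<Longrightarrow> \<zero>\<^bsub>S\<^esub> = s \<odot>\<^bsub>Ob scalar_functor S\<^esub> \<zero>\<^bsub>S\<^esub>" for s
      by simp_all
    fix T h assume T: "algebra R T" and h: "h \<in> alg_hom R S T"
    interpret T: algebra R T by (rule T)
    have "h \<zero>\<^bsub>S\<^esub> = \<zero>\<^bsub>T\<^esub>"
      by (rule additive_zero[OF S.abelian_group_axioms T.abelian_group_axioms])
        (use linear_onD[OF alg_hom_linear[OF h]] in simp_all)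
    then show "\<zero>\<^bsub>T\<^esub> = Ar scalar_functor S T h \<zero>\<^bsub>S\<^esub>" by simp
  qed
  then show ?thesis by (rule that) simp
qed

text \<open>The defect is now regarded as a function of \<open>a\<close>, with \<open>p\<close> fixed: \<open>d\<close> is a morphism of functors on
  \<open>S\<close>-algebras, and for each functional \<open>l\<close> of \<open>P'\<close> the composite \<open>w\<close> lies in \<open>A\<^sup>*(S)\<close>. It has the same image
  as \<open>0\<close> in the dual of \<open>A(K) \<otimes> _\<close>, hence is \<open>0\<close>.\<close>

lemma functor_hom_commutes_action:
  assumes K: "field K" and A: "algebra_functor K A" and D: "D_proquasi_coherent K (underlying A)"
    and M: "module_functor K P" and P': "proquasi_coherent TYPE('j) TYPE('w) K P'"
    and act: "algebra_action K A P act" and act': "algebra_action K A P' act'"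
    and f: "f \<in> functor_hom K P P'"
    and const: "\<And>a S p. a \<in> carrier (AOb A (regular K)) \<Longrightarrow> algebra K S \<Longrightarrow> p \<in> carrier (Ob P S) \<Longrightarrow>
      f S (act S (scalar_ext K A S a) p) = act' S (scalar_ext K A S a) (f S p)"
    and S: "algebra K S" and a: "a \<in> carrier (AOb A S)" and p: "p \<in> carrier (Ob P S)"
  shows "f S (act S a p) = act' S a (f S p)"
proof -
  interpret K: field K by fact
  interpret S: algebra K S by fact
  have U: "module_functor K (underlying A)" using D by (simp add: D_proquasi_coherent_def)
  have M': "module_functor K P'" using P' by (simp add: proquasi_coherent_def)
  let ?r = "restrict_scalars S" and ?A = "restrict_functor S (underlying A)"
  note alg = algebra_restrict_scalars[OF S] and uh = unit_hom_restrict_scalars[OF S]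
  define q where "q T = Ar P S (?r T) (unit_hom S T) p" for T
  have q: "q T \<in> carrier (Ob P (?r T))" if "algebra S T" for T
    unfolding q_def by (rule module_functorD(2)[OF M S alg[OF that] uh[OF that] p])
  have fq: "Ar P' S (?r T) (unit_hom S T) (f S p) = f (?r T) (q T)" if "algebra S T" for T
    using functor_homD(4)[OF f S alg[OF that] uh[OF that] p] by (simp add: q_def)
  note fp = functor_homD(1)[OF f S p]
  note rU = module_functor_restrict[OF S U] and rM' = module_functor_restrict[OF S M']
  obtain ev where ev: "ev \<in> functor_hom S ?A (restrict_functor S P)"
    "\<And>T b. algebra S T \<Longrightarrow> b \<in> carrier (AOb A (?r T)) \<Longrightarrow> ev T b = act (?r T) b (Ar P S (?r T) (unit_hom S T) p)"
    by (rule evaluation_functor_hom[OF S A U act p]) (rule that)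
  obtain ev' where ev': "ev' \<in> functor_hom S ?A (restrict_functor S P')"
    "\<And>T b. algebra S T \<Longrightarrow> b \<in> carrier (AOb A (?r T)) \<Longrightarrow>
      ev' T b = act' (?r T) b (Ar P' S (?r T) (unit_hom S T) (f S p))"
    by (rule evaluation_functor_hom[OF S A U act' fp]) (rule that)
  obtain fS where fS: "fS \<in> functor_hom S (restrict_functor S P) (restrict_functor S P')"
    "\<And>T x. algebra S T \<Longrightarrow> x \<in> carrier (Ob P (?r T)) \<Longrightarrow> fS T x = f (?r T) x"
    by (rule functor_hom_restrict[OF S M f]) (rule that)
  obtain g where g: "g \<in> functor_hom S ?A (restrict_functor S P')"
    "\<And>T b. algebra S T \<Longrightarrow> b \<in> carrier (Ob ?A T) \<Longrightarrow> g T b = fS T (ev T b)"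
    by (rule functor_hom_comp[OF ev(1) fS(1) rU]) (rule that)
  obtain d where d: "d \<in> functor_hom S ?A (restrict_functor S P')"
    "\<And>T b. algebra S T \<Longrightarrow> b \<in> carrier (Ob ?A T) \<Longrightarrow> d T b = g T b \<ominus>\<^bsub>Ob (restrict_functor S P') T\<^esub> ev' T b"
    by (rule functor_hom_diff[OF g(1) ev'(1) rU rM']) (rule that)
  have g_eq: "g T b = f (?r T) (act (?r T) b (q T))" if T: "algebra S T" and b: "b \<in> carrier (AOb A (?r T))" for T b
    using g(2)[OF T, of b] ev(2)[OF T b, folded q_def] fS(2)[OF T algebra_actionD(1)[OF act alg[OF T] b q[OF T]]] b by simp
  have ev'_eq: "ev' T b = act' (?r T) b (f (?r T) (q T))" if T: "algebra S T" and b: "b \<in> carrier (AOb A (?r T))" for T b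
    using ev'(2)[OF T b] fq[OF T] by simp
  \<comment> \<open>\<open>S\<close> over itself and then over \<open>K\<close> is \<open>S\<close> again, but as a record only up to the values of the scalar
    multiplication outside the carriers. So the identity is proved for \<open>?r T\<close> and transported to \<open>S\<close>
    along the isomorphism \<open>unit_hom S T\<close> with inverse \<open>\<kappa>\<close>.\<close>
  define T where "T = regular S"
  have T: "algebra S T" unfolding T_def by (rule algebra_regular[OF S.M_cring])
  note rT = alg[OF T]
  define b where "b = AAr A S (?r T) (unit_hom S T) a"
  have b: "b \<in> carrier (AOb A (?r T))"
    unfolding b_def by (rule algebra_functorD(1)[OF A S rT uh[OF T] a])
  interpret PT: module "?r T" "Ob P' (?r T)" by (rule module_functorD(1)[OF M' rT])
  have dT: "d T b \<in> carrier (Ob P' (?r T))" using functor_homD(1)[OF d(1) T, of b] b by simp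
  have "d T b = \<zero>\<^bsub>Ob P' (?r T)\<^esub>"
  proof (rule proquasi_coherent_separated[OF K P' rT dT])
    fix l assume l: "l \<in> functor_hom K P' scalar_functor"
    obtain lS where lS: "lS \<in> functor_hom S (restrict_functor S P') scalar_functor"
      "\<And>T x. algebra S T \<Longrightarrow> x \<in> carrier (Ob P' (?r T)) \<Longrightarrow> lS T x = l (?r T) x"
      using functor_hom_restrict[OF S M' l] unfolding restrict_scalar_functor by metis
    obtain w where w: "w \<in> functor_hom S ?A scalar_functor"
      "\<And>T b. algebra S T \<Longrightarrow> b \<in> carrier (Ob ?A T) \<Longrightarrow> w T b = lS T (d T b)"
      by (rule functor_hom_comp[OF d(1) lS(1) rU]) (rule that)
    obtain z where z: "z \<in> functor_hom S ?A scalar_functor"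
      and z0: "\<And>T b. algebra S T \<Longrightarrow> b \<in> carrier (Ob ?A T) \<Longrightarrow> z T b = \<zero>\<^bsub>T\<^esub>"
      by (rule zero_functional[OF rU]) (rule that)
    have "dual_map (global_part K (underlying A)) (global_map K (underlying A)) S w =
        dual_map (global_part K (underlying A)) (global_map K (underlying A)) S z"
    proof (rule dual_map_global_eqI[OF K.is_cring U S])
      show "w \<in> dual (underlying A) S" "z \<in> dual (underlying A) S"
        using w(1) z by (simp_all add: dual_def)
      fix W :: "'a alg" and m assume W: "algebra S W" and "m \<in> carrier (Ob (underlying A) (regular K))"
      then have m: "m \<in> carrier (AOb A (regular K))" by simp
      let ?m = "scalar_ext K A (?r W) m"
      interpret W: algebra S W by (rule W)
      note rW = alg[OF W]
      interpret PW: module "?r W" "Ob P' (?r W)" by (rule module_functorD(1)[OF M' rW])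
      have mW: "?m \<in> carrier (AOb A (?r W))"
        by (rule algebra_functorD(1)[OF A algebra_regular[OF K.is_cring] rW unit_hom_alg_hom[OF rW] m])
      have "g W ?m = ev' W ?m"
        unfolding g_eq[OF W mW] ev'_eq[OF W mW] by (rule const[OF m rW q[OF W]])
      moreover have "ev' W ?m \<in> carrier (Ob P' (?r W))" using functor_homD(1)[OF ev'(1) W, of ?m] mW by simp
      ultimately have "d W ?m = \<zero>\<^bsub>Ob P' (?r W)\<^esub>"
        using d(2)[OF W, of ?m] mW by (simp add: PW.M.minus_eq PW.M.r_neg)
      moreover have "l (?r W) \<zero>\<^bsub>Ob P' (?r W)\<^esub> = \<zero>\<^bsub>W\<^esub>"
      proof -
        have z: "\<zero>\<^bsub>W\<^esub> \<in> carrier (?r W)" by simp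
        show ?thesis
          using functor_homD(3)[OF l rW z PW.zero_closed] PW.smult_r_null[OF z]
            functor_homD(1)[OF l rW PW.zero_closed] by simp
      qed
      ultimately have "w W ?m = \<zero>\<^bsub>W\<^esub>" using w(2)[OF W, of ?m] lS(2)[OF W PW.zero_closed] mW by simp
      then show "w W (Ar (underlying A) (regular K) (?r W) (unit_hom K (?r W)) m) =
          z W (Ar (underlying A) (regular K) (?r W) (unit_hom K (?r W)) m)"
        using z0[OF W, of ?m] mW by simp
    qed
    moreover have "inj_on (dual_map (global_part K (underlying A)) (global_map K (underlying A)) S) (dual (underlying A) S)"
      using D S by (simp add: D_proquasi_coherent_def)
    ultimately have "w = z" using w(1) z by (auto simp: dual_def inj_on_def)
    then have "lS T (d T b) = \<zero>\<^bsub>T\<^esub>" using w(2)[OF T, of b] z0[OF T, of b] b by simp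
    then show "l (?r T) (d T b) = \<zero>\<^bsub>?r T\<^esub>" using lS(2)[OF T dT] by simp
  qed
  then have "f (?r T) (act (?r T) b (q T)) = act' (?r T) b (f (?r T) (q T))"
    using eq_if_minus_eq_zero[OF PT.M.abelian_group_axioms, of "g T b" "ev' T b"] d(2)[OF T, of b]
      functor_homD(1)[OF g(1) T, of b] functor_homD(1)[OF ev'(1) T, of b] b
    by (simp add: g_eq[OF T b] ev'_eq[OF T b])
  then have eq: "Ar P' S (?r T) (unit_hom S T) (f S (act S a p)) = Ar P' S (?r T) (unit_hom S T) (act' S a (f S p))"
    using algebra_actionD(6)[OF act S rT uh[OF T] a p] algebra_actionD(6)[OF act' S rT uh[OF T] a fp]
      functor_homD(4)[OF f S rT uh[OF T] algebra_actionD(1)[OF act S a p]] fq[OF T]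
    by (simp add: b_def q_def)
  define \<kappa> where "\<kappa> = (\<lambda>s\<in>carrier (?r T). s)"
  have \<kappa>: "\<kappa> \<in> alg_hom K (?r T) S"
    unfolding \<kappa>_def
    by (rule restrict_alg_hom[OF rT]) (simp_all add: T_def S.smult_assoc2)
  have comp: "compose (carrier S) \<kappa> (unit_hom S T) = (\<lambda>s\<in>carrier S. s)"
    by (simp add: \<kappa>_def T_def compose_def unit_hom_def fun_eq_iff)
  have retract: "Ar P' (?r T) S \<kappa> (Ar P' S (?r T) (unit_hom S T) x) = x" if "x \<in> carrier (Ob P' S)" for x
    using module_functorD(6)[OF M' S rT S uh[OF T] \<kappa> that] module_functorD(5)[OF M' S that] comp by simp
  show ?thesis
    using eq retract[OF functor_homD(1)[OF f S algebra_actionD(1)[OF act S a p]]]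
      retract[OF algebra_actionD(1)[OF act' S a fp]] by metis
qed

theorem proposition4p13:
  fixes K :: "'u ring"
    and A :: "('u, 'a) alg_functor"
    and P :: "('u, 'p) mod_functor" and act :: "'u alg \<Rightarrow> 'a \<Rightarrow> 'p \<Rightarrow> 'p"
    and P' :: "('u, 'q) mod_functor" and act' :: "'u alg \<Rightarrow> 'a \<Rightarrow> 'q \<Rightarrow> 'q"
    and f :: "'u alg \<Rightarrow> 'p \<Rightarrow> 'q"
  assumes "field K"
    and "algebra_functor K A"
    and "D_proquasi_coherent K (underlying A)"
    and "proquasi_coherent TYPE('i) TYPE('v) K P"
    and "proquasi_coherent TYPE('j) TYPE('w) K P'"
    and "algebra_action K A P act"
    and "algebra_action K A P' act'"
    and "f \<in> functor_hom K P P'"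
  shows "f \<in> algebra_functor_hom K A P act P' act' \<longleftrightarrow>
    f (regular K) \<in> linear_maps (AOb A (regular K))
      (action_module P act (regular K)) (action_module P' act' (regular K))"
proof
  interpret K: field K by fact
  note R = algebra_regular[OF K.is_cring]
  show "f (regular K) \<in> linear_maps (AOb A (regular K))
      (action_module P act (regular K)) (action_module P' act' (regular K))"
    if "f \<in> algebra_functor_hom K A P act P' act'"
    using that R by (simp add: algebra_functor_hom_def)
  assume fK: "f (regular K) \<in> linear_maps (AOb A (regular K))
      (action_module P act (regular K)) (action_module P' act' (regular K))"
  have M: "module_functor K P" using assms(4) by (simp add: proquasi_coherent_def)
  have const: "f S (act S (scalar_ext K A S a) p) = act' S (scalar_ext K A S a) (f S p)"
    if "a \<in> carrier (AOb A (regular K))" "algebra K S" "p \<in> carrier (Ob P S)" for a S p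
  proof (rule functor_hom_commutes_constant_scalars[OF assms(1,2,4,5,6,7,8) that(1) _ that(2,3)])
    show "f (regular K) (act (regular K) a q) = act' (regular K) a (f (regular K) q)"
      if "q \<in> carrier (Ob P (regular K))" for q
      using fK \<open>a \<in> carrier (AOb A (regular K))\<close> that by (simp add: linear_maps_def)
  qed
  have "f S (act S a p) = act' S a (f S p)"
    if "algebra K S" "a \<in> carrier (AOb A S)" "p \<in> carrier (Ob P S)" for S a p
    by (rule functor_hom_commutes_action[OF assms(1-3) M assms(5-8) const that])
  moreover have "f S \<in> linear_maps S (Ob P S) (Ob P' S)" if "algebra K S" for S
    using assms(8) that by (simp add: functor_hom_def)
  ultimately show "f \<in> algebra_functor_hom K A P act P' act'"
    using assms(8) by (simp add: algebra_functor_hom_def linear_maps_def)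
qed

end
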